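(* There exists an efficient (polynomial-time in $n$) algorithm that, given a non-negative submodular function $f\colon 2^{\mathcal{N}} \to \mathbb{R}^+$ (accessed via a value oracle) and an integer cardinality parameter $1 \leq k \leq n$, achieves an approximation ratio of $e^{-1} - o(1)$ for the problem $\max\{f(S) : S\subseteq \mathcal{N},\ |S| = k\}$.
   Context: $\mathcal{N}$ is a finite ground set with $n=|\mathcal{N}|$. $f$ is submodular if $f(A)+f(B)\ge f(A\cup B)+f(A\cap B)$ for all $A,B\subseteq\mathcal{N}$. A value oracle returns $f(S)$ for a queried $S$. An approximation ratio $\alpha$ means the (expected) value of the output feasible set is at least $\alpha$ times the optimum. The $o(1)$ term tends to $0$ as $n\to\infty$. *)

theory Defs
  imports "HOL-Probability.Probability" "HOL-Computational_Algebra.Polynomial"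
begin

section \<open>Submodular maximization under an exact cardinality constraint\<close>

definition submodular_on :: "'a set \<Rightarrow> ('a set \<Rightarrow> real) \<Rightarrow> bool" where
  "submodular_on N f \<longleftrightarrow>
     (\<forall>A B. A \<subseteq> N \<longrightarrow> B \<subseteq> N \<longrightarrow> f A + f B \<ge> f (A \<union> B) + f (A \<inter> B))"

definition nonneg_on :: "'a set \<Rightarrow> ('a set \<Rightarrow> real) \<Rightarrow> bool" where
  "nonneg_on N f \<longleftrightarrow> (\<forall>S. S \<subseteq> N \<longrightarrow> 0 \<le> f S)"

definition feasible :: "'a set \<Rightarrow> nat \<Rightarrow> 'a set set" where
  "feasible N k = {S. S \<subseteq> N \<and> card S = k}"

definition opt_value :: "'a set \<Rightarrow> ('a set \<Rightarrow> real) \<Rightarrow> nat \<Rightarrow> real" where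
  "opt_value N f k = Max (f ` feasible N k)"


section \<open>Randomized programs with a value oracle\<close>

text \<open>
  The machine is a random access machine with unit-cost instructions, working on natural
  numbers and, since oracle answers are arbitrary reals, on real numbers.  Scalars and arrays
  are named by numbers fixed in the program text; array cells are addressed by computed indices.

  The instruction set is deliberately weak, so that a polynomial number of steps really is
  polynomial time.  On naturals there are only addition and truncated subtraction: after \<open>t\<close>
  steps every number has \<open>O(t)\<close> more bits than the input.  (Unit-cost multiplication would
  yield numbers of exponential length.)  On reals there are only addition, subtraction and
  comparison, and no conversion back to naturals.
\<close>

datatype nexp =
    NConst nat
  | NVar nat
  | NArr nat nexp
  | NAdd nexp nexp
  | NSub nexp nexp

datatype rexp =
    RZero
  | ROne
  | RVar nat
  | RArr nat nexp
  | RAdd rexp rexp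
  | RSub rexp rexp

datatype bexp =
    NLess nexp nexp
  | RLess rexp rexp
  | BNot bexp
  | BAnd bexp bexp

datatype com =
    Skip
  | NAssign nat nexp
  | NStore nat nexp nexp
  | RAssign nat rexp
  | RStore nat nexp rexp
  | Query nat nat
  | Rand nat nexp
  | Seq com com
  | If bexp com com
  | While bexp com

record state =
  nvar :: "nat \<Rightarrow> nat"
  narr :: "nat \<Rightarrow> nat \<Rightarrow> nat"
  rvar :: "nat \<Rightarrow> real"
  rarr :: "nat \<Rightarrow> nat \<Rightarrow> real"

primrec nval :: "state \<Rightarrow> nexp \<Rightarrow> nat" where
  "nval s (NConst c) = c"
| "nval s (NVar x) = nvar s x"
| "nval s (NArr a i) = narr s a (nval s i)"
| "nval s (NAdd u v) = nval s u + nval s v"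
| "nval s (NSub u v) = nval s u - nval s v"

primrec rval :: "state \<Rightarrow> rexp \<Rightarrow> real" where
  "rval s RZero = 0"
| "rval s ROne = 1"
| "rval s (RVar x) = rvar s x"
| "rval s (RArr a i) = rarr s a (nval s i)"
| "rval s (RAdd u v) = rval s u + rval s v"
| "rval s (RSub u v) = rval s u - rval s v"

primrec bval :: "state \<Rightarrow> bexp \<Rightarrow> bool" where
  "bval s (NLess u v) \<longleftrightarrow> nval s u < nval s v"
| "bval s (RLess u v) \<longleftrightarrow> rval s u < rval s v"
| "bval s (BNot b) \<longleftrightarrow> \<not> bval s b"
| "bval s (BAnd b c) \<longleftrightarrow> bval s b \<and> bval s c"

text \<open>
  The ground set is presented to the machine as the index set \<open>{..<n}\<close>; a subset is passed
  to the oracle, and returned as the output, as a 0/1-array (nonzero meaning membership).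
\<close>

definition array_set :: "nat \<Rightarrow> state \<Rightarrow> nat \<Rightarrow> nat set" where
  "array_set n s a = {i. i < n \<and> narr s a i \<noteq> 0}"

text \<open>
  A configuration consists of the stack of commands still to be executed and the memory;
  it is halted when the stack is empty.  \<open>Query x a\<close> stores the oracle's value of the set held
  in array \<open>a\<close>; \<open>Rand x u\<close> draws uniformly and independently from \<open>{0, \<dots>, u}\<close>.
\<close>

type_synonym config = "com list \<times> state"

fun step :: "nat \<Rightarrow> (nat set \<Rightarrow> real) \<Rightarrow> config \<Rightarrow> config pmf" where
  "step n g ([], s) = return_pmf ([], s)"
| "step n g (Skip # K, s) = return_pmf (K, s)"
| "step n g (NAssign x u # K, s) =
     return_pmf (K, s\<lparr>nvar := (nvar s)(x := nval s u)\<rparr>)"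
| "step n g (NStore a i u # K, s) =
     return_pmf (K, s\<lparr>narr := (narr s)(a := (narr s a)(nval s i := nval s u))\<rparr>)"
| "step n g (RAssign x u # K, s) =
     return_pmf (K, s\<lparr>rvar := (rvar s)(x := rval s u)\<rparr>)"
| "step n g (RStore a i u # K, s) =
     return_pmf (K, s\<lparr>rarr := (rarr s)(a := (rarr s a)(nval s i := rval s u))\<rparr>)"
| "step n g (Query x a # K, s) =
     return_pmf (K, s\<lparr>rvar := (rvar s)(x := g (array_set n s a))\<rparr>)"
| "step n g (Rand x u # K, s) =
     map_pmf (\<lambda>r. (K, s\<lparr>nvar := (nvar s)(x := r)\<rparr>)) (pmf_of_set {0..nval s u})"
| "step n g (Seq c d # K, s) = return_pmf (c # d # K, s)"
| "step n g (If b c d # K, s) = return_pmf ((if bval s b then c else d) # K, s)"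
| "step n g (While b c # K, s) =
     return_pmf (if bval s b then c # While b c # K else K, s)"

primrec steps :: "nat \<Rightarrow> (nat set \<Rightarrow> real) \<Rightarrow> nat \<Rightarrow> config \<Rightarrow> config pmf" where
  "steps n g 0 c = return_pmf c"
| "steps n g (Suc t) c = bind_pmf (step n g c) (steps n g t)"

definition init_state :: "nat \<Rightarrow> nat \<Rightarrow> state" where
  "init_state n k = \<lparr>nvar = (\<lambda>_. 0)(0 := n, 1 := k), narr = (\<lambda>_ _. 0),
                     rvar = (\<lambda>_. 0), rarr = (\<lambda>_ _. 0)\<rparr>"

definition halted :: "config \<Rightarrow> bool" where
  "halted c \<longleftrightarrow> fst c = []"

text \<open>
  For an instance \<open>(N, f, k)\<close> whose ground set is numbered by \<open>e\<close>, the distribution of the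
  configuration after \<open>t\<close> steps, and the subset of \<open>N\<close> that a configuration holds as its
  output (in array 0).  The function \<open>f\<close> is accessible to the program through \<open>Query\<close> only.
\<close>

definition run :: "com \<Rightarrow> 'a set \<Rightarrow> (nat \<Rightarrow> 'a) \<Rightarrow> ('a set \<Rightarrow> real) \<Rightarrow> nat \<Rightarrow> nat \<Rightarrow> config pmf" where
  "run P N e f k t = steps (card N) (\<lambda>I. f (e ` I)) t ([P], init_state (card N) k)"

definition output_set :: "'a set \<Rightarrow> (nat \<Rightarrow> 'a) \<Rightarrow> config \<Rightarrow> 'a set" where
  "output_set N e c = e ` array_set (card N) (snd c) 0"

end

theory Submission
  imports Defs
begin

text \<open>
  Three regimes of \<open>k / n\<close> are treated separately, each with a potential function whose expectation
  does not decrease.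

  If \<open>10 k \<le> n\<close>, random greedy adds in each of \<open>k\<close> rounds a uniformly random one of the \<open>k\<close> best
  elements.  This alone reaches \<open>1 / e\<close> up to a loss of order \<open>k / n\<close>, which vanishes for bounded \<open>k\<close>.
  For larger \<open>k\<close> an approximate local optimum \<open>Z\<close> with respect to swaps is computed first, and random
  greedy avoids \<open>Z\<close> during its first \<open>2 k / 5\<close> rounds.  Local optimality gives
  \<open>f (OPT \<union> Z) + f (OPT \<inter> Z) \<le> 2 f Z\<close> up to a negligible error, so either \<open>Z\<close> is good enough itself or
  avoiding it keeps \<open>f (OPT \<union> S)\<close> large; in the latter case the ratio exceeds \<open>1 / e\<close> by a constant
  margin, which pays for the loss.  If \<open>10 (n - k) \<le> n\<close>, the same algorithm is run on the complement
  function.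

  Otherwise double greedy is used.  A state is a pair \<open>X \<subseteq> Y\<close>; a uniformly random undecided element
  \<open>u\<close> is added to \<open>X\<close> with probability \<open>p u\<close> and removed from \<open>Y\<close> otherwise, where \<open>\<Sum>u. p u\<close> is the
  number of elements still to be picked.  The \<open>p u\<close> are the usual double greedy probabilities for the
  marginals shifted by a common Lagrange multiplier \<open>\<theta>\<close>.  Splitting each element into \<open>4096\<close> tokens, the
  multiplier is found without division, by sorting the tokens.  The gain of the mixture
  \<open>(1 - \<rho>) f X + \<rho> f Y\<close>, with \<open>\<rho>\<close> the fraction of the undecided elements to be picked, pays \<open>1 / 1.69\<close>
  of the loss of \<open>f (X \<union> (OPT \<inter> Y))\<close>, apart from \<open>\<theta>\<close> times the deviation of \<open>|OPT \<inter> (Y - X)|\<close> from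
  the number still to be picked, which a quadratic term of the potential absorbs.  This gives the ratio
  \<open>1 / 2.7 > 1 / e\<close>, up to lower order terms.
\<close>

section \<open>Averages and lowest elements\<close>

definition average :: "'a set \<Rightarrow> ('a \<Rightarrow> real) \<Rightarrow> real" where
  "average A h = sum h A / real (card A)"

lemma average_add: "average A (\<lambda>x. h x + h' x) = average A h + average A h'"
  by (simp add: average_def sum.distrib add_divide_distrib)

lemma average_cmult: "average A (\<lambda>x. c * h x) = c * average A h"
  by (simp add: average_def sum_distrib_left)

lemma average_const: "finite A \<Longrightarrow> A \<noteq> {} \<Longrightarrow> average A (\<lambda>_. c) = c"
  by (simp add: average_def)

lemma average_mono: "(\<And>x. x \<in> A \<Longrightarrow> h x \<le> h' x) \<Longrightarrow> average A h \<le> average A h'"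
  unfolding average_def by (intro divide_right_mono sum_mono) auto

lemma average_cong: "(\<And>x. x \<in> A \<Longrightarrow> h x = h' x) \<Longrightarrow> average A h = average A h'"
  by (simp add: average_def cong: sum.cong)

lemma average_nonneg: "(\<And>x. x \<in> A \<Longrightarrow> 0 \<le> h x) \<Longrightarrow> 0 \<le> average A h"
  unfolding average_def by (intro divide_nonneg_nonneg sum_nonneg) auto

lemma average_image: "inj_on \<sigma> A \<Longrightarrow> average (\<sigma> ` A) h = average A (h \<circ> \<sigma>)"
  by (simp add: average_def sum.reindex card_image)

definition split_average :: "'a set \<Rightarrow> ('a \<Rightarrow> real) \<Rightarrow> ('a \<Rightarrow> real) \<Rightarrow> ('a \<Rightarrow> real) \<Rightarrow> real" where
  "split_average A p V W = average A (\<lambda>x. p x * V x + (1 - p x) * W x)"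

lemma split_average_add:
  "split_average A p (\<lambda>x. V x + V' x) (\<lambda>x. W x + W' x)
      = split_average A p V W + split_average A p V' W'"
  unfolding split_average_def average_add[symmetric]
  by (intro average_cong) (simp add: algebra_simps)

lemma split_average_cmult:
  "split_average A p (\<lambda>x. c * V x) (\<lambda>x. c * W x) = c * split_average A p V W"
  unfolding split_average_def average_cmult[symmetric]
  by (intro average_cong) (simp add: algebra_simps)

lemma split_average_const:
  assumes "finite A" "A \<noteq> {}"
  shows "split_average A p (\<lambda>_. c) (\<lambda>_. c) = c"
  using average_const[OF assms, of c] by (simp add: split_average_def algebra_simps)

lemma split_average_cong:
  assumes "\<And>x. x \<in> A \<Longrightarrow> V x = V' x" "\<And>x. x \<in> A \<Longrightarrow> W x = W' x"
  shows "split_average A p V W = split_average A p V' W'"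
  unfolding split_average_def using assms by (intro average_cong) simp

lemma split_average_mono:
  assumes "\<And>x. x \<in> A \<Longrightarrow> 0 \<le> p x \<and> p x \<le> 1"
    and "\<And>x. x \<in> A \<Longrightarrow> V x \<le> V' x" "\<And>x. x \<in> A \<Longrightarrow> W x \<le> W' x"
  shows "split_average A p V W \<le> split_average A p V' W'"
  unfolding split_average_def using assms by (intro average_mono add_mono mult_left_mono) auto

lemma split_average_square_shift_le:
  assumes A: "finite A" "A \<noteq> {}" and p: "\<And>x. x \<in> A \<Longrightarrow> 0 \<le> p x \<and> p x \<le> 1"
    and centred: "split_average A p V W = 0"
    and bounded: "\<And>x. x \<in> A \<Longrightarrow> \<bar>V x\<bar> \<le> K" "\<And>x. x \<in> A \<Longrightarrow> \<bar>W x\<bar> \<le> K"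
  shows "split_average A p (\<lambda>x. (z + V x)\<^sup>2) (\<lambda>x. (z + W x)\<^sup>2) \<le> z\<^sup>2 + K\<^sup>2"
proof -
  have square_le: "t\<^sup>2 \<le> K\<^sup>2" if "\<bar>t\<bar> \<le> K" for t
    using power_mono[OF that, of 2] by simp
  have "split_average A p (\<lambda>x. (z + V x)\<^sup>2) (\<lambda>x. (z + W x)\<^sup>2)
      \<le> split_average A p (\<lambda>x. (z\<^sup>2 + K\<^sup>2) + (2 * z) * V x) (\<lambda>x. (z\<^sup>2 + K\<^sup>2) + (2 * z) * W x)"
    using p bounded square_le by (intro split_average_mono) (auto simp: power2_sum)
  also have "\<dots> = z\<^sup>2 + K\<^sup>2"
    unfolding split_average_add split_average_cmult split_average_const[OF A] centred by simp
  finally show ?thesis .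
qed

definition lowest :: "('a \<Rightarrow> real) \<Rightarrow> 'a set \<Rightarrow> 'a set \<Rightarrow> bool" where
  "lowest key A T \<longleftrightarrow> T \<subseteq> A \<and> (\<forall>x\<in>T. \<forall>y\<in>A - T. key x \<le> key y)"

lemma lowest_threshold:
  assumes "finite A" "lowest key A T"
  obtains t where "\<And>x. x \<in> T \<Longrightarrow> key x \<le> t" "\<And>y. y \<in> A - T \<Longrightarrow> t \<le> key y"
proof (cases "A - T = {}")
  case True
  show thesis
    by (rule that[of "Max (key ` A)"]) (use True assms in \<open>auto simp: lowest_def\<close>)
next
  case False
  then have "key x \<le> Min (key ` (A - T))" if "x \<in> T" for x
    using assms that by (subst Min_ge_iff) (auto simp: lowest_def)
  then show thesis
    by (rule that[of "Min (key ` (A - T))"]) (use assms in auto)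
qed

lemma lowest_singleton: "lowest key A {x} \<longleftrightarrow> x \<in> A \<and> (\<forall>y\<in>A. key x \<le> key y)"
  by (auto simp: lowest_def)

lemma lowest_fst:
  assumes "lowest (\<lambda>x. key (fst x)) (E \<times> {c}) T"
  shows "lowest key E (fst ` T)" "inj_on fst T"
proof -
  have T: "T \<subseteq> E \<times> {c}" and low: "\<And>x y. x \<in> T \<Longrightarrow> y \<in> E \<times> {c} - T \<Longrightarrow> key (fst x) \<le> key (fst y)"
    using assms by (auto simp: lowest_def)
  show "inj_on fst T" using T by (auto simp: inj_on_def)
  have "key u \<le> key v" if "u \<in> fst ` T" "v \<in> E - fst ` T" for u v
  proof -
    have "(u, c) \<in> T" "(v, c) \<in> E \<times> {c} - T" using that T by (auto simp: image_iff)
    then show ?thesis using low by fastforce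
  qed
  then show "lowest key E (fst ` T)" using T by (auto simp: lowest_def)
qed

lemma sum_lowest_le:
  assumes A: "finite A" and T: "lowest key A T"
    and w: "\<And>x. x \<in> A \<Longrightarrow> 0 \<le> w x \<and> w x \<le> 1" and sum_w: "sum w A = real (card T)"
  shows "sum key T \<le> (\<Sum>x\<in>A. w x * key x)"
proof -
  obtain t where t: "\<And>x. x \<in> T \<Longrightarrow> key x \<le> t" "\<And>y. y \<in> A - T \<Longrightarrow> t \<le> key y"
    using lowest_threshold[OF A T] by metis
  have TA: "T \<subseteq> A" using T by (simp add: lowest_def)
  have "sum key T - real (card T) * t = (\<Sum>x\<in>A. if x \<in> T then key x - t else 0)"
    using A TA by (simp add: sum.If_cases Int_absorb1 sum_subtractf)
  also have "\<dots> \<le> (\<Sum>x\<in>A. w x * (key x - t))"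
  proof (rule sum_mono)
    fix x assume "x \<in> A"
    then show "(if x \<in> T then key x - t else 0) \<le> w x * (key x - t)"
      using t w[of x] mult_right_mono_neg[of "w x" 1 "key x - t"] by auto
  qed
  also have "\<dots> = (\<Sum>x\<in>A. w x * key x) - sum w A * t"
    by (simp add: right_diff_distrib sum_subtractf sum_distrib_right)
  finally show ?thesis unfolding sum_w by simp
qed

section \<open>Submodular functions\<close>

lemma finite_feasible: "finite N \<Longrightarrow> finite (feasible N k)"
  by (simp add: feasible_def)

lemma opt_value_ge: "finite N \<Longrightarrow> S \<in> feasible N k \<Longrightarrow> f S \<le> opt_value N f k"
  unfolding opt_value_def using finite_feasible by (intro Max_ge) auto

lemma opt_value_attained:
  assumes "finite N" "k \<le> card N"
  obtains S where "S \<subseteq> N" "card S = k" "f S = opt_value N f k"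
proof -
  have "feasible N k \<noteq> {}"
    using obtain_subset_with_card_n[OF assms(2)] unfolding feasible_def by blast
  then have "opt_value N f k \<in> f ` feasible N k"
    unfolding opt_value_def using assms finite_feasible by (intro Max_in) auto
  then show thesis using that by (auto simp: feasible_def)
qed

lemma opt_value_image:
  assumes "bij_betw e M N"
  shows "opt_value N f k = opt_value M (\<lambda>I. f (e ` I)) k"
proof -
  have inj: "inj_on e M" and N: "N = e ` M" using assms by (auto simp: bij_betw_def)
  have "feasible N k = (`) e ` feasible M k"
    unfolding feasible_def N using inj
      by (auto simp: subset_image_iff card_image inj_on_subset intro!: image_eqI)
  then show ?thesis by (simp add: opt_value_def image_image)
qed

lemma opt_value_complement:
  assumes "finite N" "k \<le> card N"
  shows "opt_value N (\<lambda>S. f (N - S)) (card N - k) = opt_value N f k"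
proof -
  have "feasible N k = (\<lambda>S. N - S) ` feasible N (card N - k)"
  proof (intro equalityI subsetI)
    fix S assume S: "S \<in> feasible N k"
    then have "N - S \<in> feasible N (card N - k)" "N - (N - S) = S"
      using assms(1) by (auto simp: feasible_def card_Diff_subset finite_subset)
    then show "S \<in> (\<lambda>S. N - S) ` feasible N (card N - k)" by (metis imageI)
  qed (use assms in \<open>auto simp: feasible_def card_Diff_subset finite_subset\<close>)
  then show ?thesis by (simp add: opt_value_def image_image)
qed

locale nonneg_submodular =
  fixes U :: "'a set" and f :: "'a set \<Rightarrow> real"
  assumes finite_ground: "finite U"
    and submodular: "submodular_on U f"
    and nonneg_on: "nonneg_on U f"
begin

abbreviation "add_gain S u \<equiv> f (insert u S) - f S"
abbreviation "remove_gain S u \<equiv> f (S - {u}) - f S"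

lemma union_inter_le: "A \<subseteq> U \<Longrightarrow> B \<subseteq> U \<Longrightarrow> f (A \<union> B) + f (A \<inter> B) \<le> f A + f B"
  using submodular by (auto simp: submodular_on_def)

lemma nonneg: "A \<subseteq> U \<Longrightarrow> 0 \<le> f A"
  using nonneg_on by (auto simp: nonneg_on_def)

lemma finite_sub: "A \<subseteq> U \<Longrightarrow> finite A"
  using finite_ground by (rule finite_subset[rotated])

lemma nonneg_submodular_complement: "nonneg_submodular U (\<lambda>S. f (U - S))"
proof
  show "submodular_on U (\<lambda>S. f (U - S))"
    unfolding submodular_on_def
  proof (intro allI impI)
    fix A B assume "A \<subseteq> U" "B \<subseteq> U"
    then show "f (U - (A \<union> B)) + f (U - (A \<inter> B)) \<le> f (U - A) + f (U - B)"
      using union_inter_le[of "U - A" "U - B"] by (simp add: Diff_Un Diff_Int)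
  qed
qed (auto simp: nonneg_on_def finite_ground intro: nonneg)

lemma add_gain_antimono:
  assumes "A \<subseteq> B" "B \<subseteq> U" "u \<in> U" "u \<notin> B"
  shows "add_gain B u \<le> add_gain A u"
proof -
  have "insert u A \<union> B = insert u B" "insert u A \<inter> B = A"
    using assms by auto
  then show ?thesis
    using union_inter_le[of "insert u A" B] subset_trans[OF assms(1,2)] assms(2,3) by simp
qed

lemma union_le_sum_add_gain:
  assumes "A \<subseteq> U" "B \<subseteq> U"
  shows "f (A \<union> B) - f A \<le> (\<Sum>u\<in>B. add_gain A u)"
  using finite_sub[OF assms(2)] assms
proof (induction B rule: finite_induct)
  case (insert v B)
  have "add_gain (A \<union> B) v \<le> add_gain A v"
  proof (cases "v \<in> A \<union> B")
    case True
    then have "v \<in> A" using insert by auto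
    then show ?thesis by (simp add: insert_absorb)
  next
    case False
    then show ?thesis using insert.prems by (intro add_gain_antimono) auto
  qed
  then show ?case using insert by simp
qed simp

text \<open>
  Statements about removals are instances of those about additions, for the complement function.
\<close>

lemma complement_identities:
  assumes "A \<subseteq> U"
  shows "U - (U - A) = A" "U - (U - A \<union> B) = A - B" "U - insert u (U - A) = A - {u}"
  using assms by auto

lemma diff_le_sum_remove_gain:
  assumes "A \<subseteq> U" "B \<subseteq> U"
  shows "f (A - B) - f A \<le> (\<Sum>u\<in>B. remove_gain A u)"
  using nonneg_submodular.union_le_sum_add_gain[OF nonneg_submodular_complement, of
    "U - A" B] assms(2)
  by (simp add: complement_identities[OF assms(1)])

lemma neg_le_weighted_add_gain:
  assumes "A \<subseteq> U" "D \<subseteq> U" "\<And>u. u \<in> D \<Longrightarrow> 0 \<le> w u \<and> w u \<le> 1"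
  shows "- f A \<le> (\<Sum>u\<in>D. w u * add_gain A u)"
proof -
  let ?N = "{u \<in> D. add_gain A u < 0}"
  have "- f A \<le> f (A \<union> ?N) - f A"
    using nonneg[of "A \<union> ?N"] assms by auto
  also have "\<dots> \<le> (\<Sum>u\<in>?N. add_gain A u)"
    using assms by (intro union_le_sum_add_gain) auto
  also have "\<dots> = (\<Sum>u\<in>D. min 0 (add_gain A u))"
    using finite_sub[OF assms(2)] by (simp add: sum.inter_filter) (intro sum.cong, auto)
  also have "\<dots> \<le> (\<Sum>u\<in>D. w u * add_gain A u)"
  proof (rule sum_mono)
    fix u assume "u \<in> D"
    then show "min 0 (add_gain A u) \<le> w u * add_gain A u"
      using assms(3)[of u] mult_right_mono_neg[of "w u" 1 "add_gain A u"]
      by (cases "add_gain A u \<le> 0") (auto simp: min_def)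
  qed
  finally show ?thesis .
qed

lemma neg_le_weighted_remove_gain:
  assumes "A \<subseteq> U" "D \<subseteq> U" "\<And>u. u \<in> D \<Longrightarrow> 0 \<le> w u \<and> w u \<le> 1"
  shows "- f A \<le> (\<Sum>u\<in>D. w u * remove_gain A u)"
  using nonneg_submodular.neg_le_weighted_add_gain[OF nonneg_submodular_complement, of
    "U - A" D w] assms(2,3)
  by (simp add: complement_identities[OF assms(1)])

lemma exists_good_removal:
  assumes "A \<subseteq> U" "A \<noteq> {}"
  shows "\<exists>u\<in>A. (real (card A) - 1) * f A \<le> real (card A) * f (A - {u})"
proof -
  define c where "c = real (card A)"
  have c: "0 < c" using assms finite_sub[OF assms(1)] by (simp add: c_def card_gt_0_iff)
  have "\<exists>u\<in>A. - f A / c \<le> remove_gain A u"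
  proof (rule ccontr)
    assume "\<not> ?thesis"
    then have "(\<Sum>u\<in>A. remove_gain A u) < (\<Sum>u\<in>A. - f A / c)"
      using finite_sub[OF assms(1)] assms(2) by (intro sum_strict_mono) (auto simp: not_le)
    also have "\<dots> = - f A" using c by (simp add: c_def)
    also have "\<dots> \<le> f (A - A) - f A" using nonneg[of "{}"] by simp
    also have "\<dots> \<le> (\<Sum>u\<in>A. remove_gain A u)" using assms(1) by (intro diff_le_sum_remove_gain) auto
    finally show False by simp
  qed
  then show ?thesis using c by (auto simp: field_simps c_def[symmetric])
qed

lemma exists_proportional_subset:
  assumes "A \<subseteq> U" "q \<le> card A"
  shows "\<exists>Q\<subseteq>A. card Q = q \<and> real q * f A \<le> real (card A) * f Q"
  using assms
proof (induction "card A - q" arbitrary: A)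
  case 0
  then show ?case by (intro exI[of _ A]) auto
next
  case (Suc d)
  define c where "c = real (card A)"
  have c: "1 \<le> c" and q: "real q \<le> c - 1" "q \<le> card A - 1" using Suc.hyps(2) by (auto simp: c_def)
  have "A \<noteq> {}" using c by (auto simp: c_def)
  then obtain u where u: "u \<in> A" "(c - 1) * f A \<le> c * f (A - {u})"
    using exists_good_removal[OF Suc.prems(1)] by (auto simp: c_def)
  have card_diff: "card (A - {u}) = card A - 1" using u(1) by simp
  have "\<exists>Q\<subseteq>A - {u}. card Q = q \<and> real q * f (A - {u}) \<le> real (card (A - {u})) * f Q"
    using Suc.hyps Suc.prems q(2) by (intro Suc.hyps(1)) (auto simp: card_diff)
  moreover have "real (card (A - {u})) = c - 1" using c by (simp add: card_diff c_def of_nat_diff)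
  ultimately obtain Q where Q: "Q \<subseteq> A - {u}" "card Q = q" "real q * f (A - {u}) \<le> (c - 1) * f Q"
    by auto
  have "real q * f A \<le> c * f Q"
  proof (cases "c = 1")
    case True
    then show ?thesis using q(1) nonneg[of Q] Q(1) Suc.prems(1) by auto
  next
    case False
    have "(c - 1) * (real q * f A) \<le> c * (real q * f (A - {u}))"
      using mult_left_mono[OF u(2), of "real q"] by (simp add: mult_ac)
    also have "\<dots> \<le> c * ((c - 1) * f Q)" using c Q(3) by (intro mult_left_mono) auto
    finally have "(c - 1) * (real q * f A) \<le> (c - 1) * (c * f Q)" by (simp add: mult_ac)
    then show ?thesis using False c by simp
  qed
  then show ?case using Q unfolding c_def by blast
qed

lemma le_card_ratio_max:
  assumes A: "A \<subseteq> U" "k \<le> card A" and P: "\<And>S. S \<subseteq> U \<Longrightarrow> card S = k \<Longrightarrow> f S \<le> P"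
  shows "real k * f A \<le> real (card U) * P"
proof -
  obtain Q where Q: "Q \<subseteq> A" "card Q = k" "real k * f A \<le> real (card A) * f Q"
    using exists_proportional_subset[OF A] by auto
  have "real (card A) * f Q \<le> real (card U) * P"
    using Q A P[of Q] nonneg[of Q] card_mono[OF finite_ground A(1)] by (intro mult_mono) auto
  then show ?thesis using Q(3) by linarith
qed

lemma le_complement_card_ratio_max:
  assumes A: "A \<subseteq> U" "card A \<le> k" and k: "k \<le> card U"
    and P: "\<And>S. S \<subseteq> U \<Longrightarrow> card S = k \<Longrightarrow> f S \<le> P"
  shows "real (card U - k) * f A \<le> real (card U) * P"
proof -
  have card: "card (U - S) = card U - card S" if "S \<subseteq> U" for S
    using that finite_ground by (simp add: card_Diff_subset finite_subset)
  have "real (card U - k) * f (U - (U - A)) \<le> real (card U) * P"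
    using A k by (intro nonneg_submodular.le_card_ratio_max[OF nonneg_submodular_complement] P)
      (auto simp: card)
  then show ?thesis using A(1) by (simp add: complement_identities)
qed

end

lemma nonneg_submodular_image:
  assumes "finite M" "bij_betw e M N" "submodular_on N f" "nonneg_on N f"
  shows "nonneg_submodular M (\<lambda>I. f (e ` I))"
proof
  have inj: "inj_on e M" and N: "e ` M = N" using assms(2) by (auto simp: bij_betw_def)
  show "submodular_on M (\<lambda>I. f (e ` I))"
    unfolding submodular_on_def
  proof (intro allI impI)
    fix A B assume AB: "A \<subseteq> M" "B \<subseteq> M"
    then have "e ` A \<subseteq> N" "e ` B \<subseteq> N" using N by auto
    then show "f (e ` (A \<union> B)) + f (e ` (A \<inter> B)) \<le> f (e ` A) + f (e ` B)"
      using assms(3) unfolding submodular_on_def image_Un inj_on_image_Int[OF inj AB] by blast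
  qed
  show "nonneg_on M (\<lambda>I. f (e ` I))"
    using assms(4) N unfolding nonneg_on_def by (metis image_mono)
qed (rule assms(1))

section \<open>Double greedy with a cardinality budget\<close>

lemma choice_square_bounds:
  fixes p \<rho> \<delta> :: real
  assumes \<rho>: "99 / 1000 \<le> \<rho>" "\<rho> \<le> 901 / 1000" and \<delta>: "\<delta> \<le> 1 / 8192"
  defines "Q \<equiv> (1 - \<rho>) * p\<^sup>2 + \<rho> * (1 - p)\<^sup>2"
  shows "8 / 100 \<le> Q - \<delta>" "p * (1 - p) + \<delta> \<le> 169 / 100 * (Q - \<delta>)"
proof -
  have "0 \<le> (\<rho> - 99 / 1000) * (901 / 1000 - \<rho>)" using \<rho> by auto
  also have "\<dots> = \<rho> * (1 - \<rho>) - 89199 / 1000000" by (simp add: field_simps)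
  finally have \<rho>_var: "891 / 10000 \<le> \<rho> * (1 - \<rho>)" by linarith
  have "Q = \<rho> * (1 - \<rho>) + (p - \<rho>)\<^sup>2"
    unfolding Q_def by (simp add: algebra_simps power2_eq_square)
  then have Q_ge: "891 / 10000 \<le> Q" using \<rho>_var by (smt (verit) zero_le_power2)
  then show "8 / 100 \<le> Q - \<delta>" using \<delta> by linarith
  define q where "q = p * (1 - p)"
  have "4 * (1597 / 1000) * (Q - 597 / 1000 * q)
      = (2 * (1597 / 1000) * p - (2 * \<rho> + 597 / 1000))\<^sup>2 + 4 * (\<rho> * (1 - \<rho>)) - (597 / 1000)\<^sup>2"
    unfolding Q_def q_def by (simp add: field_simps power2_eq_square)
  also have "\<dots> \<ge> 4 * (891 / 10000) - (597 / 1000)\<^sup>2"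
    using \<rho>_var by (smt (verit) zero_le_power2)
  finally have "597 / 1000 * q \<le> Q + 1 / 10000" by (simp add: power2_eq_square)
  then show "p * (1 - p) + \<delta> \<le> 169 / 100 * (Q - \<delta>)"
    unfolding q_def[symmetric] using Q_ge \<delta> by argo
qed

lemma double_greedy_element:
  fixes p s a \<rho> \<delta> :: real
  assumes p: "0 \<le> p" "p \<le> 1" and s: "0 \<le> s"
    and lower: "p * (p - \<delta>) * s \<le> p * a" and upper: "(1 - p) * a \<le> (1 - p) * (p + \<delta>) * s"
    and \<rho>: "99 / 1000 \<le> \<rho>" "\<rho> \<le> 901 / 1000" and \<delta>: "0 \<le> \<delta>" "\<delta> \<le> 1 / 8192"
  defines "\<gamma> \<equiv> (1 - \<rho>) * p * a + \<rho> * (1 - p) * (s - a)"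
  shows "8 / 100 * s \<le> \<gamma>" "p * (s - a) \<le> 169 / 100 * \<gamma>" "(1 - p) * a \<le> 169 / 100 * \<gamma>"
proof -
  define Q where "Q = (1 - \<rho>) * p\<^sup>2 + \<rho> * (1 - p)\<^sup>2"
  note Q = choice_square_bounds[OF \<rho> \<delta>(2), of p, folded Q_def]
  have "(1 - \<rho>) * p + \<rho> * (1 - p) \<le> (1 - \<rho>) * 1 + \<rho> * 1"
    using p \<rho> by (intro add_mono mult_left_mono) auto
  then have "\<delta> * ((1 - \<rho>) * p + \<rho> * (1 - p)) \<le> \<delta>"
    using mult_left_mono[OF _ \<delta>(1)] by fastforce
  then have "s * (Q - \<delta>) \<le> s * (Q - \<delta> * ((1 - \<rho>) * p + \<rho> * (1 - p)))"
    using s by (intro mult_left_mono) auto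
  also have "\<dots> = (1 - \<rho>) * (p * (p - \<delta>) * s) + \<rho> * ((1 - p) * (1 - p - \<delta>) * s)"
    unfolding Q_def by (simp add: algebra_simps power2_eq_square)
  also have "\<dots> \<le> (1 - \<rho>) * (p * a) + \<rho> * ((1 - p) * (s - a))"
    using \<rho> lower upper by (intro add_mono mult_left_mono) (auto simp: algebra_simps)
  finally have \<gamma>_ge: "s * (Q - \<delta>) \<le> \<gamma>" by (simp add: \<gamma>_def mult.assoc)
  show "8 / 100 * s \<le> \<gamma>"
    using mult_left_mono[OF Q(1) s] \<gamma>_ge by (simp add: mult.commute)
  have product_le: "s * (p * (1 - p) + c * \<delta>) \<le> 169 / 100 * \<gamma>" if "c \<le> 1" for c
  proof -
    have "s * (p * (1 - p) + c * \<delta>) \<le> s * (p * (1 - p) + 1 * \<delta>)"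
      using that s \<delta> by (intro mult_left_mono add_left_mono mult_right_mono) auto
    also have "\<dots> \<le> 169 / 100 * (s * (Q - \<delta>))"
      using mult_left_mono[OF Q(2) s] by (simp add: mult_ac)
    finally show ?thesis using \<gamma>_ge by linarith
  qed
  have "p * (s - a) \<le> s * (p * (1 - p) + p * \<delta>)" "(1 - p) * a \<le> s * (p * (1 - p) + (1 - p) * \<delta>)"
    using lower upper by (simp_all add: algebra_simps)
  then show "p * (s - a) \<le> 169 / 100 * \<gamma>" "(1 - p) * a \<le> 169 / 100 * \<gamma>"
    using product_le[of p] product_le[of "1 - p"] p by linarith+
qed

lemma shift_times_average_le:
  assumes "\<And>u. u \<in> A \<Longrightarrow> w u * (a u + \<theta>) \<le> 2 * s u" and "- c \<le> (\<Sum>u\<in>A. w u * a u)"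
  shows "\<theta> * average A w \<le> 2 * average A s + c / real (card A)"
proof -
  have "\<theta> * average A w + average A (\<lambda>u. w u * a u) = average A (\<lambda>u. w u * (a u + \<theta>))"
    unfolding average_cmult[symmetric] average_add[symmetric]
    by (intro average_cong) (simp add: algebra_simps)
  also have "\<dots> \<le> 2 * average A s"
    unfolding average_cmult[symmetric] using assms(1) by (rule average_mono)
  finally have "\<theta> * average A w + average A (\<lambda>u. w u * a u) \<le> 2 * average A s" .
  moreover have "- (c / real (card A)) \<le> average A (\<lambda>u. w u * a u)"
    unfolding average_def using divide_right_mono[OF assms(2), of "real (card A)"] by simp
  ultimately show ?thesis by linarith
qed

definition (in nonneg_submodular) mix :: "real \<Rightarrow> 'a set \<Rightarrow> 'a set \<Rightarrow> real" where
  "mix c X Y = (1 - c) * f X + c * f Y"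

text \<open>
  One round of double greedy: the undecided element \<open>u\<close>, drawn uniformly, is accepted with probability
  \<open>p u\<close>.  The set \<open>W\<close> stands for the optimum corrected by the decisions made so far.
\<close>

locale double_greedy_step = nonneg_submodular +
  fixes X Y W :: "'a set" and p :: "'a \<Rightarrow> real" and \<rho> :: real
  assumes XY: "X \<subseteq> Y" "Y \<subseteq> U" and neq: "X \<noteq> Y" and W: "X \<subseteq> W" "W \<subseteq> Y"
    and p: "\<And>u. u \<in> Y - X \<Longrightarrow> 0 \<le> p u \<and> p u \<le> 1"
    and average_p: "average (Y - X) p = \<rho>"
begin

abbreviation "D \<equiv> Y - X"
abbreviation "m \<equiv> real (card (Y - X))"
abbreviation "a u \<equiv> add_gain X u"
abbreviation "b u \<equiv> remove_gain Y u"

definition "gain = average D (\<lambda>u. (1 - \<rho>) * p u * a u + \<rho> * (1 - p u) * b u)"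
definition "loss = average D (\<lambda>u. if u \<in> W then (1 - p u) * a u else p u * b u)"

definition next_value :: "('a set \<Rightarrow> 'a set \<Rightarrow> real) \<Rightarrow> real" where
  "next_value V = split_average D p (\<lambda>u. V (insert u X) Y) (\<lambda>u. V X (Y - {u}))"

lemma X_sub: "X \<subseteq> U" and D_sub: "D \<subseteq> U"
  using XY by auto

lemma finite_D: "finite D" and D_nonempty: "D \<noteq> {}"
  using XY neq finite_sub by auto

lemma average_D_const [simp]: "average D (\<lambda>_. c) = c"
  by (rule average_const[OF finite_D D_nonempty])

lemma m_ge_1: "1 \<le> m"
  using finite_D D_nonempty by (simp add: Suc_le_eq card_gt_0_iff)

lemma rho_bounds: "0 \<le> \<rho>" "\<rho> \<le> 1"
proof -
  show "0 \<le> \<rho>" unfolding average_p[symmetric] using p by (intro average_nonneg) auto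
  have "average D p \<le> average D (\<lambda>_. 1)" using p by (intro average_mono) auto
  then show "\<rho> \<le> 1" by (simp add: average_p)
qed

lemma average_one_minus_p: "average D (\<lambda>u. 1 - p u) = 1 - \<rho>"
  using average_add[of D "\<lambda>_. 1" "\<lambda>u. - 1 * p u"]
  unfolding average_cmult average_p by simp

lemma split_average_rho: "split_average D p (\<lambda>_. \<rho> - 1) (\<lambda>_. \<rho>) = 0"
proof -
  have "split_average D p (\<lambda>_. \<rho> - 1) (\<lambda>_. \<rho>) = average D (\<lambda>u. \<rho> + - 1 * p u)"
    unfolding split_average_def by (intro average_cong) (simp add: algebra_simps)
  then show ?thesis
    unfolding average_add average_cmult average_p by simp
qed

lemma gains_nonneg:
  assumes u: "u \<in> D"
  shows "0 \<le> a u + b u"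
proof -
  have "X \<subseteq> Y - {u}" "Y - {u} \<subseteq> U" "u \<in> U" using u XY by auto
  then show ?thesis using add_gain_antimono[of X "Y - {u}" u] u by (simp add: insert_absorb)
qed

lemma opt_step: "f W - loss \<le> split_average D p (\<lambda>u. f (insert u W)) (\<lambda>u. f (W - {u}))"
proof -
  have "f W - (if u \<in> W then (1 - p u) * a u else p u * b u)
      \<le> p u * f (insert u W) + (1 - p u) * f (W - {u})" if u: "u \<in> D" for u
  proof (cases "u \<in> W")
    case True
    have "X \<subseteq> W - {u}" "W - {u} \<subseteq> U" "u \<in> U" using u W XY by auto
    then have "f W - a u \<le> f (W - {u})"
      using add_gain_antimono[of X "W - {u}" u] True by (simp add: insert_absorb)
    then have "(1 - p u) * (f W - a u) \<le> (1 - p u) * f (W - {u})"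
      using p[OF u] by (intro mult_left_mono) auto
    then show ?thesis using True by (simp add: insert_absorb algebra_simps)
  next
    case False
    then have "W \<subseteq> Y - {u}" "Y - {u} \<subseteq> U" "u \<in> U" "u \<in> Y" using u W XY by auto
    then have "f W - b u \<le> f (insert u W)"
      using add_gain_antimono[of W "Y - {u}" u] by (simp add: insert_absorb)
    then have "p u * (f W - b u) \<le> p u * f (insert u W)"
      using p[OF u] by (intro mult_left_mono) auto
    then show ?thesis using False by (simp add: algebra_simps)
  qed
  then have "average D (\<lambda>u. f W + - 1 * (if u \<in> W then (1 - p u) * a u else p u * b u))
      \<le> split_average D p (\<lambda>u. f (insert u W)) (\<lambda>u. f (W - {u}))"
    unfolding split_average_def by (intro average_mono) simp
  then show ?thesis
    unfolding average_add average_cmult by (simp add: loss_def)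
qed

lemma opt_minus_mix_le: "f W - mix \<rho> X Y \<le> m * (gain + loss)"
proof -
  let ?gain = "\<lambda>u. (1 - \<rho>) * p u * a u + \<rho> * (1 - p u) * b u"
  let ?loss = "\<lambda>u. if u \<in> W then (1 - p u) * a u else p u * b u"
  have "X \<union> (W - X) = W" "Y - (Y - W) = W" using W by auto
  then have "f W - f X \<le> (\<Sum>u\<in>W - X. a u)" "f W - f Y \<le> (\<Sum>u\<in>Y - W. b u)"
    using union_le_sum_add_gain[of X "W - X"] diff_le_sum_remove_gain[of Y "Y - W"] X_sub XY(2) W
    by (simp_all add: subset_iff)
  then have "(1 - \<rho>) * (f W - f X) + \<rho> * (f W - f Y)
      \<le> (1 - \<rho>) * (\<Sum>u\<in>W - X. a u) + \<rho> * (\<Sum>u\<in>Y - W. b u)"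
    using rho_bounds by (intro add_mono mult_left_mono) auto
  also have "\<dots> = (\<Sum>u\<in>D. if u \<in> W then (1 - \<rho>) * a u else \<rho> * b u)"
  proof -
    have "D \<inter> W = W - X" "D \<inter> - W = Y - W" using W by auto
    then show ?thesis by (simp add: sum.If_cases finite_D sum_distrib_left)
  qed
  also have "\<dots> \<le> (\<Sum>u\<in>D. ?gain u + ?loss u)"
  proof (rule sum_mono)
    fix u assume u: "u \<in> D"
    have "0 \<le> \<rho> * ((1 - p u) * (a u + b u))" "0 \<le> (1 - \<rho>) * (p u * (a u + b u))"
      using rho_bounds p[OF u] gains_nonneg[OF u] by (intro mult_nonneg_nonneg; simp)+
    then show "(if u \<in> W then (1 - \<rho>) * a u else \<rho> * b u) \<le> ?gain u + ?loss u"
      by (simp add: algebra_simps)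
  qed
  also have "\<dots> = m * (gain + loss)"
    unfolding gain_def loss_def average_add[symmetric] using m_ge_1 by (simp add: average_def)
  finally show ?thesis by (simp add: mix_def algebra_simps)
qed

lemma mix_step:
  assumes c: "0 < c"
  shows "split_average D p (\<lambda>u. mix (\<rho> + (\<rho> - 1) / c) (insert u X) Y)
      (\<lambda>u. mix (\<rho> + \<rho> / c) X (Y - {u}))
    = mix \<rho> X Y + (1 + 1 / c) * gain"
proof -
  define h where "h = (f Y - f X) / c"
  have "mix (\<rho> + (\<rho> - 1) / c) (insert u X) Y
      = (mix \<rho> X Y + h * (\<rho> - 1)) + (1 + 1 / c) * ((1 - \<rho>) * a u)" for u
    using c by (simp add: mix_def h_def field_simps)
  moreover have "mix (\<rho> + \<rho> / c) X (Y - {u}) = (mix \<rho> X Y + h * \<rho>) + (1 + 1 / c) * (\<rho> * b u)" for u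
    using c by (simp add: mix_def h_def field_simps)
  moreover have "split_average D p (\<lambda>u. (1 - \<rho>) * a u) (\<lambda>u. \<rho> * b u) = gain"
    unfolding split_average_def gain_def by (intro average_cong) (simp add: mult_ac)
  ultimately show ?thesis
    by (simp only: split_average_add split_average_cmult split_average_rho
        split_average_const[OF finite_D D_nonempty] mult_zero_right add_0_right)
qed

end

text \<open>
  The acceptance probabilities approximate the ratio \<open>(a u + \<theta>) / (a u + b u)\<close> clipped to the unit
  interval; multiplied through, the approximation needs no case distinction for clipped values.
\<close>

locale double_greedy_threshold = double_greedy_step +
  fixes \<theta> \<delta> :: real
  assumes lower: "\<And>u. u \<in> D \<Longrightarrow> p u * (p u - \<delta>) * (a u + b u) \<le> p u * (a u + \<theta>)"
    and upper: "\<And>u. u \<in> D \<Longrightarrow> (1 - p u) * (a u + \<theta>) \<le> (1 - p u) * (p u + \<delta>) * (a u + b u)"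
    and gap: "\<And>u. u \<in> D \<Longrightarrow> 0 \<le> p u * (p u - \<delta>)" "\<And>u. u \<in> D \<Longrightarrow> 0 \<le> (1 - p u) * (1 - p u - \<delta>)"
    and \<delta>: "0 \<le> \<delta>" "\<delta> \<le> 1 / 8192"
begin

definition "shifted_gain u = (1 - \<rho>) * p u * (a u + \<theta>) + \<rho> * (1 - p u) * (b u - \<theta>)"

lemma average_shifted_gain: "average D shifted_gain = gain"
proof -
  have "average D shifted_gain = gain + \<theta> * ((1 - \<rho>) * average D p + - \<rho> * average D (\<lambda>u. 1 - p u))"
    unfolding gain_def average_cmult[symmetric] average_add[symmetric]
    by (intro average_cong) (simp add: shifted_gain_def algebra_simps)
  then show ?thesis by (simp add: average_p average_one_minus_p mult.commute)
qed

lemma upper_complement: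
  assumes "u \<in> D"
  shows "(1 - p u) * (1 - p u - \<delta>) * (a u + b u) \<le> (1 - p u) * (b u - \<theta>)"
  using upper[OF assms] by (simp add: algebra_simps)

lemma gain_nonneg: "0 \<le> gain"
proof -
  have "0 \<le> shifted_gain u" if u: "u \<in> D" for u
  proof -
    have "0 \<le> p u * (a u + \<theta>)"
      using mult_nonneg_nonneg[OF gap(1) gains_nonneg] lower u by (meson order_trans)
    moreover have "0 \<le> (1 - p u) * (b u - \<theta>)"
      using mult_nonneg_nonneg[OF gap(2) gains_nonneg] upper_complement u by (meson order_trans)
    ultimately show ?thesis
      unfolding shifted_gain_def mult.assoc using rho_bounds
      by (intro add_nonneg_nonneg[OF mult_nonneg_nonneg mult_nonneg_nonneg]) auto
  qed
  then show ?thesis unfolding average_shifted_gain[symmetric] by (rule average_nonneg)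
qed

context
  assumes \<rho>: "99 / 1000 \<le> \<rho>" "\<rho> \<le> 901 / 1000"
begin

lemma shifted_gain_ge:
  assumes u: "u \<in> D"
  shows "8 / 100 * (a u + b u) \<le> shifted_gain u"
    "p u * (b u - \<theta>) \<le> 169 / 100 * shifted_gain u"
    "(1 - p u) * (a u + \<theta>) \<le> 169 / 100 * shifted_gain u"
proof -
  have shift: "a u + b u - (a u + \<theta>) = b u - \<theta>" by simp
  note element = double_greedy_element[OF conjunct1[OF p[OF u]] conjunct2[OF p[OF u]]
      gains_nonneg[OF u] lower[OF u] upper[OF u] \<rho> \<delta>, unfolded shift, folded shifted_gain_def]
  show "8 / 100 * (a u + b u) \<le> shifted_gain u" by (rule element(1))
  show "p u * (b u - \<theta>) \<le> 169 / 100 * shifted_gain u" by (rule element(2))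
  show "(1 - p u) * (a u + \<theta>) \<le> 169 / 100 * shifted_gain u" by (rule element(3))
qed

lemma loss_le: "loss \<le> 169 / 100 * gain + \<theta> * (\<rho> - average D (\<lambda>u. of_bool (u \<in> W)))"
proof -
  have "loss = average D (\<lambda>u. (if u \<in> W then (1 - p u) * (a u + \<theta>) else p u * (b u - \<theta>))
      + \<theta> * (p u + - 1 * of_bool (u \<in> W)))"
    unfolding loss_def by (intro average_cong) (simp add: algebra_simps)
  also have "\<dots> \<le> average D (\<lambda>u. 169 / 100 * shifted_gain u + \<theta> * (p u + - 1 * of_bool (u \<in> W)))"
    using shifted_gain_ge by (intro average_mono add_right_mono) simp
  also have "\<dots> = 169 / 100 * gain + \<theta> * (\<rho> - average D (\<lambda>u. of_bool (u \<in> W)))"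
    unfolding average_add average_cmult average_shifted_gain average_p by simp
  finally show ?thesis .
qed

lemma shift_le:
  assumes G: "f X \<le> G" "f Y \<le> G"
  shows "\<theta> * (1 - \<rho>) \<le> 2 * average D (\<lambda>u. a u + b u) + G / m"
    and "- \<theta> * \<rho> \<le> 2 * average D (\<lambda>u. a u + b u) + G / m"
proof -
  have mass_le: "w * (c * (a u + b u)) \<le> 2 * (a u + b u)"
    if "u \<in> D" "0 \<le> w" "w \<le> 1" "0 \<le> c" "c \<le> 2" for u w c
  proof -
    have "w * c \<le> 1 * 2" using that by (intro mult_mono) auto
    then have "w * c * (a u + b u) \<le> 2 * (a u + b u)"
      using gains_nonneg[OF that(1)] by (intro mult_right_mono) auto
    then show ?thesis by (simp add: mult.assoc)
  qed
  show "\<theta> * (1 - \<rho>) \<le> 2 * average D (\<lambda>u. a u + b u) + G / m"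
    unfolding average_one_minus_p[symmetric]
  proof (rule shift_times_average_le)
    show "(1 - p u) * (a u + \<theta>) \<le> 2 * (a u + b u)" if "u \<in> D" for u
      using upper[OF that] mass_le[OF that, of "1 - p u" "p u + \<delta>"] p[OF that] \<delta>
        by (simp add: mult.assoc)
    show "- G \<le> (\<Sum>u\<in>D. (1 - p u) * a u)"
      using neg_le_weighted_add_gain[OF X_sub D_sub, of "\<lambda>u. 1 - p u"] p G(1) by fastforce
  qed
  show "- \<theta> * \<rho> \<le> 2 * average D (\<lambda>u. a u + b u) + G / m"
    unfolding average_p[symmetric]
  proof (rule shift_times_average_le)
    show "p u * (b u + - \<theta>) \<le> 2 * (a u + b u)" if "u \<in> D" for u
      using lower[OF that] mass_le[OF that, of "p u" "1 - p u + \<delta>"] p[OF that] \<delta>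
      by (simp add: algebra_simps)
    show "- G \<le> (\<Sum>u\<in>D. p u * b u)"
      using neg_le_weighted_remove_gain[OF XY(2) D_sub, of p] p G(2) by fastforce
  qed
qed

lemma abs_shift_le:
  assumes G: "f X \<le> G" "f Y \<le> G"
  shows "\<bar>\<theta>\<bar> \<le> 300 * gain + 11 * G / m"
proof -
  define s where "s = average D (\<lambda>u. a u + b u)"
  have "8 / 100 * s \<le> gain"
    unfolding s_def average_shifted_gain[symmetric] average_cmult[symmetric]
    by (intro average_mono shifted_gain_ge)
  moreover have "99 / 1000 * \<bar>\<theta>\<bar> \<le> max (\<theta> * (1 - \<rho>)) (- \<theta> * \<rho>)"
  proof (cases "0 \<le> \<theta>")
    case True
    then have "\<theta> * (99 / 1000) \<le> \<theta> * (1 - \<rho>)" using \<rho> by (intro mult_left_mono) auto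
    then show ?thesis using True by auto
  next
    case False
    then have "- \<theta> * (99 / 1000) \<le> - \<theta> * \<rho>" using \<rho> by (intro mult_left_mono) auto
    then show ?thesis using False by linarith
  qed
  moreover have "0 \<le> G / m" using G(1) nonneg[OF X_sub] by simp
  ultimately show ?thesis
    using gain_nonneg shift_le[OF G, folded s_def] unfolding times_divide_eq_right[symmetric]
      by linarith
qed

end
end

definition share :: "nat \<Rightarrow> 'a set \<Rightarrow> 'a set \<Rightarrow> real" where
  "share k X Y = (real k - real (card X)) / real (card (Y - X))"

definition overlap :: "'a set \<Rightarrow> 'a set \<Rightarrow> 'a set \<Rightarrow> real" where
  "overlap OPT X Y = real (card (OPT \<inter> (Y - X))) / real (card (Y - X))"

definition imbalance :: "'a set \<Rightarrow> nat \<Rightarrow> real \<Rightarrow> 'a set \<Rightarrow> 'a set \<Rightarrow> real" where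
  "imbalance OPT k r X Y = (share k X Y - overlap OPT X Y)\<^sup>2 + (share k X Y - r)\<^sup>2"

locale double_greedy_potential = nonneg_submodular +
  fixes OPT :: "'a set" and k :: nat and r G \<epsilon> :: real and M :: nat
  assumes r: "1 / 10 \<le> r" "r \<le> 9 / 10"
    and G: "\<And>A. A \<subseteq> U \<Longrightarrow> f A \<le> G"
    and \<epsilon>: "0 < \<epsilon>" "\<epsilon> \<le> 1 / 30000" and M: "1 \<le> M"
begin

definition "penalty = 27 / 10 * G / \<epsilon>\<^sup>2"
definition "error = 11 * G * \<epsilon> / real M + 5 * penalty / (real M)\<^sup>2"

definition early_pot :: "'a set \<Rightarrow> 'a set \<Rightarrow> real" where
  "early_pot X Y = (let m = real (card (Y - X)) in
    (17 / 10 + M / m) * mix (share k X Y) X Y + (1 - M / m) * f (X \<union> OPT \<inter> Y) - (m - M) * error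
      - penalty * imbalance OPT k r X Y)"

text \<open>
  Once at most \<open>M\<close> elements are undecided, random fluctuations of the cardinalities are no longer
  controlled, and only the monotonicity of the mixture is used.
\<close>

definition pot :: "'a set \<Rightarrow> 'a set \<Rightarrow> real" where
  "pot X Y = max 0 (if card (Y - X) \<le> M then 27 / 10 * mix (share k X Y) X Y else early_pot X Y)"

lemma G_nonneg: "0 \<le> G"
  using G[of "{}"] nonneg[of "{}"] by simp

lemma penalty_nonneg: "0 \<le> penalty"
  using G_nonneg by (simp add: penalty_def)

lemma error_nonneg: "0 \<le> error"
  using G_nonneg penalty_nonneg \<epsilon> by (simp add: error_def)

lemma pot_nonneg: "0 \<le> pot X Y"
  by (simp add: pot_def)

lemma pot_same: "A \<subseteq> U \<Longrightarrow> pot A A = 27 / 10 * f A"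
  using nonneg by (simp add: pot_def mix_def share_def)

lemma early_pot_le_pot:
  assumes "M \<le> card (Y - X)"
  shows "early_pot X Y \<le> pot X Y"
proof (cases "card (Y - X) = M")
  case True
  have "0 \<le> penalty * imbalance OPT k r X Y"
    using penalty_nonneg by (simp add: imbalance_def)
  then show ?thesis using True M by (simp add: pot_def early_pot_def Let_def)
qed (use assms in \<open>simp add: pot_def\<close>)

end

locale double_greedy_round =
  double_greedy_potential U f OPT k r G \<epsilon> M +
  double_greedy_threshold U f X Y "X \<union> OPT \<inter> Y" p "share k X Y" \<theta> \<delta>
  for U :: "'a set" and f OPT k r G \<epsilon> M X Y p \<theta> \<delta>
begin

abbreviation "W \<equiv> X \<union> OPT \<inter> Y"
abbreviation "\<rho> \<equiv> share k X Y"

lemma undecided_add: "Y - insert u X = D - {u}" and undecided_remove: "Y - {u} - X = D - {u}"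
  by auto

lemma card_undecided:
  assumes "u \<in> D"
  shows "real (card (D - {u})) = m - 1"
  using assms m_ge_1 by (simp add: of_nat_diff)

lemma share_add:
  assumes "u \<in> D" "2 \<le> m"
  shows "share k (insert u X) Y = \<rho> + (\<rho> - 1) / (m - 1)"
proof -
  have "real k - real (card X) = \<rho> * m" using assms by (simp add: share_def)
  moreover have "real (card (insert u X)) = real (card X) + 1"
    using assms finite_sub[OF X_sub] by simp
  ultimately show ?thesis
    using assms unfolding share_def[of k "insert u X"] undecided_add card_undecided[OF assms(1)]
    by (simp add: field_simps)
qed

lemma share_remove:
  assumes "u \<in> D" "2 \<le> m"
  shows "share k X (Y - {u}) = \<rho> + \<rho> / (m - 1)"
proof -
  have "real k - real (card X) = \<rho> * m" using assms by (simp add: share_def)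
  then show ?thesis
    using assms unfolding share_def[of k X "Y - {u}"] undecided_remove card_undecided[OF assms(1)]
    by (simp add: field_simps)
qed

lemma overlap_after:
  assumes "u \<in> D" "2 \<le> m"
  shows "real (card (OPT \<inter> (D - {u}))) / real (card (D - {u}))
    = overlap OPT X Y + (overlap OPT X Y - of_bool (u \<in> OPT)) / (m - 1)"
proof -
  have minus: "OPT \<inter> (D - {u}) = OPT \<inter> D - {u}" by auto
  have "real (card (OPT \<inter> D - {u})) = real (card (OPT \<inter> D)) - of_bool (u \<in> OPT)"
  proof (cases "u \<in> OPT")
    case True
    then have "card (OPT \<inter> D) = Suc (card (OPT \<inter> D - {u}))"
      using assms finite_D by (intro card.remove) auto
    then show ?thesis using True by simp
  qed simp
  also have "real (card (OPT \<inter> D)) = overlap OPT X Y * m"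
    using assms by (simp add: overlap_def)
  finally show ?thesis
    using assms unfolding minus card_undecided[OF assms(1)] by (simp add: field_simps)
qed

lemmas overlap_add = overlap_after[folded undecided_add, folded overlap_def]
  and overlap_remove = overlap_after[folded undecided_remove, folded overlap_def]

lemma average_in_OPT: "average D (\<lambda>u. of_bool (u \<in> OPT)) = overlap OPT X Y"
proof -
  have "D \<inter> {u. u \<in> OPT} = OPT \<inter> D" by auto
  then show ?thesis by (simp add: average_def overlap_def of_bool_def sum.If_cases finite_D)
qed

lemma average_in_W: "average D (\<lambda>u. of_bool (u \<in> W)) = overlap OPT X Y"
  unfolding average_in_OPT[symmetric] by (intro average_cong) auto

lemma next_mix:
  assumes "2 \<le> m"
  shows "next_value (\<lambda>X Y. mix (share k X Y) X Y) = mix \<rho> X Y + (1 + 1 / (m - 1)) * gain"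
proof -
  have "next_value (\<lambda>X Y. mix (share k X Y) X Y)
      = split_average D p (\<lambda>u. mix (\<rho> + (\<rho> - 1) / (m - 1)) (insert u X) Y)
          (\<lambda>u. mix (\<rho> + \<rho> / (m - 1)) X (Y - {u}))"
    unfolding next_value_def using share_add share_remove assms by (intro split_average_cong) simp_all
  then show ?thesis using mix_step[of "m - 1"] assms by simp
qed

lemma next_opt: "f W - loss \<le> next_value (\<lambda>X Y. f (X \<union> OPT \<inter> Y))"
proof -
  have "X \<union> OPT \<inter> (Y - {u}) = W - {u}" if "u \<in> D" for u
    using that by auto
  then have "next_value (\<lambda>X Y. f (X \<union> OPT \<inter> Y))
      = split_average D p (\<lambda>u. f (insert u W)) (\<lambda>u. f (W - {u}))"
    unfolding next_value_def by (intro split_average_cong) (simp_all del: Diff_iff)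
  then show ?thesis using opt_step by simp
qed

lemma next_share_overlap_square:
  assumes m: "2 \<le> m"
  shows "next_value (\<lambda>X Y. (share k X Y - overlap OPT X Y)\<^sup>2)
      \<le> (\<rho> - overlap OPT X Y)\<^sup>2 + (2 / (m - 1))\<^sup>2"
proof -
  define c where "c = m - 1"
  define \<phi> where "\<phi> = overlap OPT X Y"
  define t where "t u = (of_bool (u \<in> OPT) :: real)" for u
  have c: "1 \<le> c" using m by (simp add: c_def)
  have \<phi>: "0 \<le> \<phi>" "\<phi> \<le> 1"
    using m card_mono[of D "OPT \<inter> D"] finite_D by (auto simp: \<phi>_def overlap_def divide_le_eq)
  have "split_average D p (\<lambda>u. t u + - \<phi>) (\<lambda>u. t u + - \<phi>) = average D (\<lambda>u. t u + - \<phi>)"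
    unfolding split_average_def by (intro average_cong) (simp add: algebra_simps)
  also have "\<dots> = 0" unfolding average_add t_def average_in_OPT \<phi>_def by simp
  finally have centred: "split_average D p (\<lambda>u. 1 / c * ((\<rho> - 1) + (t u + - \<phi>)))
      (\<lambda>u. 1 / c * (\<rho> + (t u + - \<phi>))) = 0"
    unfolding split_average_cmult split_average_add split_average_rho by simp
  have "next_value (\<lambda>X Y. (share k X Y - overlap OPT X Y)\<^sup>2)
      = split_average D p (\<lambda>u. ((\<rho> - \<phi>) + 1 / c * ((\<rho> - 1) + (t u + - \<phi>)))\<^sup>2)
          (\<lambda>u. ((\<rho> - \<phi>) + 1 / c * (\<rho> + (t u + - \<phi>)))\<^sup>2)"
    unfolding next_value_def
  proof (rule split_average_cong)
    fix u assume u: "u \<in> D"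
    show "(share k (insert u X) Y - overlap OPT (insert u X) Y)\<^sup>2
        = ((\<rho> - \<phi>) + 1 / c * ((\<rho> - 1) + (t u + - \<phi>)))\<^sup>2"
      unfolding share_add[OF u m] overlap_add[OF u m] c_def \<phi>_def t_def
      by (simp add: diff_divide_distrib add_divide_distrib algebra_simps)
    show "(share k X (Y - {u}) - overlap OPT X (Y - {u}))\<^sup>2
        = ((\<rho> - \<phi>) + 1 / c * (\<rho> + (t u + - \<phi>)))\<^sup>2"
      unfolding share_remove[OF u m] overlap_remove[OF u m] c_def \<phi>_def t_def
      by (simp add: diff_divide_distrib add_divide_distrib algebra_simps)
  qed
  also have "\<dots> \<le> (\<rho> - \<phi>)\<^sup>2 + (2 / c)\<^sup>2"
    using c p rho_bounds \<phi>
    by (intro split_average_square_shift_le[OF finite_D D_nonempty _ centred])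
      (auto simp: t_def abs_le_iff divide_simps)
  finally show ?thesis by (simp add: \<phi>_def c_def)
qed

lemma next_share_square:
  assumes m: "2 \<le> m"
  shows "next_value (\<lambda>X Y. (share k X Y - r)\<^sup>2) \<le> (\<rho> - r)\<^sup>2 + (1 / (m - 1))\<^sup>2"
proof -
  have centred: "split_average D p (\<lambda>_. (\<rho> - 1) / (m - 1)) (\<lambda>_. \<rho> / (m - 1)) = 0"
    using split_average_cmult[of D p "1 / (m - 1)" "\<lambda>_. \<rho> - 1" "\<lambda>_. \<rho>"]
      by (simp add: split_average_rho)
  have "next_value (\<lambda>X Y. (share k X Y - r)\<^sup>2)
      = split_average D p (\<lambda>u. ((\<rho> - r) + (\<rho> - 1) / (m - 1))\<^sup>2) (\<lambda>u. ((\<rho> - r) + \<rho> / (m - 1))\<^sup>2)"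
    unfolding next_value_def using share_add share_remove m
    by (intro split_average_cong) (simp_all add: algebra_simps)
  also have "\<dots> \<le> (\<rho> - r)\<^sup>2 + (1 / (m - 1))\<^sup>2"
    using m p rho_bounds
    by (intro split_average_square_shift_le[OF finite_D D_nonempty _ centred])
      (auto simp: abs_le_iff divide_simps)
  finally show ?thesis .
qed

lemma next_imbalance:
  assumes "2 \<le> m"
  shows "next_value (imbalance OPT k r) \<le> imbalance OPT k r X Y + 5 / (m - 1)\<^sup>2"
proof -
  have "next_value (imbalance OPT k r)
      = next_value (\<lambda>X Y. (share k X Y - overlap OPT X Y)\<^sup>2) + next_value (\<lambda>X Y. (share k X Y - r)\<^sup>2)"
    by (simp add: next_value_def imbalance_def split_average_add)
  then show ?thesis
    using next_share_overlap_square[OF assms] next_share_square[OF assms]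
    by (simp add: imbalance_def power_divide)
qed

lemma next_early_pot:
  shows "next_value early_pot = (17 / 10 + M / (m - 1)) * next_value (\<lambda>X Y. mix (share k X Y) X Y)
    + (1 - M / (m - 1)) * next_value (\<lambda>X Y. f (X \<union> OPT \<inter> Y)) - (m - 1 - M) * error
    - penalty * next_value (imbalance OPT k r)"
proof -
  define c where "c = m - 1"
  define V where "V X Y = (17 / 10 + M / c) * mix (share k X Y) X Y + (1 - M / c) * f (X \<union> OPT \<inter> Y)
    + - ((c - M) * error) + - penalty * imbalance OPT k r X Y" for X Y
  have "next_value early_pot = next_value V"
    unfolding next_value_def
  proof (rule split_average_cong)
    fix u assume u: "u \<in> D"
    show "early_pot (insert u X) Y = V (insert u X) Y" "early_pot X (Y - {u}) = V X (Y - {u})"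
      unfolding early_pot_def V_def Let_def undecided_add undecided_remove card_undecided[OF u] c_def
        by simp_all
  qed
  also have "\<dots> = (17 / 10 + M / c) * next_value (\<lambda>X Y. mix (share k X Y) X Y)
      + (1 - M / c) * next_value (\<lambda>X Y. f (X \<union> OPT \<inter> Y)) + - ((c - M) * error)
      + - penalty * next_value (imbalance OPT k r)"
    unfolding next_value_def V_def
    by (simp only: split_average_add split_average_cmult split_average_const[OF finite_D D_nonempty])
  finally show ?thesis by (simp add: c_def)
qed

lemma early_pot_eq:
  "early_pot X Y = (17 / 10 + M / m) * mix \<rho> X Y + (1 - M / m) * f W - (m - M) * error
    - penalty * imbalance OPT k r X Y"
  by (simp add: early_pot_def Let_def)

lemma imbalance_small:
  assumes "M < m" "0 < early_pot X Y"
  shows "imbalance OPT k r X Y \<le> \<epsilon>\<^sup>2"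
proof -
  have "mix \<rho> X Y \<le> (1 - \<rho>) * G + \<rho> * G"
    unfolding mix_def using rho_bounds X_sub XY by (intro add_mono mult_left_mono G) auto
  then have "(17 / 10 + M / m) * mix \<rho> X Y \<le> (17 / 10 + M / m) * G"
    by (intro mult_left_mono) (auto simp: algebra_simps)
  moreover have "(1 - M / m) * f W \<le> (1 - M / m) * G"
    using assms X_sub XY by (intro mult_left_mono G) (auto simp: field_simps)
  moreover have "0 \<le> (m - M) * error" using assms error_nonneg by simp
  ultimately have "penalty * imbalance OPT k r X Y < (17 / 10 + M / m) * G + (1 - M / m) * G"
    using assms unfolding early_pot_eq by linarith
  also have "\<dots> = penalty * \<epsilon>\<^sup>2"
    using \<epsilon> by (simp add: penalty_def algebra_simps)
  finally show ?thesis using penalty_nonneg by (simp add: mult_less_cancel_left)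
qed

lemma loss_le_of_imbalance_small:
  assumes "imbalance OPT k r X Y \<le> \<epsilon>\<^sup>2"
  shows "loss \<le> 17 / 10 * gain + 11 * G * \<epsilon> / m"
proof -
  have "\<bar>t\<bar> \<le> \<epsilon>" if "t\<^sup>2 \<le> \<epsilon>\<^sup>2" for t
    using that \<epsilon> by (simp add: abs_le_square_iff[symmetric])
  then have dev: "\<bar>\<rho> - overlap OPT X Y\<bar> \<le> \<epsilon>" "\<bar>\<rho> - r\<bar> \<le> \<epsilon>"
    using assms unfolding imbalance_def by (smt (verit) zero_le_power2)+
  have \<rho>: "99 / 1000 \<le> \<rho>" "\<rho> \<le> 901 / 1000"
    using dev(2) r \<epsilon> by (simp_all add: abs_le_iff)
  have "loss \<le> 169 / 100 * gain + \<theta> * (\<rho> - overlap OPT X Y)"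
    using loss_le[OF \<rho>] unfolding average_in_W .
  also have "\<theta> * (\<rho> - overlap OPT X Y) \<le> \<bar>\<theta>\<bar> * \<bar>\<rho> - overlap OPT X Y\<bar>"
    by (metis abs_ge_self abs_mult)
  also have "\<dots> \<le> (300 * gain + 11 * G / m) * \<epsilon>"
    using abs_shift_le[OF \<rho>] G X_sub XY dev gain_nonneg G_nonneg by (intro mult_mono) auto
  also have "\<dots> \<le> 1 / 100 * gain + 11 * G * \<epsilon> / m"
  proof -
    have "gain * \<epsilon> \<le> gain * (1 / 30000)" using \<epsilon> gain_nonneg by (intro mult_left_mono) auto
    then show ?thesis by (simp add: algebra_simps)
  qed
  finally show ?thesis by simp
qed

lemma error_ge:
  assumes "real M + 1 \<le> m"
  shows "11 * G * \<epsilon> / m + penalty * (5 / (m - 1)\<^sup>2) \<le> error"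
proof -
  have "11 * G * \<epsilon> / m \<le> 11 * G * \<epsilon> / M"
    using assms G_nonneg \<epsilon> M by (intro divide_left_mono) auto
  moreover have "5 / (m - 1)\<^sup>2 \<le> 5 / (real M)\<^sup>2"
    using assms M by (intro divide_left_mono power_mono) auto
  then have "penalty * (5 / (m - 1)\<^sup>2) \<le> penalty * (5 / (real M)\<^sup>2)"
    using penalty_nonneg by (rule mult_left_mono)
  ultimately show ?thesis by (simp add: error_def mult.commute)
qed

lemma next_early_pot_ge:
  fixes c :: real
  assumes c: "c = m - 1" "1 \<le> c" and Mc: "M \<le> c"
  shows "(17 / 10 + M / c) * (mix \<rho> X Y + gain) + (1 - M / c) * (f W - loss) - (c - M) * error
    - penalty * (imbalance OPT k r X Y + 5 / c\<^sup>2) \<le> next_value early_pot"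
proof -
  have m: "2 \<le> m" using c by simp
  have "(17 / 10 + M / c) * (mix \<rho> X Y + gain)
      \<le> (17 / 10 + M / c) * next_value (\<lambda>X Y. mix (share k X Y) X Y)"
    unfolding next_mix[OF m] c(1)[symmetric] using c(2) gain_nonneg
    by (intro mult_left_mono add_left_mono) (auto simp: distrib_right)
  moreover have "(1 - M / c) * (f W - loss) \<le> (1 - M / c) * next_value (\<lambda>X Y. f (X \<union> OPT \<inter> Y))"
    using next_opt c(2) Mc by (intro mult_left_mono) (auto simp: divide_le_eq)
  moreover have "penalty * next_value (imbalance OPT k r)
      \<le> penalty * (imbalance OPT k r X Y + 5 / c\<^sup>2)"
    using next_imbalance[OF m] penalty_nonneg unfolding c(1) by (rule mult_left_mono)
  ultimately show ?thesis unfolding next_early_pot c(1)[symmetric] by linarith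
qed

lemma early_pot_step:
  assumes Mm: "real M + 1 \<le> m" and pos: "0 < early_pot X Y"
  shows "early_pot X Y \<le> next_value early_pot"
proof -
  define c where "c = m - 1"
  define \<mu> where "\<mu> = M / c"
  define \<nu> where "\<nu> = M / m"
  define S where "S = f W"
  define \<Phi> where "\<Phi> = mix \<rho> X Y"
  have c: "1 \<le> c" "M \<le> c" "m = c + 1" using Mm M by (auto simp: c_def)
  have \<mu>: "0 \<le> \<mu>" "\<mu> - \<nu> = \<mu> / m"
    using c by (simp_all add: \<mu>_def \<nu>_def field_simps)
  have loss: "loss \<le> 17 / 10 * gain + 11 * G * \<epsilon> / m"
    using Mm pos by (intro loss_le_of_imbalance_small imbalance_small) auto
  have error: "11 * G * \<epsilon> / m + penalty * (5 / c\<^sup>2) \<le> error"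
    using error_ge[OF Mm] by (simp add: c_def)
  have "(\<mu> - \<nu>) * (S - \<Phi>) \<le> \<mu> / m * (m * (gain + loss))"
    unfolding S_def \<Phi>_def \<mu>(2) using opt_minus_mix_le \<mu>(1) by (intro mult_left_mono) auto
  also have "\<dots> = \<mu> * gain + \<mu> * loss"
    using c by (simp add: distrib_left)
  finally have mix: "(\<mu> - \<nu>) * (S - \<Phi>) \<le> \<mu> * gain + \<mu> * loss" .
  have "early_pot X Y = (17 / 10 + \<nu>) * \<Phi> + (1 - \<nu>) * S - (c + 1 - M) * error
      - penalty * imbalance OPT k r X Y"
    unfolding early_pot_eq \<Phi>_def S_def \<nu>_def using c(3) by simp
  also have "\<dots> \<le> (17 / 10 + \<mu>) * (\<Phi> + gain) + (1 - \<mu>) * (S - loss) - (c - M) * error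
      - penalty * (imbalance OPT k r X Y + 5 / c\<^sup>2)"
    using loss error mix unfolding ring_distribs by linarith
  also have "\<dots> \<le> next_value early_pot"
    unfolding \<mu>_def S_def \<Phi>_def using c by (intro next_early_pot_ge) auto
  finally show ?thesis .
qed

lemma next_value_mono:
  assumes "\<And>u. u \<in> D \<Longrightarrow> V (insert u X) Y \<le> V' (insert u X) Y"
    and "\<And>u. u \<in> D \<Longrightarrow> V X (Y - {u}) \<le> V' X (Y - {u})"
  shows "next_value V \<le> next_value V'"
  unfolding next_value_def using p assms by (intro split_average_mono)

lemma mix_le_next_pot_last:
  assumes "card D = 1"
  shows "27 / 10 * mix \<rho> X Y \<le> next_value pot"
proof -
  obtain u where D: "D = {u}" using assms by (auto simp: card_1_singleton_iff)
  have "insert u X = Y" "Y - {u} = X" using D XY by auto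
  then have "pot (insert u X) Y = 27 / 10 * f Y" "pot X (Y - {u}) = 27 / 10 * f X"
    using pot_same[OF X_sub] pot_same[OF XY(2)] by simp_all
  moreover have "p u = \<rho>" using average_p by (simp add: D average_def)
  ultimately show ?thesis
    by (simp add: next_value_def split_average_def average_def D mix_def) (simp add: algebra_simps)
qed

lemma mix_le_next_pot:
  assumes "card D \<le> M"
  shows "27 / 10 * mix \<rho> X Y \<le> next_value pot"
proof (cases "card D = 1")
  case False
  then have m: "2 \<le> m" using m_ge_1 by simp
  have "27 / 10 * mix \<rho> X Y \<le> 27 / 10 * next_value (\<lambda>X Y. mix (share k X Y) X Y)"
    unfolding next_mix[OF m] using gain_nonneg m by simp
  also have "\<dots> = next_value (\<lambda>X Y. 27 / 10 * mix (share k X Y) X Y)"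
    unfolding next_value_def split_average_cmult ..
  also have "\<dots> \<le> next_value pot"
  proof (rule next_value_mono)
    fix u assume "u \<in> D"
    then have "card (D - {u}) \<le> M" using assms by simp
    then show "27 / 10 * mix (share k (insert u X) Y) (insert u X) Y \<le> pot (insert u X) Y"
      "27 / 10 * mix (share k X (Y - {u})) X (Y - {u}) \<le> pot X (Y - {u})"
      by (simp_all add: pot_def undecided_add undecided_remove)
  qed
  finally show ?thesis .
qed (rule mix_le_next_pot_last)

lemma pot_step: "pot X Y \<le> next_value pot"
proof -
  have next_nonneg: "0 \<le> next_value pot"
    unfolding next_value_def split_average_def using p pot_nonneg
    by (intro average_nonneg add_nonneg_nonneg mult_nonneg_nonneg) auto
  show ?thesis
  proof (cases "card D \<le> M")
    case True
    then show ?thesis using mix_le_next_pot[OF True] next_nonneg by (simp add: pot_def)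
  next
    case False
    have "early_pot X Y \<le> next_value pot" if "0 < early_pot X Y"
    proof -
      have "early_pot X Y \<le> next_value early_pot" using False that by (intro early_pot_step) auto
      also have "\<dots> \<le> next_value pot"
        using False by (intro next_value_mono early_pot_le_pot)
          (auto simp: undecided_add undecided_remove)
      finally show ?thesis .
    qed
    then show ?thesis using False next_nonneg by (cases "0 < early_pot X Y") (auto simp: pot_def)
  qed
qed

end

text \<open>
  The acceptance probabilities are found without division: every undecided element is split into
  \<open>L\<close> tokens, and the tokens of lowest key are accepted, as many as there are elements to be picked,
  times \<open>L\<close>.  Token \<open>j\<close> of \<open>u\<close> has key at most \<open>2 L \<theta>\<close> iff \<open>(2 j + 1) / (2 L) * s u \<le> a u + \<theta>\<close>, so the
  accepted fraction of the tokens of \<open>u\<close> approximates \<open>(a u + \<theta>) / s u\<close>, clipped to the unit interval.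
\<close>

definition token_key :: "nat \<Rightarrow> ('a \<Rightarrow> real) \<Rightarrow> ('a \<Rightarrow> real) \<Rightarrow> 'a \<times> nat \<Rightarrow> real" where
  "token_key L a s = (\<lambda>(u, j). (2 * real j + 1) * s u - 2 * real L * a u)"

definition token_fraction :: "nat \<Rightarrow> ('a \<times> nat) set \<Rightarrow> 'a \<Rightarrow> real" where
  "token_fraction L T u = real (card (T `` {u})) / real L"

lemma tokens_of_element:
  assumes "T \<subseteq> D \<times> {..<L}"
  shows "T `` {u} \<subseteq> {..<L}" "finite (T `` {u})" "card (T `` {u}) \<le> L"
proof -
  show sub: "T `` {u} \<subseteq> {..<L}" using assms by auto
  then show "finite (T `` {u})" by (rule finite_subset) simp
  show "card (T `` {u}) \<le> L" using card_mono[OF _ sub] by simp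
qed

lemma token_fraction_bounds:
  assumes "0 < L" "T \<subseteq> D \<times> {..<L}"
  shows "0 \<le> token_fraction L T u \<and> token_fraction L T u \<le> 1"
  using tokens_of_element(3)[OF assms(2)] assms(1) by (simp add: token_fraction_def)

lemma sum_tokens:
  assumes "0 < L" "finite D" "T \<subseteq> D \<times> {..<L}"
  shows "(\<Sum>x\<in>T. W (fst x)) = real L * (\<Sum>u\<in>D. token_fraction L T u * W u)"
proof -
  have "T = (SIGMA u:D. T `` {u})" using assms by auto
  then have "(\<Sum>x\<in>T. W (fst x)) = (\<Sum>u\<in>D. \<Sum>j\<in>T `` {u}. W u)"
    using assms tokens_of_element(2)[OF assms(3)]
      by (metis (no_types, lifting) fst_conv split_def sum.Sigma sum.cong)
  also have "\<dots> = real L * (\<Sum>u\<in>D. token_fraction L T u * W u)"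
    using assms by (simp add: token_fraction_def sum_distrib_left)
  finally show ?thesis .
qed

lemma average_tokens:
  assumes "0 < L" "finite D" "T \<subseteq> D \<times> {..<L}"
  shows "average (D \<times> {..<L}) (\<lambda>x. if x \<in> T then V (fst x) else W (fst x))
    = split_average D (token_fraction L T) V W"
proof -
  have all: "token_fraction L (D \<times> {..<L}) u = 1" if "u \<in> D" for u
    using that assms(1) by (simp add: token_fraction_def Image_singleton)
  have "(\<Sum>x\<in>D \<times> {..<L}. if x \<in> T then V (fst x) else W (fst x))
      = (\<Sum>x\<in>D \<times> {..<L}. W (fst x) + (if x \<in> T then V (fst x) - W (fst x) else 0))"
    by (intro sum.cong) auto
  also have "\<dots> = (\<Sum>x\<in>D \<times> {..<L}. W (fst x)) + (\<Sum>x\<in>T. V (fst x) - W (fst x))"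
    using assms by (simp add: sum.distrib sum.If_cases Int_absorb1)
  also have "\<dots> = real L * (\<Sum>u\<in>D. W u) + real L * (\<Sum>u\<in>D. token_fraction L T u * (V u - W u))"
    using sum_tokens[OF assms, of "\<lambda>u. V u - W u"] sum_tokens[OF assms(1,2) order_refl, of W] all
      by simp
  also have "\<dots> = real L * (\<Sum>u\<in>D. token_fraction L T u * V u + (1 - token_fraction L T u) * W u)"
    by (simp add: sum.distrib sum_subtractf algebra_simps)
  finally show ?thesis
    using assms(1) by (simp add: average_def split_average_def card_cartesian_product)
qed

lemma exists_accepted_token:
  assumes "T \<subseteq> D \<times> {..<L}" "0 < token_fraction L T u"
  obtains j where "(u, j) \<in> T" "card (T `` {u}) \<le> Suc j"
proof -
  note tokens = tokens_of_element[OF assms(1)]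
  have "T `` {u} \<noteq> {}" using assms(2) by (auto simp: token_fraction_def)
  then show thesis
    using that[of "Max (T `` {u})"] Max_in[OF tokens(2)] card_le_Suc_Max[OF tokens(2)] by auto
qed

lemma exists_rejected_token:
  assumes "T \<subseteq> D \<times> {..<L}" "u \<in> D" "0 < L" "token_fraction L T u < 1"
  obtains j where "(u, j) \<in> D \<times> {..<L} - T" "j \<le> card (T `` {u})"
proof -
  have "card (T `` {u}) < L" using assms(3,4) by (simp add: token_fraction_def)
  moreover have "\<not> {..card (T `` {u})} \<subseteq> T `` {u}"
    using card_mono[OF tokens_of_element(2)[OF assms(1)], of "{..card (T `` {u})}" u] by auto
  ultimately obtain j where "j \<le> card (T `` {u})" "j < L" "(u, j) \<notin> T" by auto
  then show thesis using that assms(2) by simp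
qed

lemma token_threshold:
  assumes L: "0 < L" and D: "finite D" and T: "lowest (token_key L a s) (D \<times> {..<L}) T"
    and s: "\<And>u. u \<in> D \<Longrightarrow> 0 \<le> s u"
  obtains \<theta> where
    "\<And>u. u \<in> D \<Longrightarrow> 0 < token_fraction L T u \<Longrightarrow> (token_fraction L T u - 1 / (2 * real L)) * s u \<le> a u + \<theta>"
    "\<And>u. u \<in> D \<Longrightarrow> token_fraction L T u < 1 \<Longrightarrow> a u + \<theta> \<le> (token_fraction L T u + 1 / (2 * real L)) * s u"
proof -
  obtain t where t: "\<And>x. x \<in> T \<Longrightarrow> token_key L a s x \<le> t"
    "\<And>y. y \<in> D \<times> {..<L} - T \<Longrightarrow> t \<le> token_key L a s y"
    using lowest_threshold[OF _ T] D by (metis finite_SigmaI finite_lessThan)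
  have TD: "T \<subseteq> D \<times> {..<L}" using T by (simp add: lowest_def)
  define \<theta> where "\<theta> = t / (2 * real L)"
  have scale: "2 * real L * (a u + \<theta>) = 2 * real L * a u + t"
    "2 * real L * ((token_fraction L T u + c / (2 * real L)) * s u)
        = (2 * real (card (T `` {u})) + c) * s u" for u c
    using L by (simp_all add: \<theta>_def token_fraction_def field_simps)
  have L2: "0 < 2 * real L" using L by simp
  show thesis
  proof (rule that)
    fix u assume u: "u \<in> D" and pos: "0 < token_fraction L T u"
    define c where "c = card (T `` {u})"
    obtain j where j: "(u, j) \<in> T" "c \<le> Suc j"
      using exists_accepted_token[OF TD pos] by (auto simp: c_def)
    have "(2 * real c - 1) * s u \<le> (2 * real j + 1) * s u"
      using j(2) s[OF u] by (intro mult_right_mono) auto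
    then have "2 * real L * ((token_fraction L T u + - 1 / (2 * real L)) * s u)
        \<le> 2 * real L * (a u + \<theta>)"
      using t(1)[OF j(1)] unfolding scale c_def[symmetric] by (simp add: token_key_def)
    then show "(token_fraction L T u - 1 / (2 * real L)) * s u \<le> a u + \<theta>"
      using L2 by (simp add: mult_le_cancel_left_pos)
  next
    fix u assume u: "u \<in> D" and less: "token_fraction L T u < 1"
    define c where "c = card (T `` {u})"
    obtain j where j: "(u, j) \<in> D \<times> {..<L} - T" "j \<le> c"
      using exists_rejected_token[OF TD u L less] by (auto simp: c_def)
    have "(2 * real j + 1) * s u \<le> (2 * real c + 1) * s u"
      using j(2) s[OF u] by (intro mult_right_mono) auto
    then have "2 * real L * (a u + \<theta>) \<le> 2 * real L
        * ((token_fraction L T u + 1 / (2 * real L)) * s u)"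
      using t(2)[OF j(1)] unfolding scale c_def[symmetric] by (simp add: token_key_def)
    then show "a u + \<theta> \<le> (token_fraction L T u + 1 / (2 * real L)) * s u"
      using L2 by (simp add: mult_le_cancel_left_pos)
  qed
qed

definition (in nonneg_submodular) token_submartingale ::
    "nat \<Rightarrow> nat \<Rightarrow> ('a set \<Rightarrow> 'a set \<Rightarrow> real) \<Rightarrow> bool" where
  "token_submartingale L k V \<longleftrightarrow> (\<forall>X Y T. X \<subseteq> Y \<longrightarrow> Y \<subseteq> U \<longrightarrow> X \<noteq> Y \<longrightarrow> card X \<le> k \<longrightarrow> k \<le> card Y \<longrightarrow>
     lowest (token_key L (add_gain X) (\<lambda>u. add_gain X u + remove_gain Y u)) ((Y - X) \<times> {..<L}) T \<longrightarrow>
     card T = L * (k - card X) \<longrightarrow>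
     V X Y \<le> average ((Y - X) \<times> {..<L}) (\<lambda>x. if x \<in> T then V (insert (fst x) X) Y
         else V X (Y - {fst x})))"

lemma (in double_greedy_potential) pot_token_submartingale:
  assumes L: "4096 \<le> L"
  shows "token_submartingale L k pot"
  unfolding token_submartingale_def
proof (intro allI impI)
  fix X Y T
  assume XY: "X \<subseteq> Y" "Y \<subseteq> U" "X \<noteq> Y" and k: "card X \<le> k"
    and T: "lowest (token_key L (add_gain X) (\<lambda>u. add_gain X u + remove_gain Y u))
        ((Y - X) \<times> {..<L}) T"
    and card_T: "card T = L * (k - card X)"
  let ?D = "Y - X" and ?p = "token_fraction L T" and ?\<delta> = "1 / (2 * real L)"
  have D: "finite ?D" using XY finite_sub by auto
  have L0: "0 < L" using L by simp
  have TD: "T \<subseteq> ?D \<times> {..<L}" using T by (simp add: lowest_def)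
  have "average ?D ?p = share k X Y"
    using sum_tokens[OF L0 D TD, of "\<lambda>_. 1"] card_T k L0
    by (simp add: average_def share_def of_nat_diff)
  then interpret step: double_greedy_step U f X Y "X \<union> OPT \<inter> Y" ?p "share k X Y"
    by unfold_locales (use XY token_fraction_bounds[OF L0 TD] in auto)
  obtain \<theta> where \<theta>:
    "\<And>u. u \<in> ?D \<Longrightarrow> 0 < ?p u \<Longrightarrow> (?p u - ?\<delta>) * (add_gain X u + remove_gain Y u) \<le> add_gain X u + \<theta>"
    "\<And>u. u \<in> ?D \<Longrightarrow> ?p u < 1 \<Longrightarrow> add_gain X u + \<theta> \<le> (?p u + ?\<delta>) * (add_gain X u + remove_gain Y u)"
    using token_threshold[OF L0 D T step.gains_nonneg] by metis
  interpret round: double_greedy_round U f OPT k r G \<epsilon> M X Y ?p \<theta> ?\<delta>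
  proof unfold_locales
    fix u assume u: "u \<in> ?D"
    note p = step.p[OF u]
    show "?p u * (?p u - ?\<delta>) * (add_gain X u + remove_gain Y u) \<le> ?p u * (add_gain X u + \<theta>)"
      using \<theta>(1)[OF u] p by (cases "?p u = 0") (auto simp: mult.assoc intro: mult_left_mono)
    show "(1 - ?p u) * (add_gain X u + \<theta>) \<le> (1 - ?p u) * (?p u + ?\<delta>)
        * (add_gain X u + remove_gain Y u)"
      using \<theta>(2)[OF u] p by (cases "?p u = 1") (auto simp: mult.assoc intro: mult_left_mono)
    have "?p u = 0 \<or> ?\<delta> \<le> ?p u" "?p u = 1 \<or> ?\<delta> \<le> 1 - ?p u"
      using L0 tokens_of_element(3)[OF TD, of u] by (auto simp: token_fraction_def field_simps)
    then show "0 \<le> ?p u * (?p u - ?\<delta>)" "0 \<le> (1 - ?p u) * (1 - ?p u - ?\<delta>)"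
      using p by (auto intro: mult_nonneg_nonneg)
  next
    show "?\<delta> \<le> 1 / 8192" using L by (simp add: field_simps)
  qed simp
  show "pot X Y \<le> average (?D \<times> {..<L}) (\<lambda>x. if x \<in> T then pot (insert (fst x) X) Y
      else pot X (Y - {fst x}))"
    using round.pot_step average_tokens[OF L0 D TD, of "\<lambda>u. pot (insert u X) Y" "\<lambda>u. pot X (Y - {u})"]
    by (simp add: step.next_value_def)
qed

lemma (in double_greedy_potential) pot_start:
  assumes OPT: "OPT \<subseteq> U" "card OPT = k" and r_eq: "r = real k / real (card U)" and MU: "M \<le> card U"
  shows "(1 - real M / real (card U)) * f OPT - real (card U) * error \<le> pot {} U"
proof -
  have U: "0 < card U" using M MU by simp
  have "OPT \<inter> U = OPT" using OPT by auto
  then have "early_pot {} U = (17 / 10 + M / card U) * mix r {} U + (1 - M / card U) * f OPT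
      - (real (card U) - M) * error"
    using OPT(2) by (simp add: early_pot_def Let_def imbalance_def share_def overlap_def
      r_eq[symmetric])
  moreover have "0 \<le> mix r {} U"
    unfolding mix_def using r nonneg[of "{}"] nonneg[of U] by simp
  then have "0 \<le> (17 / 10 + M / card U) * mix r {} U" by simp
  moreover have "(real (card U) - M) * error \<le> real (card U) * error"
    using error_nonneg by (intro mult_right_mono) auto
  ultimately have "(1 - M / card U) * f OPT - card U * error \<le> early_pot {} U" by simp
  also have "\<dots> \<le> pot {} U" using MU by (intro early_pot_le_pot) simp
  finally show ?thesis .
qed

lemma exp_minus_1_le: "exp (- 1 :: real) \<le> 3682 / 10000"
proof -
  have "(1 + (1 / 16) + (1 / 16)\<^sup>2 / 2 :: real) \<le> exp (1 / 16)"
    by (rule exp_lower_Taylor_quadratic) simp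
  then have "(1 + (1 / 16) + (1 / 16)\<^sup>2 / 2 :: real) ^ 16 \<le> exp (1 / 16) ^ 16"
    by (intro power_mono) auto
  also have "exp (1 / 16 :: real) ^ 16 = exp 1" by (simp add: exp_of_nat_mult[symmetric])
  finally have "10000 / 3682 \<le> exp (1 :: real)"
    by (rule order_trans[rotated]) (simp add: power2_eq_square eval_nat_numeral)
  then show ?thesis by (simp add: exp_minus field_simps)
qed

context nonneg_submodular
begin

lemma le_ten_opt_value:
  assumes k: "k < card U" "card U \<le> 10 * k" "card U \<le> 10 * (card U - k)" and A: "A \<subseteq> U"
  shows "f A \<le> 10 * opt_value U f k"
proof -
  let ?P = "opt_value U f k"
  have P: "f S \<le> ?P" if "S \<subseteq> U" "card S = k" for S
    using that by (intro opt_value_ge[OF finite_ground]) (auto simp: feasible_def)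
  obtain OPT where "OPT \<subseteq> U" "f OPT = ?P"
    using opt_value_attained[OF finite_ground] k by (metis less_imp_le)
  then have P0: "0 \<le> ?P" using nonneg by metis
  have "\<exists>c. 0 < c \<and> card U \<le> 10 * c \<and> real c * f A \<le> real (card U) * ?P"
  proof (cases "k \<le> card A")
    case True
    then show ?thesis using le_card_ratio_max[OF A _ P] k by (intro exI[of _ k]) auto
  next
    case False
    then show ?thesis
      using le_complement_card_ratio_max[OF A _ _ P] k by (intro exI[of _ "card U - k"]) auto
  qed
  then obtain c where c: "0 < c" "card U \<le> 10 * c" "real c * f A \<le> real (card U) * ?P" by blast
  note c(3)
  also have "real (card U) * ?P \<le> real (10 * c) * ?P" using c(2) P0 by (intro mult_right_mono) auto
  finally have "real c * f A \<le> real c * (10 * ?P)" by simp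
  then show ?thesis using c(1) by simp
qed

lemma double_greedy_potential_exists_proper:
  assumes k: "k < card U" "card U \<le> 10 * k" "card U \<le> 10 * (card U - k)"
    and large: "10 ^ 24 < real (card U)"
  obtains V where "token_submartingale 4096 k V" "\<And>A. A \<subseteq> U \<Longrightarrow> V A A = 27 / 10 * f A"
    "27 / 10 * ((exp (- 1) - 10 ^ 24 / real (card U)) * opt_value U f k) \<le> V {} U"
proof -
  define n where "n = card U"
  define P where "P = opt_value U f k"
  define M where "M = n div 500 + 1"
  obtain OPT where OPT: "OPT \<subseteq> U" "card OPT = k" "f OPT = P"
    using opt_value_attained[OF finite_ground] k unfolding P_def by (metis less_imp_le)
  have P0: "0 \<le> P" using OPT nonneg by metis
  have "real n \<le> 10 * real k" "10 * real k \<le> 9 * real n" using k unfolding n_def by linarith+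
  then interpret double_greedy_potential U f OPT k "real k / real n" "10 * P" "1 / 10 ^ 8" M
    using k le_ten_opt_value by unfold_locales (auto simp: n_def M_def P_def field_simps)
  have n: "10 ^ 24 < real n" using large by (simp add: n_def)
  have Mn: "M \<le> n" using n by (auto simp: M_def div_le_dividend le_Suc_eq)
  have "n < 500 * M" unfolding M_def using dividend_less_times_div[of 500 n] by simp
  then have nM: "real n / real M \<le> 500" using M by (simp add: field_simps)
  have "500 * M \<le> n + 500" unfolding M_def by simp
  then have Mn': "real M / real n \<le> 1 / 500 + 1 / real n" using n by (simp add: field_simps)
  have "real n * error = 110 * P / 10 ^ 8 * (real n / real M)
      + 135 * 10 ^ 16 * P * (real n / real M)\<^sup>2 * (1 / real n)"
    unfolding error_def penalty_def using n M by (simp add: power2_eq_square field_simps)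
  also have "\<dots> \<le> 110 * P / 10 ^ 8 * 500 + 135 * 10 ^ 16 * P * 500\<^sup>2 * (1 / real n)"
    using P0 nM by (intro add_mono mult_left_mono mult_right_mono power_mono) auto
  finally have err: "real n * error \<le> (55 / 10 ^ 5 + 3375 * 10 ^ 20 * (1 / real n)) * P"
    by (simp add: power2_eq_square algebra_simps)
  have "27 / 10 * ((exp (- 1) - 10 ^ 24 / real n) * P)
      \<le> 27 / 10 * ((3682 / 10000 - 10 ^ 24 / real n) * P)"
    using exp_minus_1_le P0 by (intro mult_left_mono mult_right_mono) auto
  also have "\<dots> \<le> ((1 - (1 / 500 + 1 / real n)) - (55 / 10 ^ 5 + 3375 * 10 ^ 20 * (1 / real n))) * P"
    unfolding mult.assoc[symmetric] using n P0 by (intro mult_right_mono) (auto simp: field_simps)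
  also have "\<dots> \<le> (1 - real M / real n) * P - real n * error"
    unfolding left_diff_distrib[of "1 - (1 / 500 + 1 / real n)"]
    using err Mn' P0 by (intro diff_mono mult_right_mono) auto
  also have "\<dots> \<le> pot {} U"
    using pot_start OPT Mn by (simp add: n_def)
  finally show thesis
    using pot_token_submartingale[OF order_refl] pot_same
      by (intro that[of pot]) (simp_all add: n_def P_def)
qed

lemma token_submartingale_const:
  assumes "0 < L"
  shows "token_submartingale L k (\<lambda>_ _. c)"
proof -
  have "average ((Y - X) \<times> {..<L}) (\<lambda>_. c) = c" if "X \<subseteq> Y" "Y \<subseteq> U" "X \<noteq> Y" for X Y :: "'a set"
    using that assms finite_sub[OF that(2)] by (intro average_const) (auto simp: lessThan_empty_iff)
  then show ?thesis by (simp add: token_submartingale_def)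
qed

lemma token_submartingale_cmult:
  assumes "token_submartingale L k V" "0 \<le> c"
  shows "token_submartingale L k (\<lambda>X Y. c * V X Y)"
  unfolding token_submartingale_def
proof (intro allI impI)
  fix X Y T
  assume step: "X \<subseteq> Y" "Y \<subseteq> U" "X \<noteq> Y" "card X \<le> k" "k \<le> card Y"
    "lowest (token_key L (add_gain X) (\<lambda>u. add_gain X u + remove_gain Y u)) ((Y - X) \<times> {..<L}) T"
    "card T = L * (k - card X)"
  have "c * V X Y \<le> c * average ((Y - X) \<times> {..<L})
      (\<lambda>x. if x \<in> T then V (insert (fst x) X) Y else V X (Y - {fst x}))"
    using assms(1)[unfolded token_submartingale_def, rule_format, OF step] assms(2)
      by (rule mult_left_mono)
  then show "c * V X Y \<le> average ((Y - X) \<times> {..<L})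
      (\<lambda>x. if x \<in> T then c * V (insert (fst x) X) Y else c * V X (Y - {fst x}))"
    unfolding average_cmult[symmetric] if_distrib[of "(*) c"] .
qed

lemma weak_ratio_le_feasible:
  assumes k: "k \<le> card U" and weak: "k = card U \<or> real (card U) \<le> 10 ^ 24" and A: "A \<in> feasible U k"
  shows "(exp (- 1) - 10 ^ 24 / real (card U)) * opt_value U f k \<le> f A"
proof -
  obtain OPT where OPT: "OPT \<subseteq> U" "card OPT = k" "f OPT = opt_value U f k"
    using opt_value_attained[OF finite_ground k] .
  then have opt_nonneg: "0 \<le> opt_value U f k" using nonneg by metis
  show ?thesis
  proof (cases "k = card U")
    case True
    then have "A = OPT"
      using A OPT(1,2) card_subset_eq[OF finite_ground, of A] card_subset_eq[OF finite_ground, of OPT]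
      by (simp add: feasible_def)
    moreover have "0 \<le> 10 ^ 24 / real (card U)" by simp
    then have "exp (- 1) - 10 ^ 24 / real (card U) \<le> 1" using exp_minus_1_le by linarith
    then have "(exp (- 1) - 10 ^ 24 / real (card U)) * opt_value U f k \<le> 1 * opt_value U f k"
      using opt_nonneg by (rule mult_right_mono)
    ultimately show ?thesis using OPT(3) by simp
  next
    case False
    then have "1 \<le> 10 ^ 24 / real (card U)" using k weak by (simp add: field_simps)
    then have "exp (- 1) - 10 ^ 24 / real (card U) \<le> 0" using exp_minus_1_le by simp
    then have "(exp (- 1) - 10 ^ 24 / real (card U)) * opt_value U f k \<le> 0"
      using opt_nonneg by (rule mult_nonpos_nonneg)
    then show ?thesis using nonneg[of A] A by (simp add: feasible_def)
  qed
qed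

lemma double_greedy_potential_exists:
  assumes k: "k \<le> card U" and mid: "k = card U \<or> card U \<le> 10 * k \<and> card U \<le> 10 * (card U - k)"
  obtains V where "token_submartingale 4096 k V" "\<And>A. A \<in> feasible U k \<Longrightarrow> V A A \<le> f A"
    "(exp (- 1) - 10 ^ 24 / real (card U)) * opt_value U f k \<le> V {} U"
proof -
  define v where "v = (exp (- 1) - 10 ^ 24 / real (card U)) * opt_value U f k"
  show thesis
  proof (cases "k < card U \<and> 10 ^ 24 < real (card U)")
    case True
    then obtain V where V: "token_submartingale 4096 k V" "\<And>A. A \<subseteq> U \<Longrightarrow> V A A = 27 / 10 * f A"
      "27 / 10 * v \<le> V {} U"
      using double_greedy_potential_exists_proper[of k] mid unfolding v_def by (metis less_irrefl)
    show thesis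
    proof (rule that)
      show "token_submartingale 4096 k (\<lambda>X Y. 10 / 27 * V X Y)"
        using V(1) by (rule token_submartingale_cmult) simp
      show "10 / 27 * V A A \<le> f A" if "A \<in> feasible U k" for A
        using V(2)[of A] that by (simp add: feasible_def)
      show "(exp (- 1) - 10 ^ 24 / real (card U)) * opt_value U f k \<le> 10 / 27 * V {} U"
        using V(3) by (simp add: v_def)
    qed
  next
    case False
    then have "v \<le> f A" if "A \<in> feasible U k" for A
      unfolding v_def using k that by (intro weak_ratio_le_feasible) auto
    then show thesis
      by (intro that[of "\<lambda>_ _. v"] token_submartingale_const) (simp_all add: v_def)
  qed
qed

end

section \<open>Random greedy\<close>

lemma lowest_two_level:
  fixes key :: "'a \<Rightarrow> real"
  assumes E: "finite E" and T: "lowest key E T"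
    and AR: "A \<subseteq> E" "R \<subseteq> E" "A \<inter> R = {}" "card A \<le> card T" "card T \<le> card R"
  obtains b where "0 \<le> b" "b \<le> real (card T) / real (card R)" "sum key T \<le> sum key A + b * sum key R"
proof -
  define b where "b = real (card T - card A) / real (card R)"
  define w where "w u = (if u \<in> A then 1 else if u \<in> R then b else 0)" for u
  have b: "0 \<le> b" "b \<le> 1" "b \<le> real (card T) / real (card R)"
    using AR unfolding b_def by (auto simp: divide_le_eq intro: divide_right_mono)
  have fin: "finite A" "finite R" using AR(1,2) E by (auto intro: finite_subset)
  have sum_w: "(\<Sum>u\<in>E. w u * h u) = sum h A + b * sum h R" for h
  proof -
    have "(\<Sum>u\<in>E. w u * h u) = (\<Sum>u\<in>A \<union> R. w u * h u)"
      using E AR by (intro sum.mono_neutral_right) (auto simp: w_def)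
    also have "\<dots> = (\<Sum>u\<in>A. w u * h u) + (\<Sum>u\<in>R. w u * h u)"
      using AR fin by (intro sum.union_disjoint) auto
    also have "(\<Sum>u\<in>A. w u * h u) = sum h A" by (intro sum.cong) (auto simp: w_def)
    also have "(\<Sum>u\<in>R. w u * h u) = b * sum h R"
      unfolding sum_distrib_left using AR by (intro sum.cong) (auto simp: w_def)
    finally show ?thesis .
  qed
  have "b * real (card R) = real (card T) - real (card A)"
    using AR by (cases "card R = 0") (auto simp: b_def of_nat_diff)
  then have "sum w E = real (card T)" using sum_w[of "\<lambda>_. 1"] by simp
  then have "sum key T \<le> (\<Sum>u\<in>E. w u * key u)"
    using b by (intro sum_lowest_le[OF E T]) (auto simp: w_def)
  then show thesis using that b unfolding sum_w by blast
qed

context nonneg_submodular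
begin

lemma nonneg_submodular_union:
  assumes "V \<subseteq> U"
  shows "nonneg_submodular U (\<lambda>S. f (V \<union> S))"
proof
  show "submodular_on U (\<lambda>S. f (V \<union> S))"
    unfolding submodular_on_def
  proof (intro allI impI)
    fix A B assume "A \<subseteq> U" "B \<subseteq> U"
    then show "f (V \<union> (A \<union> B)) + f (V \<union> (A \<inter> B)) \<le> f (V \<union> A) + f (V \<union> B)"
      using union_inter_le[of "V \<union> A" "V \<union> B"] assms by (simp add: Un_Int_distrib Un_ac)
  qed
qed (use assms in \<open>auto simp: nonneg_on_def finite_ground intro: nonneg\<close>)

definition worst_union :: "'a set \<Rightarrow> 'a set \<Rightarrow> 'a set \<Rightarrow> real" where
  "worst_union V W S = Min ((\<lambda>R. f (V \<union> S \<union> R)) ` Pow W)"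

lemma worst_union_le:
  assumes "W \<subseteq> U" "R \<subseteq> W"
  shows "worst_union V W S \<le> f (V \<union> S \<union> R)"
  unfolding worst_union_def using assms finite_sub by (intro Min_le) auto

lemma worst_union_attained:
  assumes "W \<subseteq> U"
  obtains R where "R \<subseteq> W" "worst_union V W S = f (V \<union> S \<union> R)"
proof -
  have "worst_union V W S \<in> (\<lambda>R. f (V \<union> S \<union> R)) ` Pow W"
    unfolding worst_union_def using assms finite_sub by (intro Min_in) auto
  then show thesis using that by auto
qed

lemma nonneg_submodular_worst_union:
  assumes V: "V \<subseteq> U" and W: "W \<subseteq> U"
  shows "nonneg_submodular U (worst_union V W)"
proof
  show "submodular_on U (worst_union V W)"
    unfolding submodular_on_def
  proof (intro allI impI)
    fix A B assume AB: "A \<subseteq> U" "B \<subseteq> U"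
    obtain R where R: "R \<subseteq> W" "worst_union V W A = f (V \<union> A \<union> R)" using worst_union_attained[OF W] .
    obtain Q where Q: "Q \<subseteq> W" "worst_union V W B = f (V \<union> B \<union> Q)" using worst_union_attained[OF W] .
    define I where "I = A \<inter> Q \<union> R \<inter> B \<union> R \<inter> Q"
    have "worst_union V W (A \<union> B) \<le> f (V \<union> (A \<union> B) \<union> (R \<union> Q))"
      "worst_union V W (A \<inter> B) \<le> f (V \<union> (A \<inter> B) \<union> I)"
      using R Q by (auto simp: I_def intro!: worst_union_le[OF W])
    moreover have "V \<union> A \<union> R \<union> (V \<union> B \<union> Q) = V \<union> (A \<union> B) \<union> (R \<union> Q)"
      "(V \<union> A \<union> R) \<inter> (V \<union> B \<union> Q) = V \<union> (A \<inter> B) \<union> I"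
      by (auto simp: I_def)
    then have "f (V \<union> (A \<union> B) \<union> (R \<union> Q)) + f (V \<union> (A \<inter> B) \<union> I) \<le> f (V \<union> A \<union> R) + f (V \<union> B \<union> Q)"
      using union_inter_le[of "V \<union> A \<union> R" "V \<union> B \<union> Q"] V W AB R(1) Q(1) by (simp add: subset_trans)
    ultimately show "worst_union V W (A \<union> B) + worst_union V W (A \<inter> B)
        \<le> worst_union V W A + worst_union V W B"
      using R(2) Q(2) by linarith
  qed
  show "nonneg_on U (worst_union V W)"
    unfolding nonneg_on_def using worst_union_attained[OF W, of V] V W
    by (metis nonneg le_sup_iff subset_trans)
qed (rule finite_ground)

lemma average_insert_ge:
  assumes "S \<subseteq> U" "T \<subseteq> U" "T \<noteq> {}"
  shows "(1 - 1 / real (card T)) * f S + f (S \<union> T) / real (card T) \<le> average T (\<lambda>u. f (insert u S))"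
proof -
  have T: "0 < real (card T)" using assms finite_sub by (simp add: card_gt_0_iff)
  have "f (S \<union> T) - f S \<le> (\<Sum>u\<in>T. add_gain S u)"
    using assms by (intro union_le_sum_add_gain) auto
  also have "\<dots> = (\<Sum>u\<in>T. f (insert u S)) - real (card T) * f S"
    by (simp add: sum_subtractf)
  finally have "((real (card T) - 1) * f S + f (S \<union> T)) / real (card T)
      \<le> average T (\<lambda>u. f (insert u S))"
    unfolding average_def using T by (intro divide_right_mono) (simp_all add: algebra_simps)
  then show ?thesis using T by (simp add: add_divide_distrib left_diff_distrib diff_divide_distrib)
qed

lemma swap_local_optimum:
  assumes Z: "Z \<subseteq> U" "card Z = k" and OPT: "OPT \<subseteq> U" "card OPT = k" and \<delta>: "0 \<le> \<delta>"
    and local: "\<And>u v. u \<in> Z \<Longrightarrow> v \<in> U - Z \<Longrightarrow> f (insert v (Z - {u})) \<le> f Z + \<delta>"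
  shows "f (OPT \<union> Z) + f (OPT \<inter> Z) \<le> 2 * f Z + real k * \<delta>"
proof -
  let ?A = "Z - OPT" and ?B = "OPT - Z"
  have fin: "finite Z" "finite OPT" using Z OPT finite_sub by auto
  have "card ?A = card ?B"
    using fin Z(2) OPT(2) by (simp add: card_Diff_subset_Int Int_commute)
  then obtain \<pi> where \<pi>: "bij_betw \<pi> ?A ?B"
    using fin finite_same_card_bij by (metis finite_Diff)
  have swap: "add_gain Z (\<pi> u) + remove_gain Z u \<le> \<delta>" if u: "u \<in> ?A" for u
  proof -
    have v: "\<pi> u \<in> ?B" using \<pi> u by (auto simp: bij_betw_def)
    then have exchange: "insert (\<pi> u) (Z - {u}) \<union> Z = insert (\<pi> u) Z"
      "insert (\<pi> u) (Z - {u}) \<inter> Z = Z - {u}"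
      using u by auto
    have "f (insert (\<pi> u) Z) + f (Z - {u}) \<le> f (insert (\<pi> u) (Z - {u})) + f Z"
      using union_inter_le[of "insert (\<pi> u) (Z - {u})" Z] Z OPT u v unfolding exchange by auto
    then show ?thesis using local[of u "\<pi> u"] u v OPT by auto
  qed
  have "Z \<union> ?B = OPT \<union> Z" "Z - ?A = OPT \<inter> Z" by auto
  then have "f (OPT \<union> Z) - f Z + (f (OPT \<inter> Z) - f Z)
      \<le> (\<Sum>v\<in>?B. add_gain Z v) + (\<Sum>u\<in>?A. remove_gain Z u)"
    using union_le_sum_add_gain[of Z ?B] diff_le_sum_remove_gain[of Z ?A] Z OPT
    by (intro add_mono) (simp_all add: subset_iff)
  also have "\<dots> = (\<Sum>u\<in>?A. add_gain Z (\<pi> u) + remove_gain Z u)"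
    unfolding sum.distrib sum.reindex_bij_betw[OF \<pi>, of "add_gain Z"] ..
  also have "\<dots> \<le> real (card ?A) * \<delta>"
    by (rule sum_bounded_above[OF swap])
  also have "\<dots> \<le> real k * \<delta>"
    using Z(2) fin card_mono[of Z ?A] \<delta> by (intro mult_right_mono) auto
  finally show ?thesis by linarith
qed

end

text \<open>
  Random greedy avoids \<open>Z\<close> in its first \<open>s\<close> rounds.  The parameter \<open>a\<close> bounds the fraction of elements
  other than those of the optimum among the \<open>k\<close> best ones; \<open>\<gamma>\<close> is a lower bound for
  \<open>f (OPT \<union> S)\<close> as long as \<open>Z\<close> is avoided.
\<close>

locale aided_greedy = nonneg_submodular +
  fixes OPT Z :: "'a set" and k s :: nat and a :: real
  assumes OPT: "OPT \<subseteq> U" "card OPT = k" and Z: "Z \<subseteq> U" "card Z = k"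
    and k: "1 \<le> k" "4 * k \<le> card U"
    and a: "real k / real (card U - 3 * k) \<le> a" "a \<le> 1"
    and s: "s \<le> k"
begin

abbreviation "h S \<equiv> f (OPT \<union> S)"
abbreviation "g \<equiv> worst_union OPT (U - Z)"
abbreviation "rest S \<equiv> U - (Z \<union> OPT \<union> S)"
definition "target S = (1 - a) * h S + a * g S"
definition "\<gamma> = max 0 (f OPT - f (OPT \<union> Z))"
definition "\<beta> = f (OPT \<inter> Z)"
definition "q = 1 / real k"
definition "lam = 1 - q"

lemma h_submodular: "nonneg_submodular U h"
  by (rule nonneg_submodular_union[OF OPT(1)])

lemma g_submodular: "nonneg_submodular U g"
  using OPT by (intro nonneg_submodular_worst_union) auto

lemma g_le_h: "g S \<le> h S"
  using worst_union_le[of "U - Z" "{}" OPT S] by auto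

lemma a_nonneg: "0 \<le> a"
  using a(1) by (meson divide_nonneg_nonneg of_nat_0_le_iff order_trans)

lemma gamma_nonneg: "0 \<le> \<gamma>" and beta_nonneg: "0 \<le> \<beta>"
  using OPT by (auto simp: \<gamma>_def \<beta>_def intro!: nonneg)

lemma q_bounds: "0 < q" "q \<le> 1"
  using k by (auto simp: q_def)

lemma lam_bounds: "0 \<le> lam" "lam \<le> 1"
  using q_bounds by (auto simp: lam_def)

lemma gamma_le_union:
  assumes "S \<subseteq> U" "S \<inter> Z = {}"
  shows "\<gamma> \<le> h S"
proof -
  have "(OPT \<union> S) \<inter> (OPT \<union> Z) = OPT" using assms by auto
  then have "f (OPT \<union> S \<union> (OPT \<union> Z)) + f OPT \<le> h S + f (OPT \<union> Z)"
    using union_inter_le[of "OPT \<union> S" "OPT \<union> Z"] assms OPT Z by simp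
  moreover have "0 \<le> f (OPT \<union> S \<union> (OPT \<union> Z))" "0 \<le> h S"
    using assms OPT Z by (auto intro!: nonneg)
  ultimately show ?thesis by (simp add: \<gamma>_def)
qed

lemma gamma_le_worst_union:
  assumes "S \<subseteq> U" "S \<inter> Z = {}"
  shows "\<gamma> \<le> g S"
proof -
  obtain R where R: "R \<subseteq> U - Z" "g S = f (OPT \<union> S \<union> R)"
    using worst_union_attained[OF Diff_subset] .
  then show ?thesis
    using gamma_le_union[of "S \<union> R"] assms by (auto simp: Un_assoc)
qed

lemma card_rest_ge:
  assumes "S \<subseteq> U" "card S \<le> k"
  shows "card U - 3 * k \<le> card (rest S)"
proof -
  have "card (Z \<union> OPT \<union> S) \<le> 3 * k"
    using card_Un_le[of "Z \<union> OPT" S] card_Un_le[of Z OPT] OPT Z assms by linarith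
  moreover have "card (rest S) = card U - card (Z \<union> OPT \<union> S)"
    using assms OPT Z finite_sub by (intro card_Diff_subset) auto
  ultimately show ?thesis by simp
qed

lemma greedy_gain_ge:
  assumes S: "S \<subseteq> U" "card S \<le> k" and E: "rest S \<subseteq> E" "E \<subseteq> U"
    and T: "lowest (\<lambda>u. - f (insert u S)) E T" "card T = k"
    and A: "A \<subseteq> E" "A \<subseteq> OPT"
  obtains b where "0 \<le> b" "b \<le> a"
    "f S + q * ((\<Sum>u\<in>A. add_gain S u) + b * (\<Sum>u\<in>rest S. add_gain S u))
        \<le> average T (\<lambda>u. f (insert u S))"
proof -
  have "lowest (\<lambda>u. - add_gain S u) E T" using T(1) by (auto simp: lowest_def)
  moreover have "card A \<le> card T" using A(2) OPT T(2) finite_sub card_mono by metis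
  moreover have "card T \<le> card (rest S)" using card_rest_ge[OF S] k T(2) by linarith
  moreover have "finite E" "A \<inter> rest S = {}" using E finite_sub A by auto
  ultimately obtain b where b: "0 \<le> b" "b \<le> real k / real (card (rest S))"
    "(\<Sum>u\<in>T. - add_gain S u) \<le> (\<Sum>u\<in>A. - add_gain S u) + b * (\<Sum>u\<in>rest S. - add_gain S u)"
    using lowest_two_level[OF _ _ A(1) E(1)] T(2) by metis
  have "real k / real (card (rest S)) \<le> real k / real (card U - 3 * k)"
    using card_rest_ge[OF S] k by (intro divide_left_mono mult_pos_pos) auto
  then have "b \<le> a" using b(2) a(1) by (meson order_trans)
  moreover have "(\<Sum>u\<in>A. add_gain S u) + b * (\<Sum>u\<in>rest S. add_gain S u) \<le> (\<Sum>u\<in>T. add_gain S u)"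
    using b(3) unfolding sum_negf mult_minus_right by linarith
  then have "real k * f S + ((\<Sum>u\<in>A. add_gain S u) + b * (\<Sum>u\<in>rest S. add_gain S u))
      \<le> (\<Sum>u\<in>T. f (insert u S))"
    by (simp only: sum_subtractf[of _ _ T] sum_constant T(2))
  then have "(real k * f S + ((\<Sum>u\<in>A. add_gain S u) + b * (\<Sum>u\<in>rest S. add_gain S u))) / real k
      \<le> average T (\<lambda>u. f (insert u S))"
    unfolding average_def T(2) by (rule divide_right_mono) simp
  then have "f S + q * ((\<Sum>u\<in>A. add_gain S u) + b * (\<Sum>u\<in>rest S. add_gain S u))
      \<le> average T (\<lambda>u. f (insert u S))"
    using k(1) by (simp add: add_divide_distrib q_def)
  ultimately show thesis using that b(1) by blast
qed

lemma free_step: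
  assumes S: "S \<subseteq> U" "card S \<le> k" and T: "lowest (\<lambda>u. - f (insert u S)) (U - S) T" "card T = k"
  shows "lam * f S + q * target S \<le> average T (\<lambda>u. f (insert u S))"
proof -
  obtain b where b: "0 \<le> b" "b \<le> a"
    "f S + q * ((\<Sum>u\<in>OPT - S. add_gain S u) + b * (\<Sum>u\<in>rest S. add_gain S u))
        \<le> average T (\<lambda>u. f (insert u S))"
    using greedy_gain_ge[OF S _ _ T, of "OPT - S"] OPT by auto
  have union_gain: "h S - f S \<le> (\<Sum>u\<in>OPT - S. add_gain S u)"
    using union_le_sum_add_gain[of S "OPT - S"] S OPT by (auto simp: Un_commute)
  have fin: "finite (OPT - S)" "finite (rest S)" using OPT finite_sub by auto
  have "S \<union> (OPT - S \<union> rest S) = OPT \<union> S \<union> rest S" by auto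
  then have "g S - f S \<le> f (S \<union> (OPT - S \<union> rest S)) - f S"
    using worst_union_le[of "U - Z" "rest S" OPT S] by auto
  also have "\<dots> \<le> (\<Sum>u\<in>OPT - S \<union> rest S. add_gain S u)"
    using S OPT by (intro union_le_sum_add_gain) auto
  also have "\<dots> = (\<Sum>u\<in>OPT - S. add_gain S u) + (\<Sum>u\<in>rest S. add_gain S u)"
    using fin by (intro sum.union_disjoint) auto
  finally have worst_gain: "g S - f S \<le> (\<Sum>u\<in>OPT - S. add_gain S u) + (\<Sum>u\<in>rest S. add_gain S u)" .
  have "a * (h S - g S) \<ge> b * (h S - g S)" using b(2) g_le_h by (intro mult_right_mono) auto
  then have "target S - f S \<le> (1 - b) * (h S - f S) + b * (g S - f S)"
    by (simp add: target_def algebra_simps)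
  also have "\<dots> \<le> (1 - b) * (\<Sum>u\<in>OPT - S. add_gain S u)
      + b * ((\<Sum>u\<in>OPT - S. add_gain S u) + (\<Sum>u\<in>rest S. add_gain S u))"
    using b a union_gain worst_gain by (intro add_mono mult_left_mono) auto
  also have "\<dots> = (\<Sum>u\<in>OPT - S. add_gain S u) + b * (\<Sum>u\<in>rest S. add_gain S u)"
    by (simp add: algebra_simps)
  finally have "f S + q * (target S - f S) \<le> average T (\<lambda>u. f (insert u S))"
    using b(3) q_bounds by (meson add_left_mono less_imp_le mult_left_mono order_trans)
  then show ?thesis by (simp add: lam_def algebra_simps)
qed

lemma avoiding_step:
  assumes S: "S \<subseteq> U - Z" "card S \<le> k"
    and T: "lowest (\<lambda>u. - f (insert u S)) (U - Z - S) T" "card T = k"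
  shows "(1 - (1 + a) * q) * f S + q * (h S - \<beta>) \<le> average T (\<lambda>u. f (insert u S))"
proof -
  let ?A = "OPT - Z - S"
  have SU: "S \<subseteq> U" using S by auto
  obtain b where b: "0 \<le> b" "b \<le> a"
    "f S + q * ((\<Sum>u\<in>?A. add_gain S u) + b * (\<Sum>u\<in>rest S. add_gain S u))
        \<le> average T (\<lambda>u. f (insert u S))"
    using greedy_gain_ge[OF SU S(2) _ _ T, of ?A] OPT by auto
  have "S \<union> ?A \<union> (OPT \<inter> Z) = OPT \<union> S" "(S \<union> ?A) \<inter> (OPT \<inter> Z) = {}" using S by auto
  then have "h S + f {} \<le> f (S \<union> ?A) + \<beta>"
    using union_inter_le[of "S \<union> ?A" "OPT \<inter> Z"] SU OPT by (auto simp: \<beta>_def)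
  moreover have "f (S \<union> ?A) - f S \<le> (\<Sum>u\<in>?A. add_gain S u)"
    using SU OPT by (intro union_le_sum_add_gain) auto
  moreover have "0 \<le> f {}" by (rule nonneg) simp
  ultimately have "h S - \<beta> - f S \<le> (\<Sum>u\<in>?A. add_gain S u)" by linarith
  moreover have "f (S \<union> rest S) - f S \<le> (\<Sum>u\<in>rest S. add_gain S u)"
    using SU by (intro union_le_sum_add_gain) auto
  then have "- f S \<le> (\<Sum>u\<in>rest S. add_gain S u)"
    using nonneg[of "S \<union> rest S"] SU by auto
  then have "b * (- f S) \<le> b * (\<Sum>u\<in>rest S. add_gain S u)" using b(1) by (rule mult_left_mono)
  moreover have "b * f S \<le> a * f S" using b(2) nonneg[OF SU] by (rule mult_right_mono)
  ultimately have "h S - \<beta> - f S - a * f S \<le> (\<Sum>u\<in>?A. add_gain S u) + b * (\<Sum>u\<in>rest S. add_gain S u)"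
    by linarith
  then have "f S + q * (h S - \<beta> - f S - a * f S) \<le> average T (\<lambda>u. f (insert u S))"
    using b(3) q_bounds by (meson add_left_mono less_imp_le mult_left_mono order_trans)
  then show ?thesis by (simp add: algebra_simps)
qed

lemma average_insert_ge_lam:
  assumes F: "nonneg_submodular U F" and S: "S \<subseteq> U" and T: "T \<subseteq> U" "card T = k" and c: "c \<le> F (S \<union> T)"
  shows "lam * F S + q * c \<le> average T (\<lambda>u. F (insert u S))"
proof -
  have "q * c \<le> q * F (S \<union> T)" using c q_bounds by (intro mult_left_mono) auto
  moreover have "T \<noteq> {}" using T k by auto
  ultimately show ?thesis
    using nonneg_submodular.average_insert_ge[OF F S T(1)] T(2) by (simp add: lam_def q_def)
qed

lemma target_step:
  assumes "S \<subseteq> U" "T \<subseteq> U" "card T = k"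
  shows "lam * target S \<le> average T (\<lambda>u. target (insert u S))"
proof -
  have decay: "lam * F S \<le> average T (\<lambda>u. F (insert u S))" if F: "nonneg_submodular U F" for F
    using average_insert_ge_lam[OF F assms, of 0] nonneg_submodular.nonneg[OF F, of "S \<union> T"] assms
      by simp
  have "(1 - a) * (lam * h S) + a * (lam * g S)
      \<le> (1 - a) * average T (\<lambda>u. h (insert u S)) + a * average T (\<lambda>u. g (insert u S))"
    using a a_nonneg by (intro add_mono mult_left_mono decay h_submodular g_submodular) auto
  then show ?thesis
    unfolding target_def average_add average_cmult by (simp add: algebra_simps)
qed

definition "free_pot i S = lam ^ (k - i) * f S + real (k - i) * q * lam ^ (k - i - 1) * target S"

lemma free_pot_step:
  assumes i: "i < k" and S: "S \<subseteq> U" "card S \<le> k"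
    and T: "lowest (\<lambda>u. - f (insert u S)) (U - S) T" "card T = k"
  shows "free_pot i S \<le> average T (\<lambda>u. free_pot (Suc i) (insert u S))"
proof -
  obtain d where d: "k - i = Suc d" "k - Suc i = d"
    using i by (metis Suc_diff_Suc diff_Suc_eq_diff_pred diff_Suc_1 diff_commute)
  have TU: "T \<subseteq> U" using T(1) by (auto simp: lowest_def)
  have "free_pot i S = lam ^ d * (lam * f S + q * target S)
      + real d * q * lam ^ (d - 1) * (lam * target S)"
    unfolding free_pot_def d by (cases d) (simp_all add: algebra_simps)
  also have "\<dots> \<le> lam ^ d * average T (\<lambda>u. f (insert u S))
      + real d * q * lam ^ (d - 1) * average T (\<lambda>u. target (insert u S))"
    using lam_bounds q_bounds free_step[OF S T] target_step[OF S(1) TU T(2)]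
    by (intro add_mono mult_left_mono) auto
  also have "\<dots> = average T (\<lambda>u. free_pot (Suc i) (insert u S))"
    unfolding free_pot_def d average_add average_cmult ..
  finally show ?thesis .
qed

end

context aided_greedy
begin

text \<open>
  With \<open>j\<close> avoiding rounds to go, the potential is a combination of \<open>f S\<close>, \<open>f (OPT \<union> S)\<close> and a constant.
  Its coefficients satisfy the recurrences that the bounds for one round require, with initial values
  that make it coincide with the potential of the free rounds at \<open>j = 0\<close>; they arise from the exact
  solutions of the corresponding differential equations by truncation in \<open>a\<close>.
\<close>

abbreviation "\<tau> j \<equiv> real j * q"
definition "free_decay = lam ^ (k - s)"
definition "free_reach = real (k - s) * q * lam ^ (k - s - 1)"
definition "f_coeff j = free_decay * (lam ^ j - a * \<tau> j)"
definition "h_coeff j = lam ^ j * (free_reach * (1 - a))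
    + free_decay * (\<tau> j * lam ^ j - a * (\<tau> j)\<^sup>2 / 2)"
definition "\<gamma>_coeff j = free_reach * a + free_reach * (1 - a) * (1 - lam ^ j)
  + free_decay * (1 - lam ^ j - \<tau> j * lam ^ j - \<tau> j * q - a * \<tau> j ^ 3 / 6)"
definition "\<beta>_coeff j = free_decay * (1 - lam ^ j - a * (\<tau> j * (\<tau> j - q)) / 2)"

lemma free_nonneg: "0 \<le> free_decay" "0 \<le> free_reach"
  using lam_bounds q_bounds by (auto simp: free_decay_def free_reach_def)

lemma lam_power_bounds: "0 \<le> lam ^ j" "lam ^ j \<le> 1"
  using lam_bounds by (auto intro: power_le_one)

lemma tau_Suc: "\<tau> (Suc j) = \<tau> j + q"
  by (simp add: algebra_simps)

lemma f_coeff_Suc: "f_coeff (Suc j) \<le> (1 - (1 + a) * q) * f_coeff j"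
proof -
  have "0 \<le> a * q * (1 - lam ^ j) + a * \<tau> j * q + a * (a * \<tau> j * q)"
    using a_nonneg q_bounds lam_power_bounds by (intro add_nonneg_nonneg mult_nonneg_nonneg) auto
  then have "lam ^ Suc j - a * \<tau> (Suc j) \<le> (1 - (1 + a) * q) * (lam ^ j - a * \<tau> j)"
    by (simp add: tau_Suc lam_def algebra_simps)
  from mult_left_mono[OF this free_nonneg(1)] show ?thesis
    by (simp only: f_coeff_def mult.left_commute)
qed

lemma h_coeff_Suc: "h_coeff (Suc j) \<le> lam * h_coeff j + q * f_coeff j"
proof -
  have "0 \<le> lam ^ j * q\<^sup>2 + a * (\<tau> j)\<^sup>2 * q / 2 + a * q\<^sup>2 / 2"
    using a_nonneg q_bounds lam_power_bounds by (intro add_nonneg_nonneg) auto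
  then have "\<tau> (Suc j) * lam ^ Suc j - a * (\<tau> (Suc j))\<^sup>2 / 2
      \<le> lam * (\<tau> j * lam ^ j - a * (\<tau> j)\<^sup>2 / 2) + q * (lam ^ j - a * \<tau> j)"
    unfolding tau_Suc by (simp add: lam_def field_simps power2_eq_square)
  from mult_left_mono[OF this free_nonneg(1)] show ?thesis
    by (simp add: f_coeff_def h_coeff_def algebra_simps)
qed

lemma \<gamma>_coeff_Suc: "\<gamma>_coeff (Suc j) \<le> \<gamma>_coeff j + q * h_coeff j"
proof -
  have "0 \<le> q\<^sup>2 * (1 - lam ^ j) + a * \<tau> j * q\<^sup>2 / 2 + a * q ^ 3 / 6"
    using a_nonneg q_bounds lam_power_bounds by (intro add_nonneg_nonneg mult_nonneg_nonneg) auto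
  then have "1 - lam ^ Suc j - \<tau> (Suc j) * lam ^ Suc j - \<tau> (Suc j) * q - a * \<tau> (Suc j) ^ 3 / 6
      \<le> (1 - lam ^ j - \<tau> j * lam ^ j - \<tau> j * q - a * \<tau> j ^ 3 / 6)
          + q * (\<tau> j * lam ^ j - a * (\<tau> j)\<^sup>2 / 2)"
    unfolding tau_Suc by (simp add: lam_def field_simps power2_eq_square power3_eq_cube)
  from mult_left_mono[OF this free_nonneg(1)] show ?thesis
    by (simp add: \<gamma>_coeff_def h_coeff_def lam_def algebra_simps)
qed

lemma \<beta>_coeff_Suc: "\<beta>_coeff (Suc j) = \<beta>_coeff j + q * f_coeff j"
  by (simp add: \<beta>_coeff_def f_coeff_def tau_Suc lam_def field_simps)

lemma coeff_nonneg:
  assumes "7 * a \<le> 1" "5 * j \<le> 2 * k"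
  shows "0 \<le> f_coeff j" "0 \<le> h_coeff j"
proof -
  have \<tau>: "0 \<le> \<tau> j" "\<tau> j \<le> 2 / 5" using assms(2) k by (auto simp: q_def field_simps)
  have "1 - \<tau> j \<le> lam ^ j"
    using Bernoulli_inequality[of "- q" j] q_bounds by (simp add: lam_def)
  moreover have "a * \<tau> j \<le> 1 / 7 * (2 / 5)" using \<tau> assms(1) a_nonneg by (intro mult_mono) auto
  ultimately have decay: "a * \<tau> j \<le> lam ^ j" using \<tau>(2) by linarith
  then show "0 \<le> f_coeff j" using free_nonneg by (simp add: f_coeff_def)
  have "0 \<le> lam ^ j - a * \<tau> j / 2" using decay lam_power_bounds(1)[of j] by linarith
  then have "0 \<le> \<tau> j * (lam ^ j - a * \<tau> j / 2)" using \<tau>(1) by (rule mult_nonneg_nonneg[rotated])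
  then have "0 \<le> \<tau> j * lam ^ j - a * (\<tau> j)\<^sup>2 / 2" by (simp add: algebra_simps power2_eq_square)
  then show "0 \<le> h_coeff j"
    unfolding h_coeff_def using free_nonneg lam_power_bounds a
      by (intro add_nonneg_nonneg mult_nonneg_nonneg) auto
qed

definition "avoid_pot i S = f_coeff (s - i) * f S + h_coeff (s - i) * h S
  + (\<gamma> * \<gamma>_coeff (s - i) - \<beta> * \<beta>_coeff (s - i))"

lemma avoid_pot_step:
  assumes as: "7 * a \<le> 1" "5 * s \<le> 2 * k" and i: "i < s"
    and S: "S \<subseteq> U - Z" "card S \<le> k" and T: "lowest (\<lambda>u. - f (insert u S)) (U - Z - S) T" "card T = k"
  shows "avoid_pot i S \<le> average T (\<lambda>u. avoid_pot (Suc i) (insert u S))"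
proof -
  obtain d where d: "s - i = Suc d" "s - Suc i = d" using i by (metis Suc_diff_Suc diff_Suc_1)
  have coeffs: "0 \<le> f_coeff d" "0 \<le> h_coeff d" using coeff_nonneg[OF as(1), of d] d as by auto
  have SU: "S \<subseteq> U" and TU: "T \<subseteq> U - Z" using S T(1) by (auto simp: lowest_def)
  have T_fin: "finite T" "T \<noteq> {}" using TU finite_sub T(2) k by (auto intro: finite_subset)
  have f_step: "(1 - (1 + a) * q) * f S + q * (h S - \<beta>) \<le> average T (\<lambda>u. f (insert u S))"
    by (rule avoiding_step[OF S T])
  have "\<gamma> \<le> h (S \<union> T)" using S(1) TU by (intro gamma_le_union) auto
  then have h_step: "lam * h S + q * \<gamma> \<le> average T (\<lambda>u. h (insert u S))"
    using TU by (intro average_insert_ge_lam h_submodular SU T) auto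
  have "avoid_pot i S \<le> (1 - (1 + a) * q) * f_coeff d * f S + (lam * h_coeff d + q * f_coeff d) * h S
      + (\<gamma> * (\<gamma>_coeff d + q * h_coeff d) - \<beta> * (\<beta>_coeff d + q * f_coeff d))"
    unfolding avoid_pot_def d \<beta>_coeff_Suc using SU OPT nonneg gamma_nonneg
    by (intro add_mono diff_right_mono mult_right_mono mult_left_mono f_coeff_Suc h_coeff_Suc
      \<gamma>_coeff_Suc) auto
  also have "\<dots> = f_coeff d * ((1 - (1 + a) * q) * f S + q * (h S - \<beta>))
      + h_coeff d * (lam * h S + q * \<gamma>)
      + (\<gamma> * \<gamma>_coeff d - \<beta> * \<beta>_coeff d)"
    by (simp add: algebra_simps)
  also have "\<dots> \<le> f_coeff d * average T (\<lambda>u. f (insert u S))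
      + h_coeff d * average T (\<lambda>u. h (insert u S))
      + (\<gamma> * \<gamma>_coeff d - \<beta> * \<beta>_coeff d)"
    using f_step h_step coeffs by (intro add_right_mono add_mono mult_left_mono)
  also have "\<dots> = average T (\<lambda>u. avoid_pot (Suc i) (insert u S))"
    unfolding avoid_pot_def d average_add average_cmult average_const[OF T_fin] ..
  finally show ?thesis .
qed

lemma avoid_pot_end:
  assumes "S \<subseteq> U - Z"
  shows "avoid_pot s S \<le> free_pot s S"
proof -
  have "\<gamma> \<le> g S" using assms by (intro gamma_le_worst_union) auto
  then have "free_reach * a * \<gamma> \<le> free_reach * a * g S"
    using free_nonneg a_nonneg by (intro mult_left_mono) auto
  moreover have "free_pot s S = free_decay * f S + free_reach * (1 - a) * h S + free_reach * a * g S"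
    by (simp add: free_pot_def free_decay_def free_reach_def target_def algebra_simps)
  ultimately show ?thesis
    by (simp add: avoid_pot_def f_coeff_def h_coeff_def \<gamma>_coeff_def \<beta>_coeff_def mult_ac)
qed

definition "greedy_pot i S = (if i < s then avoid_pot i S else free_pot i S)"

lemma avoid_pot_le_greedy_pot:
  assumes "i \<le> s" "S \<subseteq> U - Z"
  shows "avoid_pot i S \<le> greedy_pot i S"
  using assms avoid_pot_end by (cases "i = s") (auto simp: greedy_pot_def)

lemma greedy_pot_final: "greedy_pot k S = f S"
  using s by (simp add: greedy_pot_def free_pot_def)

end

definition (in nonneg_submodular) greedy_submartingale ::
    "nat \<Rightarrow> nat \<Rightarrow> 'a set \<Rightarrow> (nat \<Rightarrow> 'a set \<Rightarrow> real) \<Rightarrow> bool" where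
  "greedy_submartingale k s Z V \<longleftrightarrow> (\<forall>i S T. i < k \<longrightarrow> S \<subseteq> U \<longrightarrow> card S = i \<longrightarrow> (i < s \<longrightarrow> S \<inter> Z = {}) \<longrightarrow>
     lowest (\<lambda>u. - f (insert u S)) (if i < s then U - Z - S else U - S) T \<longrightarrow> card T = k \<longrightarrow>
     V i S \<le> average T (\<lambda>u. V (Suc i) (insert u S)))"

lemma (in aided_greedy) greedy_pot_submartingale:
  assumes "s = 0 \<or> 7 * a \<le> 1 \<and> 5 * s \<le> 2 * k"
  shows "greedy_submartingale k s Z greedy_pot"
  unfolding greedy_submartingale_def
proof (intro allI impI)
  fix i S T
  assume i: "i < k" and S: "S \<subseteq> U" "card S = i" "i < s \<longrightarrow> S \<inter> Z = {}"
    and T: "lowest (\<lambda>u. - f (insert u S)) (if i < s then U - Z - S else U - S) T" "card T = k"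
  show "greedy_pot i S \<le> average T (\<lambda>u. greedy_pot (Suc i) (insert u S))"
  proof (cases "i < s")
    case True
    then have SZ: "S \<subseteq> U - Z" and TZ: "T \<subseteq> U - Z" using S T(1) by (auto simp: lowest_def)
    have "avoid_pot i S \<le> average T (\<lambda>u. avoid_pot (Suc i) (insert u S))"
      using True assms i S(2) T by (intro avoid_pot_step SZ) auto
    also have "\<dots> \<le> average T (\<lambda>u. greedy_pot (Suc i) (insert u S))"
      using True SZ TZ by (intro average_mono avoid_pot_le_greedy_pot) auto
    finally show ?thesis using True by (simp add: greedy_pot_def)
  next
    case False
    then show ?thesis using free_pot_step[OF i S(1)] S(2) T i by (simp add: greedy_pot_def)
  qed
qed

lemma exp_power_lower:
  fixes c :: real assumes "0 \<le> c" "c \<le> 1"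
  shows "(1 - c / 64) ^ 64 \<le> exp (- c)"
proof -
  have "1 - c / 64 \<le> exp (- (c / 64))" using exp_ge_add_one_self[of "- (c / 64)"] by simp
  then have "(1 - c / 64) ^ 64 \<le> exp (- (c / 64)) ^ 64" using assms by (intro power_mono) auto
  also have "exp (- (c / 64)) ^ 64 = exp (- c)" by (simp add: exp_of_nat_mult[symmetric])
  finally show ?thesis .
qed

lemma exp_minus_399_le: "exp (- (399 / 1000) :: real) \<le> 672 / 1000"
proof -
  have "(1 + (399 / 4000) + (399 / 4000)\<^sup>2 / 2 :: real) \<le> exp (399 / 4000)"
    by (rule exp_lower_Taylor_quadratic) simp
  then have "(1 + (399 / 4000) + (399 / 4000)\<^sup>2 / 2 :: real) ^ 4 \<le> exp (399 / 4000) ^ 4"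
    by (intro power_mono) auto
  also have "exp (399 / 4000 :: real) ^ 4 = exp (399 / 1000)"
    by (simp add: exp_of_nat_mult[symmetric])
  finally have "1000 / 672 \<le> exp (399 / 1000 :: real)"
    by (rule order_trans[rotated]) (simp add: power2_eq_square eval_nat_numeral)
  then show ?thesis by (simp add: exp_minus field_simps)
qed

lemma exp_le_power_one_minus_inverse:
  assumes "2 \<le> k"
  shows "exp (- (real j / (real k - 1))) \<le> (1 - 1 / real k) ^ j"
proof -
  have k: "0 < real k - 1" using assms by auto
  have "1 + 1 / (real k - 1) \<le> exp (1 / (real k - 1))" by (rule exp_ge_add_one_self)
  then have "inverse (exp (1 / (real k - 1))) \<le> inverse (1 + 1 / (real k - 1))"
    using k by (intro le_imp_inverse_le add_pos_pos) auto
  also have "\<dots> = 1 - 1 / real k" using k by (simp add: field_simps)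
  finally have "exp (- (1 / (real k - 1))) ^ j \<le> (1 - 1 / real k) ^ j"
    by (intro power_mono) (simp_all add: exp_minus)
  then show ?thesis by (simp add: exp_of_nat_mult[symmetric])
qed

lemma power_one_minus_inverse_le_exp:
  assumes "1 \<le> k"
  shows "(1 - 1 / real k) ^ j \<le> exp (- (real j / real k))"
proof -
  have "1 - 1 / real k \<le> exp (- (1 / real k))" using exp_ge_add_one_self[of "- (1 / real k)"] by simp
  then have "(1 - 1 / real k) ^ j \<le> exp (- (1 / real k)) ^ j" using assms by (intro power_mono) auto
  then show ?thesis by (simp add: exp_of_nat_mult[symmetric])
qed

lemma avoiding_margin:
  fixes \<tau> q x P \<gamma> \<beta> \<eta> :: real
  assumes \<tau>: "399 / 1000 \<le> \<tau>" "\<tau> \<le> 4 / 10" and q: "0 \<le> q" "q \<le> 1 / 1000"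
    and x: "669 / 1000 \<le> x" "x \<le> 672 / 1000"
    and P: "0 \<le> P" and \<gamma>: "\<gamma> \<le> P" and \<beta>: "0 \<le> \<beta>" and \<eta>: "0 \<le> \<eta>"
    and sum: "P - \<gamma> + \<beta> \<le> 7364 / 10000 * P + \<eta>"
  shows "678 / 1000 * P - \<eta> \<le>
    ((1 - \<tau>) * (6 / 7 * x) + (\<tau> * x - \<tau>\<^sup>2 / 14)) * P
    + ((1 - \<tau>) * (1 / 7 + 6 / 7 * (1 - x)) + (1 - x - \<tau> * x - \<tau> * q - \<tau> ^ 3 / 42)) * \<gamma>
    - (1 - x - \<tau> * (\<tau> - q) / 14) * \<beta>"
    (is "_ \<le> ?p * P + ?g * \<gamma> - ?b * \<beta>")
proof -
  have "399 / 1000 * (669 / 1000) \<le> \<tau> * x" using \<tau> x by (intro mult_mono) auto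
  then have \<tau>x: "2669 / 10000 \<le> \<tau> * x" by simp
  have "(399 / 1000)\<^sup>2 \<le> \<tau>\<^sup>2" "\<tau>\<^sup>2 \<le> (4 / 10)\<^sup>2" using \<tau> by (intro power_mono; simp)+
  then have \<tau>2: "1592 / 10000 \<le> \<tau>\<^sup>2" "\<tau>\<^sup>2 \<le> 16 / 100" by (simp_all add: power2_eq_square)
  have "\<tau> ^ 3 \<le> (4 / 10) ^ 3" using \<tau> by (intro power_mono) auto
  then have \<tau>3: "0 \<le> \<tau> ^ 3" "\<tau> ^ 3 \<le> 64 / 1000" using \<tau> by (simp_all add: power3_eq_cube)
  have "\<tau> * q \<le> 4 / 10 * (1 / 1000)" using \<tau> q by (intro mult_mono) auto
  then have \<tau>q: "0 \<le> \<tau> * q" "\<tau> * q \<le> 4 / 10000" using \<tau> q by auto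
  have g: "?g = 2 - \<tau> - 13 / 7 * x - \<tau> * x / 7 - \<tau> * q - \<tau> ^ 3 / 42"
    and p: "?p + ?g = 2 - \<tau> - x - \<tau>\<^sup>2 / 14 - \<tau> * q - \<tau> ^ 3 / 42"
    and b: "?b = 1 - x - \<tau>\<^sup>2 / 14 + \<tau> * q / 14"
    by (simp_all add: field_simps power2_eq_square)
  have "9146 / 10000 \<le> ?p + ?g" unfolding p using \<tau> x \<tau>2 \<tau>q \<tau>3 by linarith
  then have "9146 / 10000 * P \<le> (?p + ?g) * P" using P by (rule mult_right_mono)
  moreover have "?g \<le> 3206 / 10000" unfolding g using \<tau> x \<tau>x \<tau>q \<tau>3 by linarith
  then have "?g * (P - \<gamma>) \<le> 3206 / 10000 * (P - \<gamma>)" using \<gamma> by (intro mult_right_mono) auto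
  moreover have "?b \<le> 3206 / 10000" unfolding b using x \<tau>2 \<tau>q by linarith
  then have "?b * \<beta> \<le> 3206 / 10000 * \<beta>" using \<beta> by (rule mult_right_mono)
  ultimately have "9146 / 10000 * P - 3206 / 10000 * (P - \<gamma> + \<beta>)
      \<le> (?p + ?g) * P - ?g * (P - \<gamma>) - ?b * \<beta>"
    by (simp only: distrib_left)
  then have "9146 / 10000 * P - 3206 / 10000 * (P - \<gamma> + \<beta>) \<le> ?p * P + ?g * \<gamma> - ?b * \<beta>"
    by (simp only: distrib_right right_diff_distrib)
  moreover have "678 / 1000 * P - \<eta> \<le> 9146 / 10000 * P - 3206 / 10000 * (P - \<gamma> + \<beta>)"
    using sum P \<eta> by (simp add: field_simps)
  ultimately show ?thesis by (rule order_trans[rotated])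
qed

context aided_greedy
begin

lemma lam_eq: "lam = 1 - 1 / real k"
  by (simp add: lam_def q_def)

lemma opt_nonneg: "0 \<le> f OPT"
  using OPT nonneg by auto

lemma greedy_pot_start_unaided:
  assumes "s = 0"
  shows "(1 - a) * (exp (- 1) * f OPT) \<le> greedy_pot 0 {}"
proof -
  have "exp (- 1) \<le> lam ^ (k - 1)"
  proof (cases "k = 1")
    case False
    then have "2 \<le> k" using k by linarith
    then show ?thesis
      using exp_le_power_one_minus_inverse[of k "k - 1"] by (simp add: lam_eq of_nat_diff)
  qed simp
  then have "exp (- 1) * ((1 - a) * f OPT) \<le> lam ^ (k - 1) * ((1 - a) * f OPT)"
    using a opt_nonneg by (intro mult_right_mono) auto
  also have "\<dots> \<le> lam ^ (k - 1) * target {}"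
  proof (rule mult_left_mono)
    have "0 \<le> g {}" by (rule nonneg_submodular.nonneg[OF g_submodular]) simp
    then show "(1 - a) * f OPT \<le> target {}" using a_nonneg by (simp add: target_def)
  qed (rule lam_power_bounds)
  also have "\<dots> \<le> lam ^ k * f {} + lam ^ (k - 1) * target {}"
    using nonneg[of "{}"] lam_power_bounds by simp
  also have "\<dots> = greedy_pot 0 {}"
    unfolding greedy_pot_def free_pot_def using assms k by (simp add: q_def)
  finally show ?thesis by (simp add: mult_ac)
qed

lemma avoiding_decay_bounds:
  assumes k: "1000 \<le> k" and s: "s = 2 * k div 5"
  shows "399 / 1000 \<le> \<tau> s" "\<tau> s \<le> 4 / 10" "q \<le> 1 / 1000" "669 / 1000 \<le> lam ^ s" "lam ^ s \<le> 672 / 1000"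
    "546 / 1000 \<le> free_decay" "(1 - \<tau> s) * free_decay \<le> free_reach"
proof -
  have "5 * s \<le> 2 * k" "2 * k \<le> 5 * s + 4" unfolding s by presburger+
  then have sr: "5 * real s \<le> 2 * real k" "2 * real k \<le> 5 * real s + 4" by linarith+
  have sk: "s < k" unfolding s using k by auto
  show \<tau>: "399 / 1000 \<le> \<tau> s" "\<tau> s \<le> 4 / 10" and "q \<le> 1 / 1000"
    using sr k by (auto simp: q_def field_simps)
  have "lam ^ s \<le> exp (- \<tau> s)"
    using power_one_minus_inverse_le_exp[of k s] k by (simp add: lam_eq q_def)
  also have "\<dots> \<le> exp (- (399 / 1000))" using \<tau> by simp
  finally show "lam ^ s \<le> 672 / 1000" using exp_minus_399_le by linarith
  have power_ge: "(1 - c / 64) ^ 64 \<le> lam ^ j" if "0 \<le> c" "c \<le> 1" "real j \<le> c * (real k - 1)" for c j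
  proof -
    have "(1 - c / 64) ^ 64 \<le> exp (- c)" using that by (intro exp_power_lower)
    also have "\<dots> \<le> exp (- (real j / (real k - 1)))" using that k by (simp add: field_simps)
    also have "\<dots> \<le> lam ^ j" unfolding lam_eq using k by (intro exp_le_power_one_minus_inverse) simp
    finally show ?thesis .
  qed
  have "(669 / 1000 :: real) \<le> (1 - (4005 / 10000) / 64) ^ 64" by (simp add: power_divide)
  also have "\<dots> \<le> lam ^ s" using sr k by (intro power_ge) (auto simp: field_simps)
  finally show "669 / 1000 \<le> lam ^ s" .
  have "(546 / 1000 :: real) \<le> (1 - (6015 / 10000) / 64) ^ 64" by (simp add: power_divide)
  also have "\<dots> \<le> free_decay"
    unfolding free_decay_def using sr k sk by (intro power_ge) (auto simp: field_simps of_nat_diff)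
  finally show "546 / 1000 \<le> free_decay" .
  have fraction: "real (k - s) * q = 1 - \<tau> s" using sk by (simp add: q_def of_nat_diff field_simps)
  show "(1 - \<tau> s) * free_decay \<le> free_reach"
    unfolding free_decay_def free_reach_def fraction using \<tau> lam_bounds
    by (intro mult_left_mono power_decreasing) auto
qed

lemma start_combination_le_greedy_pot:
  assumes "0 < s" "5 * s \<le> 2 * k" "a = 1 / 7"
  shows "h_coeff s * f OPT + (\<gamma> * \<gamma>_coeff s - \<beta> * \<beta>_coeff s) \<le> greedy_pot 0 {}"
proof -
  have "0 \<le> f_coeff s" using s assms by (intro coeff_nonneg) auto
  then show ?thesis using assms(1) nonneg[of "{}"] by (simp add: greedy_pot_def avoid_pot_def)
qed

lemma greedy_pot_start_aided:
  assumes k: "1000 \<le> k" and s: "s = 2 * k div 5" and a: "a = 1 / 7" and \<eta>: "0 \<le> \<eta>"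
    and sum: "f (OPT \<union> Z) + f (OPT \<inter> Z) \<le> 2 * f Z + \<eta>" and small: "f Z \<le> exp (- 1) * f OPT"
  shows "exp (- 1) * f OPT - \<eta> \<le> greedy_pot 0 {}"
proof -
  define P where "P = f OPT"
  define t where "t = \<tau> s"
  define x where "x = lam ^ s"
  note decay_bounds = avoiding_decay_bounds[OF k s, folded t_def x_def]
  define h_reach where "h_reach = 6 / 7 * x"
  define \<gamma>_reach where "\<gamma>_reach = 1 / 7 + 6 / 7 * (1 - x)"
  define h_decay where "h_decay = t * x - t\<^sup>2 / 14"
  define \<gamma>_decay where "\<gamma>_decay = 1 - x - t * x - t * q - t ^ 3 / 42"
  define \<beta>_decay where "\<beta>_decay = 1 - x - t * (t - q) / 14"
  have P: "0 \<le> P" using opt_nonneg by (simp add: P_def)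
  then have exp_le: "exp (- 1) * P \<le> 3682 / 10000 * P" using exp_minus_1_le by (intro mult_right_mono)
  have decay: "free_decay \<le> 1" using lam_power_bounds by (simp add: free_decay_def)
  have \<gamma>: "\<gamma> \<le> P" using P nonneg[of "OPT \<union> Z"] OPT Z by (simp add: \<gamma>_def P_def)
  have "P - \<gamma> + \<beta> \<le> f (OPT \<union> Z) + f (OPT \<inter> Z)" by (simp add: \<gamma>_def \<beta>_def P_def)
  then have "P - \<gamma> + \<beta> \<le> 7364 / 10000 * P + \<eta>" using sum small exp_le unfolding P_def by linarith
  then have margin: "678 / 1000 * P - \<eta> \<le> ((1 - t) * h_reach + h_decay) * P
      + ((1 - t) * \<gamma>_reach + \<gamma>_decay) * \<gamma> - \<beta>_decay * \<beta>"
    unfolding h_reach_def \<gamma>_reach_def h_decay_def \<gamma>_decay_def \<beta>_decay_def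
    using decay_bounds q_bounds P \<gamma> beta_nonneg \<eta> by (intro avoiding_margin) auto
  have "exp (- 1) * P - \<eta> \<le> 546 / 1000 * (678 / 1000 * P) - \<eta>" using exp_le P by simp
  also have "\<dots> \<le> free_decay * (678 / 1000 * P) - free_decay * \<eta>"
    using decay_bounds(6) P mult_right_mono[OF decay \<eta>] by (intro diff_mono mult_right_mono) auto
  also have "\<dots> = free_decay * (678 / 1000 * P - \<eta>)" by (simp add: right_diff_distrib)
  also have "\<dots> \<le> free_decay * (((1 - t) * h_reach + h_decay) * P
      + ((1 - t) * \<gamma>_reach + \<gamma>_decay) * \<gamma> - \<beta>_decay * \<beta>)"
    using margin decay_bounds(6) by (intro mult_left_mono) auto
  also have "\<dots> = (1 - t) * free_decay * (h_reach * P + \<gamma>_reach * \<gamma>)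
      + free_decay * (h_decay * P + \<gamma>_decay * \<gamma> - \<beta>_decay * \<beta>)"
    by (simp add: algebra_simps)
  also have "\<dots> \<le> free_reach * (h_reach * P + \<gamma>_reach * \<gamma>)
      + free_decay * (h_decay * P + \<gamma>_decay * \<gamma> - \<beta>_decay * \<beta>)"
    using decay_bounds P gamma_nonneg
    by (intro add_right_mono mult_right_mono add_nonneg_nonneg mult_nonneg_nonneg)
      (auto simp: h_reach_def \<gamma>_reach_def)
  also have "\<dots> = h_coeff s * P + (\<gamma> * \<gamma>_coeff s - \<beta> * \<beta>_coeff s)"
    unfolding h_coeff_def \<gamma>_coeff_def \<beta>_coeff_def t_def[symmetric] x_def[symmetric]
    unfolding a h_reach_def \<gamma>_reach_def h_decay_def \<gamma>_decay_def \<beta>_decay_def by (simp add: field_simps)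
  also have "\<dots> \<le> greedy_pot 0 {}"
    unfolding P_def using k s a by (intro start_combination_le_greedy_pot) auto
  finally show ?thesis by (simp add: P_def)
qed

end

definition avoiding_rounds :: "nat \<Rightarrow> nat" where
  "avoiding_rounds k = (if k < 1000 then 0 else 2 * k div 5)"

context nonneg_submodular
begin

lemma greedy_submartingale_const:
  assumes "1 \<le> k"
  shows "greedy_submartingale k s Z (\<lambda>_ _. c)"
proof -
  have "average T (\<lambda>_. c) = c" if "card T = k" for T :: "'a set"
    using that assms by (intro average_const) (auto intro: card_ge_0_finite)
  then show ?thesis by (simp add: greedy_submartingale_def)
qed

lemma greedy_potential_exists_aided:
  assumes k: "1 \<le> k" "10 * k \<le> card U" and Z: "Z \<subseteq> U" "card Z = k" and OPT: "OPT \<subseteq> U" "card OPT = k"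
    and \<eta>: "0 \<le> \<eta>" "\<eta> \<le> 1000 / real (card U) * f OPT"
    and sum: "f (OPT \<union> Z) + f (OPT \<inter> Z) \<le> 2 * f Z + \<eta>" and small: "f Z \<le> exp (- 1) * f OPT"
  obtains V where "greedy_submartingale k (avoiding_rounds k) Z V" "\<And>S. V k S = f S"
    "(exp (- 1) - 1000 / real (card U)) * f OPT \<le> V 0 {}"
proof -
  define n where "n = card U"
  define a where "a = (if k < 1000 then real k / real (n - 3 * k) else 1 / 7)"
  have n: "0 < n" "10 * k \<le> n" using k by (auto simp: n_def)
  have "7 * real k \<le> real (n - 3 * k)" using n by (simp add: of_nat_diff)
  then have "real k / real (n - 3 * k) \<le> 1 / 7" using k by (simp add: field_simps)
  then have a_bounds: "real k / real (n - 3 * k) \<le> a" "a \<le> 1 / 7" by (auto simp: a_def)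
  interpret aided_greedy U f OPT Z k "avoiding_rounds k" a
    using OPT Z k a_bounds by unfold_locales (auto simp: n_def avoiding_rounds_def)
  have "(exp (- 1) - 1000 / real n) * f OPT \<le> greedy_pot 0 {}"
  proof (cases "k < 1000")
    case True
    have "7 * real n \<le> 10 * real (n - 3 * k)" using n by (simp add: of_nat_diff)
    then have "a \<le> 10 * real k / (7 * real n)" using True k n by (simp add: a_def field_simps)
    also have "\<dots> \<le> 10000 / (7 * real n)" using True n by (intro divide_right_mono) auto
    finally have "a * exp (- 1) \<le> 10000 / (7 * real n) * (3682 / 10000)"
      using exp_minus_1_le a_nonneg by (intro mult_mono) auto
    also have "\<dots> \<le> 1000 / real n" using n by (simp add: field_simps)
    finally have "(exp (- 1) - 1000 / real n) * f OPT \<le> ((1 - a) * exp (- 1)) * f OPT"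
      using opt_nonneg by (intro mult_right_mono) (auto simp: algebra_simps)
    also have "\<dots> \<le> greedy_pot 0 {}"
      using greedy_pot_start_unaided True by (simp add: avoiding_rounds_def mult.assoc)
    finally show ?thesis .
  next
    case False
    then have "exp (- 1) * f OPT - \<eta> \<le> greedy_pot 0 {}"
      using \<eta>(1) sum small by (intro greedy_pot_start_aided) (auto simp: avoiding_rounds_def a_def)
    then show ?thesis using \<eta>(2) by (simp add: n_def left_diff_distrib)
  qed
  moreover have "greedy_submartingale k (avoiding_rounds k) Z greedy_pot"
    using a_bounds(2) by (intro greedy_pot_submartingale) (auto simp: avoiding_rounds_def)
  ultimately show thesis using greedy_pot_final by (intro that) (auto simp: n_def)
qed

lemma greedy_potential_exists:
  assumes k: "1 \<le> k" "10 * k \<le> card U" and Z: "Z \<subseteq> U" "card Z = k"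
    and \<delta>: "0 \<le> \<delta>" "real (card U * card U) * \<delta> \<le> opt_value U f k"
    and local: "\<And>u v. u \<in> Z \<Longrightarrow> v \<in> U - Z \<Longrightarrow> f (insert v (Z - {u})) \<le> f Z + \<delta>"
  obtains V where "greedy_submartingale k (avoiding_rounds k) Z V" "\<And>S. V k S \<le> max (f S) (f Z)"
    "(exp (- 1) - 1000 / real (card U)) * opt_value U f k \<le> V 0 {}"
proof -
  obtain OPT where OPT: "OPT \<subseteq> U" "card OPT = k" "f OPT = opt_value U f k"
    using opt_value_attained[OF finite_ground, of k f] k by auto
  have P0: "0 \<le> f OPT" using OPT(1) by (rule nonneg)
  show thesis
  proof (cases "exp (- 1) * f OPT \<le> f Z")
    case True
    have "(exp (- 1) - 1000 / real (card U)) * f OPT \<le> exp (- 1) * f OPT"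
      using P0 by (intro mult_right_mono) auto
    then show thesis
      using True greedy_submartingale_const[OF k(1)] OPT(3)
      by (intro that[of "\<lambda>_ _. f Z"]) auto
  next
    case False
    have n: "0 < real (card U)" using k by simp
    have "real k * \<delta> \<le> real (card U) * \<delta>" using k \<delta>(1) by (intro mult_right_mono) auto
    also have "\<dots> \<le> 1 / real (card U) * f OPT" using \<delta>(2) OPT(3) n by (simp add: field_simps)
    also have "\<dots> \<le> 1000 / real (card U) * f OPT"
      using P0 by (intro mult_right_mono divide_right_mono) auto
    finally have \<eta>: "real k * \<delta> \<le> 1000 / real (card U) * f OPT" .
    have "f (OPT \<union> Z) + f (OPT \<inter> Z) \<le> 2 * f Z + real k * \<delta>"
      by (rule swap_local_optimum[OF Z OPT(1,2) \<delta>(1) local])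
    then obtain V where "greedy_submartingale k (avoiding_rounds k) Z V" "\<And>S. V k S = f S"
      "(exp (- 1) - 1000 / real (card U)) * f OPT \<le> V 0 {}"
      using greedy_potential_exists_aided[OF k Z OPT(1,2) _ \<eta>] \<delta>(1) False by auto
    then show thesis using OPT(3) by (intro that[of V]) auto
  qed
qed

end

section \<open>Execution of programs\<close>

notation Seq (infixr ";;" 60)

lemma expectation_mono_finite:
  fixes \<phi> \<psi> :: "'a \<Rightarrow> real"
  assumes "finite (set_pmf D)" "\<And>x. x \<in> set_pmf D \<Longrightarrow> \<phi> x \<le> \<psi> x"
  shows "measure_pmf.expectation D \<phi> \<le> measure_pmf.expectation D \<psi>"
  using assms by (intro integral_mono_AE integrable_measure_pmf_finite)
    (auto simp: AE_measure_pmf_iff)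

lemma expectation_bind_finite:
  fixes \<phi> :: "'b \<Rightarrow> real"
  assumes "finite (set_pmf D)" "\<And>x. x \<in> set_pmf D \<Longrightarrow> finite (set_pmf (F x))"
  shows "measure_pmf.expectation (bind_pmf D F) \<phi>
      = measure_pmf.expectation D (\<lambda>x. measure_pmf.expectation (F x) \<phi>)"
  using assms by (simp add: pmf_expectation_bind[of "set_pmf D"] integral_measure_pmf[of "set_pmf D"])

datatype location = Nat_var nat | Nat_array nat | Real_var nat | Real_array nat

primrec writes :: "com \<Rightarrow> location set" where
  "writes Skip = {}"
| "writes (NAssign x u) = {Nat_var x}"
| "writes (NStore a i u) = {Nat_array a}"
| "writes (RAssign x u) = {Real_var x}"
| "writes (RStore a i u) = {Real_array a}"
| "writes (Query x a) = {Real_var x}"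
| "writes (Rand x u) = {Nat_var x}"
| "writes (c ;; d) = writes c \<union> writes d"
| "writes (If b c d) = writes c \<union> writes d"
| "writes (While b c) = writes c"

definition agree :: "location set \<Rightarrow> state \<Rightarrow> state \<Rightarrow> bool" where
  "agree W s s' \<longleftrightarrow> (\<forall>x. Nat_var x \<notin> W \<longrightarrow> nvar s' x = nvar s x) \<and>
      (\<forall>a. Nat_array a \<notin> W \<longrightarrow> narr s' a = narr s a)
     \<and> (\<forall>x. Real_var x \<notin> W \<longrightarrow> rvar s' x = rvar s x) \<and> (\<forall>a. Real_array a \<notin> W \<longrightarrow> rarr s' a = rarr s a)"

lemma agree_refl: "agree W s s"
  by (simp add: agree_def)

lemma agree_trans: "agree W s s' \<Longrightarrow> agree W s' s'' \<Longrightarrow> agree W s s''"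
  by (simp add: agree_def)

lemma agree_mono: "agree V s s' \<Longrightarrow> V \<subseteq> W \<Longrightarrow> agree W s s'"
  unfolding agree_def by blast

lemma agree_set_nvar: "Nat_var x \<in> W \<Longrightarrow> agree W s (s'\<lparr>nvar := (nvar s')(x := v)\<rparr>) \<longleftrightarrow> agree W s s'"
  by (auto simp: agree_def)

locale oracle_machine =
  fixes n :: nat and g :: "nat set \<Rightarrow> real"
begin

lemma step_writes:
  assumes "(K', s') \<in> set_pmf (step n g (K, s))"
  shows "\<Union> (writes ` set K') \<subseteq> \<Union> (writes ` set K) \<and> agree (\<Union> (writes ` set K)) s s'"
  using assms
  by (cases "(n, g, (K, s))" rule: step.cases) (auto simp: agree_def split: if_splits)

lemma steps_writes:
  assumes "(K', s') \<in> set_pmf (steps n g t (K, s))"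
  shows "agree (\<Union> (writes ` set K)) s s'"
  using assms
proof (induction t arbitrary: K s)
  case 0
  then show ?case by (simp add: agree_refl)
next
  case (Suc t)
  then obtain K1 s1 where first: "(K1, s1) \<in> set_pmf (step n g (K, s))"
    and rest: "(K', s') \<in> set_pmf (steps n g t (K1, s1))" by auto
  show ?case
    using step_writes[OF first] Suc.IH[OF rest] by (blast intro: agree_trans agree_mono)
qed

text \<open>
  Random branches may take different numbers of steps, so \<open>D\<close> is the joint distribution of the final
  state and the running time.
\<close>

definition outcome :: "com list \<Rightarrow> state \<Rightarrow> (state \<times> nat) pmf \<Rightarrow> bool" where
  "outcome cs s D \<longleftrightarrow> finite (set_pmf D) \<and>
     (\<forall>K t. (\<forall>x\<in>set_pmf D. snd x \<le> t) \<longrightarrow>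
       steps n g t (cs @ K, s) = bind_pmf D (\<lambda>x. steps n g (t - snd x) (K, fst x)))"

lemma outcome_Nil: "outcome [] s (return_pmf (s, 0))"
  by (simp add: outcome_def bind_return_pmf)

lemma outcome_step:
  assumes "\<And>K. step n g (c # K, s) = map_pmf (Pair K) D" "finite (set_pmf D)"
  shows "outcome [c] s (map_pmf (\<lambda>s'. (s', 1)) D)"
  unfolding outcome_def
proof (intro conjI allI impI)
  fix K and t :: nat assume "\<forall>x\<in>set_pmf (map_pmf (\<lambda>s'. (s', 1)) D). snd x \<le> t"
  then obtain t' where "t = Suc t'" using set_pmf_not_empty[of D] by (cases t) auto
  then show "steps n g t ([c] @ K, s)
      = map_pmf (\<lambda>s'. (s', 1)) D \<bind> (\<lambda>x. steps n g (t - snd x) (K, fst x))"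
    by (simp add: assms(1) bind_map_pmf)
qed (use assms(2) in simp)

lemma outcome_jump:
  assumes "\<And>K. step n g (c # K, s) = return_pmf (cs @ K, s)" "outcome cs s D"
  shows "outcome [c] s (map_pmf (\<lambda>x. (fst x, Suc (snd x))) D)"
  unfolding outcome_def
proof (intro conjI allI impI)
  fix K and t :: nat assume t: "\<forall>x\<in>set_pmf (map_pmf (\<lambda>x. (fst x, Suc (snd x))) D). snd x \<le> t"
  then obtain t' where t': "t = Suc t'" using set_pmf_not_empty[of D] by (cases t) auto
  have "steps n g t' (cs @ K, s) = D \<bind> (\<lambda>x. steps n g (t' - snd x) (K, fst x))"
    using assms(2) t unfolding outcome_def t' by auto
  then show "steps n g t ([c] @ K, s)
      = map_pmf (\<lambda>x. (fst x, Suc (snd x))) D \<bind> (\<lambda>x. steps n g (t - snd x) (K, fst x))"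
    by (simp add: t' assms(1) bind_return_pmf bind_map_pmf)
qed (use assms(2) in \<open>simp add: outcome_def\<close>)

lemma outcome_append:
  assumes cs: "outcome cs s D" and ds: "\<And>x. x \<in> set_pmf D \<Longrightarrow> outcome ds (fst x) (E x)"
  shows "outcome (cs @ ds) s (bind_pmf D (\<lambda>x. map_pmf (\<lambda>y. (fst y, snd x + snd y)) (E x)))"
  unfolding outcome_def
proof (intro conjI allI impI)
  fix K and t :: nat assume t:
    "\<forall>z\<in>set_pmf (bind_pmf D (\<lambda>x. map_pmf (\<lambda>y. (fst y, snd x + snd y)) (E x))). snd z \<le> t"
  have bound: "snd x + snd y \<le> t" if "x \<in> set_pmf D" "y \<in> set_pmf (E x)" for x y
    using t that by fastforce
  have "snd x \<le> t" if x: "x \<in> set_pmf D" for x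
  proof -
    obtain y where "y \<in> set_pmf (E x)" using set_pmf_not_empty by fast
    then show ?thesis using bound[OF x, of y] by simp
  qed
  then have "steps n g t (cs @ ds @ K, s) = D \<bind> (\<lambda>x. steps n g (t - snd x) (ds @ K, fst x))"
    using cs unfolding outcome_def by blast
  also have "\<dots> = D \<bind> (\<lambda>x. E x \<bind> (\<lambda>y. steps n g (t - snd x - snd y) (K, fst y)))"
  proof (intro bind_pmf_cong refl)
    fix x assume x: "x \<in> set_pmf D"
    have "\<forall>y\<in>set_pmf (E x). snd y \<le> t - snd x" using bound[OF x] by fastforce
    then show "steps n g (t - snd x) (ds @ K, fst x)
        = E x \<bind> (\<lambda>y. steps n g (t - snd x - snd y) (K, fst y))"
      using ds[OF x] unfolding outcome_def by blast
  qed
  finally show "steps n g t ((cs @ ds) @ K, s)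
      = (D \<bind> (\<lambda>x. map_pmf (\<lambda>y. (fst y, snd x + snd y)) (E x))) \<bind> (\<lambda>x. steps n g (t - snd x)
          (K, fst x))"
    by (simp add: bind_assoc_pmf bind_map_pmf diff_diff_left)
qed (use cs ds in \<open>auto simp: outcome_def\<close>)

lemma outcome_steps:
  assumes "outcome [c] s D" "\<And>x. x \<in> set_pmf D \<Longrightarrow> snd x \<le> t"
  shows "steps n g t ([c], s) = map_pmf (\<lambda>x. ([], fst x)) D"
proof -
  have "steps n g t ([], s) = return_pmf ([], s)" for t s
    by (induction t) (auto simp: bind_return_pmf)
  moreover have "steps n g t ([c] @ [], s) = D \<bind> (\<lambda>x. steps n g (t - snd x) ([], fst x))"
    using assms unfolding outcome_def by blast
  ultimately show ?thesis by (simp add: map_pmf_def)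
qed

lemma outcome_writes:
  assumes "outcome [c] s D" "x \<in> set_pmf D"
  shows "agree (writes c) s (fst x)"
proof -
  have "finite (snd ` set_pmf D)" using assms(1) by (simp add: outcome_def)
  then have "steps n g (Max (snd ` set_pmf D)) ([c], s) = map_pmf (\<lambda>x. ([], fst x)) D"
    using assms(1) by (intro outcome_steps) auto
  then have "([], fst x) \<in> set_pmf (steps n g (Max (snd ` set_pmf D)) ([c], s))"
    using assms(2) by auto
  from steps_writes[OF this] show ?thesis by simp
qed

definition attains_stack ::
  "com list \<Rightarrow> state \<Rightarrow> nat \<Rightarrow> (state \<Rightarrow> bool) \<Rightarrow> (state \<Rightarrow> real) \<Rightarrow> real \<Rightarrow> bool" where
  "attains_stack cs s T Q \<phi> v \<longleftrightarrow> (\<exists>D. outcome cs s D \<and> (\<forall>x\<in>set_pmf D. snd x \<le> T \<and> Q (fst x)) \<and>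
     v \<le> measure_pmf.expectation D (\<lambda>x. \<phi> (fst x)))"

abbreviation "attains c \<equiv> attains_stack [c]"

abbreviation "terminates c s T Q \<equiv> attains c s T Q (\<lambda>_. 0) 0"

lemma attains_mono:
  assumes "attains c s T Q \<phi> v" "T \<le> T'" "\<And>s'. Q s' \<Longrightarrow> Q' s'" "\<And>s'. Q s' \<Longrightarrow> \<phi> s' \<le> \<phi>' s'" "v' \<le> v"
  shows "attains c s T' Q' \<phi>' v'"
proof -
  obtain D where D: "outcome [c] s D" "\<forall>x\<in>set_pmf D. snd x \<le> T \<and> Q (fst x)"
    "v \<le> measure_pmf.expectation D (\<lambda>x. \<phi> (fst x))"
    using assms(1) unfolding attains_stack_def by auto
  have "measure_pmf.expectation D (\<lambda>x. \<phi> (fst x)) \<le> measure_pmf.expectation D (\<lambda>x. \<phi>' (fst x))"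
    using D assms(4) by (intro expectation_mono_finite) (auto simp: outcome_def)
  then show ?thesis
    unfolding attains_stack_def using D assms by (intro exI[of _ D]) (auto intro: order_trans)
qed

lemma attains_of_terminates:
  assumes "terminates c s T Q" "\<And>s'. Q s' \<Longrightarrow> v \<le> \<phi> s'"
  shows "attains c s T Q \<phi> v"
proof -
  obtain D where D: "outcome [c] s D" "\<forall>x\<in>set_pmf D. snd x \<le> T \<and> Q (fst x)"
    using assms(1) unfolding attains_stack_def by auto
  have "measure_pmf.expectation D (\<lambda>_. v) \<le> measure_pmf.expectation D (\<lambda>x. \<phi> (fst x))"
    using D assms(2) by (intro expectation_mono_finite) (auto simp: outcome_def)
  then show ?thesis unfolding attains_stack_def using D by (intro exI[of _ D]) simp
qed

lemma terminates_mono: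
  assumes "terminates c s T Q" "T \<le> T'" "\<And>s'. Q s' \<Longrightarrow> Q' s'"
  shows "terminates c s T' Q'"
  using assms by (elim attains_mono) auto

lemma attains_frame:
  assumes "attains c s T Q \<phi> v"
  shows "attains c s T (\<lambda>s'. Q s' \<and> agree (writes c) s s') \<phi> v"
  using assms outcome_writes unfolding attains_stack_def by blast

lemma attains_Nil:
  assumes "Q s" "v \<le> \<phi> s"
  shows "attains_stack [] s 0 Q \<phi> v"
  unfolding attains_stack_def using outcome_Nil assms by (intro exI[of _ "return_pmf (s, 0)"]) simp

lemma attains_Cons:
  assumes c: "attains c s T1 Q1 \<phi>1 v" and cs: "\<And>s'. Q1 s' \<Longrightarrow> attains_stack cs s' T2 Q2 \<phi>2 (\<phi>1 s')"
  shows "attains_stack (c # cs) s (T1 + T2) Q2 \<phi>2 v"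
proof -
  obtain D where D: "outcome [c] s D" "\<And>x. x \<in> set_pmf D \<Longrightarrow> snd x \<le> T1 \<and> Q1 (fst x)"
    "v \<le> measure_pmf.expectation D (\<lambda>x. \<phi>1 (fst x))"
    using c unfolding attains_stack_def by auto
  have "\<exists>E. Q1 s' \<longrightarrow> outcome cs s' E \<and> (\<forall>x\<in>set_pmf E. snd x \<le> T2 \<and> Q2 (fst x)) \<and>
      \<phi>1 s' \<le> measure_pmf.expectation E (\<lambda>x. \<phi>2 (fst x))" for s'
    using cs unfolding attains_stack_def by blast
  then obtain E where E: "\<And>s'. Q1 s' \<Longrightarrow> outcome cs s' (E s')"
    "\<And>s' x. Q1 s' \<Longrightarrow> x \<in> set_pmf (E s') \<Longrightarrow> snd x \<le> T2 \<and> Q2 (fst x)"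
    "\<And>s'. Q1 s' \<Longrightarrow> \<phi>1 s' \<le> measure_pmf.expectation (E s') (\<lambda>x. \<phi>2 (fst x))"
    by metis
  define F where "F x = map_pmf (\<lambda>y. (fst y, snd x + snd y)) (E (fst x))" for x :: "state \<times> nat"
  have finite: "finite (set_pmf D)" "\<And>x. x \<in> set_pmf D \<Longrightarrow> finite (set_pmf (F x))"
    using D(1,2) E(1) by (auto simp: outcome_def F_def)
  have "outcome ([c] @ cs) s (bind_pmf D F)"
    unfolding F_def using D(1,2) E(1) by (intro outcome_append) auto
  moreover have "\<forall>z\<in>set_pmf (bind_pmf D F). snd z \<le> T1 + T2 \<and> Q2 (fst z)"
    using D(2) E(2) by (fastforce simp: F_def intro: add_mono)
  moreover have "v \<le> measure_pmf.expectation (bind_pmf D F) (\<lambda>x. \<phi>2 (fst x))"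
  proof -
    have "measure_pmf.expectation D (\<lambda>x. \<phi>1 (fst x))
        \<le> measure_pmf.expectation D (\<lambda>x. measure_pmf.expectation (F x) (\<lambda>y. \<phi>2 (fst y)))"
      using D(2) E(3) finite by (intro expectation_mono_finite) (auto simp: F_def)
    then show ?thesis using D(3) finite by (simp add: expectation_bind_finite)
  qed
  ultimately show ?thesis
    unfolding attains_stack_def by (intro exI[of _ "bind_pmf D F"]) simp
qed

lemma attains_jump:
  assumes "\<And>K. step n g (c # K, s) = return_pmf (cs @ K, s)" "attains_stack cs s T Q \<phi> v"
  shows "attains c s (T + 1) Q \<phi> v"
proof -
  obtain D where D: "outcome cs s D" "\<forall>x\<in>set_pmf D. snd x \<le> T \<and> Q (fst x)"
    "v \<le> measure_pmf.expectation D (\<lambda>x. \<phi> (fst x))"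
    using assms(2) unfolding attains_stack_def by auto
  then show ?thesis
    unfolding attains_stack_def using outcome_jump[OF assms(1) D(1)]
    by (intro exI[of _ "map_pmf (\<lambda>x. (fst x, Suc (snd x))) D"]) auto
qed

lemma attains_Seq:
  assumes "attains c s T1 Q1 \<phi>1 v" "\<And>s'. Q1 s' \<Longrightarrow> attains d s' T2 Q2 \<phi>2 (\<phi>1 s')"
  shows "attains (c ;; d) s (T1 + T2 + 1) Q2 \<phi>2 v"
  by (rule attains_jump[OF _ attains_Cons[OF assms]]) simp

lemma attains_If:
  assumes "bval s b \<Longrightarrow> attains c s T Q \<phi> v" "\<not> bval s b \<Longrightarrow> attains d s T Q \<phi> v"
  shows "attains (If b c d) s (T + 1) Q \<phi> v"
proof (cases "bval s b")
  case True
  then show ?thesis by (intro attains_jump[where cs = "[c]"] assms) simp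
next
  case False
  then show ?thesis by (intro attains_jump[where cs = "[d]"] assms) simp
qed

lemma attains_While:
  assumes body: "\<And>i s. i < N \<Longrightarrow> I i s \<Longrightarrow> bval s b \<and> attains c s T (I (Suc i)) (V (Suc i)) (V i s)"
    and stop: "\<And>s. I N s \<Longrightarrow> \<not> bval s b"
    and start: "i \<le> N" "I i s"
  shows "attains (While b c) s ((N - i) * (T + 1) + 1) (I N) (V N) (V i s)"
  using start
proof (induction "N - i" arbitrary: i s)
  case 0
  then have "i = N" by simp
  moreover have "attains (While b c) s (0 + 1) (I N) (V N) (V N s)"
    using 0 \<open>i = N\<close> stop by (intro attains_jump[where cs = "[]"] attains_Nil) auto
  ultimately show ?case by simp
next
  case (Suc d)
  then have i: "i < N" "d = N - Suc i" "N - i = Suc (N - Suc i)" by auto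
  have c: "bval s b" "attains c s T (I (Suc i)) (V (Suc i)) (V i s)"
    using body[OF i(1)] Suc.prems by auto
  have "attains (While b c) s (T + ((N - Suc i) * (T + 1) + 1) + 1) (I N) (V N) (V i s)"
    using c(1) i(1) by (intro attains_jump[OF _ attains_Cons[OF c(2) Suc.hyps(1)[OF i(2)]]]) auto
  then show ?case unfolding i(3) by (simp add: algebra_simps)
qed

lemma attains_primitive:
  assumes "\<And>K. step n g (c # K, s) = map_pmf (Pair K) D" "finite (set_pmf D)"
    and "\<And>s'. s' \<in> set_pmf D \<Longrightarrow> Q s'" "v \<le> measure_pmf.expectation D \<phi>"
  shows "attains c s 1 Q \<phi> v"
  unfolding attains_stack_def using outcome_step[OF assms(1,2)] assms(3,4)
  by (intro exI[of _ "map_pmf (\<lambda>s'. (s', 1)) D"]) auto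

lemma attains_return:
  assumes "\<And>K. step n g (c # K, s) = return_pmf (K, s')" "Q s'" "v \<le> \<phi> s'"
  shows "attains c s 1 Q \<phi> v"
  using assms by (intro attains_primitive[where D = "return_pmf s'"]) simp_all

lemma attains_Rand:
  assumes m: "nval s u + 1 = m" and Q: "\<And>r. r < m \<Longrightarrow> Q (s\<lparr>nvar := (nvar s)(x := r)\<rparr>)"
    and v: "v \<le> average {..<m} (\<lambda>r. \<phi> (s\<lparr>nvar := (nvar s)(x := r)\<rparr>))"
  shows "attains (Rand x u) s 1 Q \<phi> v"
proof (rule attains_primitive)
  let ?s = "\<lambda>r. s\<lparr>nvar := (nvar s)(x := r)\<rparr>"
  let ?D = "map_pmf ?s (pmf_of_set {..<m})"
  have nonempty: "{..<m} \<noteq> {}" and range: "{0..nval s u} = {..<m}"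
    using m by (auto simp: lessThan_empty_iff)
  show "step n g (Rand x u # K, s) = map_pmf (Pair K) ?D" for K
    by (simp add: range pmf.map_comp o_def)
  show "finite (set_pmf ?D)" "\<And>s'. s' \<in> set_pmf ?D \<Longrightarrow> Q s'"
    using nonempty Q by (auto simp: set_pmf_of_set)
  show "v \<le> measure_pmf.expectation ?D \<phi>"
    using v nonempty by (simp add: integral_pmf_of_set average_def)
qed

lemma terminates_Seq:
  assumes "terminates c s T1 Q1" "\<And>s'. Q1 s' \<Longrightarrow> terminates d s' T2 Q2"
  shows "terminates (c ;; d) s (T1 + T2 + 1) Q2"
  using assms by (rule attains_Seq)

text \<open>Commands without loops and random choices are executed by the simplifier.\<close>

primrec straight :: "com \<Rightarrow> bool" where
  "straight Skip = True"
| "straight (NAssign x u) = True"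
| "straight (NStore a i u) = True"
| "straight (RAssign x u) = True"
| "straight (RStore a i u) = True"
| "straight (Query x a) = True"
| "straight (Rand x u) = False"
| "straight (c ;; d) = (straight c \<and> straight d)"
| "straight (If b c d) = (straight c \<and> straight d)"
| "straight (While b c) = False"

primrec effect :: "com \<Rightarrow> state \<Rightarrow> state" where
  "effect Skip s = s"
| "effect (NAssign x u) s = s\<lparr>nvar := (nvar s)(x := nval s u)\<rparr>"
| "effect (NStore a i u) s = s\<lparr>narr := (narr s)(a := (narr s a)(nval s i := nval s u))\<rparr>"
| "effect (RAssign x u) s = s\<lparr>rvar := (rvar s)(x := rval s u)\<rparr>"
| "effect (RStore a i u) s = s\<lparr>rarr := (rarr s)(a := (rarr s a)(nval s i := rval s u))\<rparr>"
| "effect (Query x a) s = s\<lparr>rvar := (rvar s)(x := g (array_set n s a))\<rparr>"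
| "effect (Rand x u) s = s"
| "effect (c ;; d) s = effect d (effect c s)"
| "effect (If b c d) s = (if bval s b then effect c s else effect d s)"
| "effect (While b c) s = s"

primrec duration :: "com \<Rightarrow> nat" where
  "duration Skip = 1"
| "duration (NAssign x u) = 1"
| "duration (NStore a i u) = 1"
| "duration (RAssign x u) = 1"
| "duration (RStore a i u) = 1"
| "duration (Query x a) = 1"
| "duration (Rand x u) = 1"
| "duration (c ;; d) = duration c + duration d + 1"
| "duration (If b c d) = max (duration c) (duration d) + 1"
| "duration (While b c) = 1"

lemma terminates_effect: "straight c \<Longrightarrow> terminates c s (duration c) (\<lambda>s'. s' = effect c s)"
proof (induction c arbitrary: s)
  case (Seq c d)
  then show ?case
    unfolding duration.simps by (intro terminates_Seq[where ?Q1.0 = "\<lambda>s'. s' = effect c s"]) auto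
next
  case (If b c d)
  show ?case
    unfolding duration.simps by (rule attains_If; rule terminates_mono) (use If in auto)
qed (auto intro!: attains_return[unfolded One_nat_def])

lemma attains_straight:
  assumes "straight c" "duration c \<le> T" "Q (effect c s)" "v \<le> \<phi> (effect c s)"
  shows "attains c s T Q \<phi> v"
proof -
  have "attains c s (duration c) (\<lambda>s'. s' = effect c s) \<phi> v"
    by (rule attains_of_terminates[OF terminates_effect]) (use assms in auto)
  then show ?thesis by (rule attains_mono) (use assms in auto)
qed

end

definition For :: "nat \<Rightarrow> nexp \<Rightarrow> com \<Rightarrow> com" where
  "For x u c = NAssign x (NConst 0) ;;
     While (NLess (NVar x) u) (c ;; NAssign x (NAdd (NVar x) (NConst 1)))"

lemma writes_For [simp]: "writes (For x u c) = insert (Nat_var x) (writes c)"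
  by (auto simp: For_def)

context oracle_machine
begin

lemma attains_For:
  assumes init: "I 0 s" and bound: "\<And>i s'. I i s' \<Longrightarrow> nval s' u = N"
    and body: "\<And>i s'. i < N \<Longrightarrow> I i s' \<Longrightarrow> nvar s' x = i \<Longrightarrow>
        attains c s' T (I (Suc i)) (V (Suc i)) (V i s')"
    and counter: "Nat_var x \<notin> writes c"
    and indep: "\<And>i v s'. I i (s'\<lparr>nvar := (nvar s')(x := v)\<rparr>) \<longleftrightarrow> I i s'"
      "\<And>i v s'. V i (s'\<lparr>nvar := (nvar s')(x := v)\<rparr>) = V i s'"
  shows "attains (For x u c) s (N * (T + 3) + 3) (I N) (V N) (V 0 s)"
proof -
  let ?I = "\<lambda>i s'. I i s' \<and> nvar s' x = i"
  let ?incr = "NAssign x (NAdd (NVar x) (NConst 1))"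
  have loop: "attains (While (NLess (NVar x) u) (c ;; ?incr)) s' ((N - 0) * ((T + 1 + 1) + 1) + 1)
      (?I N) (V N) (V 0 s')"
    if s': "?I 0 s'" for s'
  proof (rule attains_While)
    fix i s' assume i: "i < N" and I: "?I i s'"
    have "attains (c ;; ?incr) s' (T + 1 + 1) (?I (Suc i)) (V (Suc i)) (V i s')"
    proof (rule attains_Seq[OF attains_frame])
      show "attains c s' T (I (Suc i)) (V (Suc i)) (V i s')" using body i I by blast
      fix s'' assume "I (Suc i) s'' \<and> agree (writes c) s' s''"
      then have "I (Suc i) s''" "nvar s'' x = i" using I counter by (simp_all add: agree_def)
      then show "attains ?incr s'' 1 (?I (Suc i)) (V (Suc i)) (V (Suc i) s'')"
        using indep by (intro attains_straight) simp_all
    qed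
    then show "bval s' (NLess (NVar x) u) \<and> attains (c ;; ?incr) s'
        (T + 1 + 1) (?I (Suc i)) (V (Suc i)) (V i s')"
      using I i bound[of i s'] by simp
  next
    show "\<And>s'. ?I N s' \<Longrightarrow> \<not> bval s' (NLess (NVar x) u)" using bound by fastforce
  qed (use s' in auto)
  have "attains (For x u c) s (1 + ((N - 0) * ((T + 1 + 1) + 1) + 1) + 1) (?I N) (V N) (V 0 s)"
    unfolding For_def
  proof (rule attains_Seq)
    show "attains (NAssign x (NConst 0)) s 1 (?I 0) (V 0) (V 0 s)"
      using init indep by (intro attains_straight) simp_all
  qed (rule loop)
  then show ?thesis by (rule attains_mono) (simp_all add: algebra_simps)
qed

lemma terminates_For:
  assumes init: "I 0 s" and W: "insert (Nat_var x) (writes c) \<subseteq> W"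
    and bound: "\<And>s'. agree W s s' \<Longrightarrow> nval s' u = N"
    and body: "\<And>i s'. i < N \<Longrightarrow> I i s' \<Longrightarrow> agree W s s' \<Longrightarrow> nvar s' x = i \<Longrightarrow> terminates c s' T (I (Suc i))"
    and counter: "Nat_var x \<notin> writes c"
    and indep: "\<And>i v s'. I i (s'\<lparr>nvar := (nvar s')(x := v)\<rparr>) \<longleftrightarrow> I i s'"
  shows "terminates (For x u c) s (N * (T + 3) + 3) (\<lambda>s'. I N s' \<and> agree W s s')"
proof (rule attains_For[where I = "\<lambda>i s'. I i s' \<and> agree W s s'"])
  fix i s' assume i: "i < N" "I i s' \<and> agree W s s'" "nvar s' x = i"
  then have "terminates c s' T (\<lambda>s''. I (Suc i) s'' \<and> agree (writes c) s' s'')"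
    by (intro attains_frame[OF body]) auto
  then show "terminates c s' T (\<lambda>s''. I (Suc i) s'' \<and> agree W s s'')"
  proof (rule terminates_mono)
    fix s'' assume "I (Suc i) s'' \<and> agree (writes c) s' s''"
    then show "I (Suc i) s'' \<and> agree W s s''"
      using i(2) W agree_mono[of "writes c" s' s'' W] agree_trans by blast
  qed simp
qed (use assms in \<open>auto simp: agree_refl agree_set_nvar\<close>)

end

section \<open>Selection by rank\<close>

text \<open>
  A token is a pair of numbers that carries a real key.  The tokens at hand occupy the first
  \<open>count_reg\<close> cells of three parallel arrays.
\<close>

abbreviation (input) size_reg :: nat where "size_reg \<equiv> 0"
abbreviation (input) count_reg :: nat where "count_reg \<equiv> 5"
abbreviation (input) candidate_reg :: nat where "candidate_reg \<equiv> 6"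
abbreviation (input) other_reg :: nat where "other_reg \<equiv> 7"
abbreviation (input) rank_reg :: nat where "rank_reg \<equiv> 8"
abbreviation (input) chosen_reg :: nat where "chosen_reg \<equiv> 9"
abbreviation (input) wanted_reg :: nat where "wanted_reg \<equiv> 10"
abbreviation (input) row_reg :: nat where "row_reg \<equiv> 11"
abbreviation (input) col_reg :: nat where "col_reg \<equiv> 12"
abbreviation (input) first_arr :: nat where "first_arr \<equiv> 2"
abbreviation (input) second_arr :: nat where "second_arr \<equiv> 3"
abbreviation (input) key_arr :: nat where "key_arr \<equiv> 0"
abbreviation (input) key_reg :: nat where "key_reg \<equiv> 0"

abbreviation "BOr b c \<equiv> BNot (BAnd (BNot b) (BNot c))"
abbreviation "NEq u v \<equiv> BAnd (BNot (NLess u v)) (BNot (NLess v u))"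
abbreviation "increment x \<equiv> NAssign x (NAdd (NVar x) (NConst 1))"

lemma bval_NEq: "bval s (NEq u v) \<longleftrightarrow> nval s u = nval s v"
  by auto

definition precedes :: "(nat \<Rightarrow> real) \<Rightarrow> nat \<Rightarrow> nat \<Rightarrow> bool" where
  "precedes key j i \<longleftrightarrow> key j < key i \<or> key j = key i \<and> j < i"

definition key_rank :: "(nat \<Rightarrow> real) \<Rightarrow> nat \<Rightarrow> nat \<Rightarrow> nat" where
  "key_rank key N i = card {j. j < N \<and> precedes key j i}"

definition order_index :: "(nat \<Rightarrow> real) \<Rightarrow> nat \<Rightarrow> nat \<Rightarrow> nat" where
  "order_index key N = inv_into {..<N} (key_rank key N)"

lemma key_rank_Suc: "key_rank key (Suc N) i = key_rank key N i + of_bool (precedes key N i)"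
proof -
  have "{j. j < Suc N \<and> precedes key j i}
      = (if precedes key N i then insert N {j. j < N \<and> precedes key j i}
          else {j. j < N \<and> precedes key j i})"
    by (auto simp: less_Suc_eq)
  then show ?thesis by (simp add: key_rank_def)
qed

lemma key_rank_mono:
  assumes "i < N" "precedes key i i'"
  shows "key_rank key N i < key_rank key N i'"
  unfolding key_rank_def
proof (rule psubset_card_mono)
  show "{j. j < N \<and> precedes key j i} \<subset> {j. j < N \<and> precedes key j i'}"
    using assms by (auto simp: precedes_def)
qed simp

lemma key_rank_bij: "bij_betw (key_rank key N) {..<N} {..<N}"
proof -
  have "key_rank key N i \<noteq> key_rank key N i'" if "i < N" "i' < N" "i \<noteq> i'" for i i'
  proof -
    have "precedes key i i' \<or> precedes key i' i" using that(3) by (auto simp: precedes_def)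
    then show ?thesis using key_rank_mono that(1,2) by (metis less_irrefl)
  qed
  then have inj: "inj_on (key_rank key N) {..<N}" by (auto simp: inj_on_def)
  have "key_rank key N i < N" if "i < N" for i
  proof -
    have "key_rank key N i \<le> card ({..<N} - {i})"
      unfolding key_rank_def by (intro card_mono) (auto simp: precedes_def)
    also have "\<dots> < N" using that by simp
    finally show ?thesis .
  qed
  then have "key_rank key N ` {..<N} = {..<N}" using inj by (intro endo_inj_surj) auto
  then show ?thesis using inj by (simp add: bij_betw_def)
qed

lemma order_index_bij: "bij_betw (order_index key N) {..<N} {..<N}"
  unfolding order_index_def by (rule bij_betw_inv_into[OF key_rank_bij])

lemma order_index_less: "r < N \<Longrightarrow> order_index key N r < N"
  using order_index_bij[of key N] by (auto simp: bij_betw_def)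

lemma key_rank_eq_iff:
  assumes "i < N" "r < N"
  shows "key_rank key N i = r \<longleftrightarrow> i = order_index key N r"
  using bij_betw_inv_into_left[OF key_rank_bij] bij_betw_inv_into_right[OF key_rank_bij] assms
  unfolding order_index_def by fastforce

lemma order_index_sorted:
  assumes "r < r'" "r' < N"
  shows "key (order_index key N r) \<le> key (order_index key N r')"
proof (rule ccontr)
  assume "\<not> ?thesis"
  then have "key_rank key N (order_index key N r') < key_rank key N (order_index key N r)"
    using assms by (intro key_rank_mono order_index_less) (auto simp: precedes_def)
  moreover have "key_rank key N (order_index key N r) = r"
    "key_rank key N (order_index key N r') = r'"
    using assms by (simp_all add: key_rank_eq_iff order_index_less)
  ultimately show False using assms by simp
qed

definition key_precedes :: bexp where
  "key_precedes = BOr (RLess (RArr key_arr (NVar other_reg)) (RArr key_arr (NVar candidate_reg)))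
     (BAnd (BNot (RLess (RArr key_arr (NVar candidate_reg)) (RArr key_arr (NVar other_reg))))
       (NLess (NVar other_reg) (NVar candidate_reg)))"

lemma bval_key_precedes:
  "bval s key_precedes \<longleftrightarrow> precedes (rarr s key_arr) (nvar s other_reg) (nvar s candidate_reg)"
  by (auto simp: key_precedes_def precedes_def)

definition compute_rank :: com where
  "compute_rank = NAssign rank_reg (NConst 0) ;;
     For other_reg (NVar count_reg) (If key_precedes (increment rank_reg) Skip)"

definition select :: com where
  "select = For candidate_reg (NVar count_reg) (compute_rank ;;
     If (NEq (NVar rank_reg) (NVar wanted_reg)) (NAssign chosen_reg (NVar candidate_reg)) Skip)"

lemma writes_compute_rank: "writes compute_rank = {Nat_var other_reg, Nat_var rank_reg}"
  by (simp add: compute_rank_def)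

lemma writes_select: "writes select = Nat_var ` {candidate_reg, other_reg, rank_reg, chosen_reg}"
  by (auto simp: select_def writes_compute_rank)

definition select_time :: "nat \<Rightarrow> nat" where
  "select_time N = N * (N * 5 + 11) + 3"

lemma select_time_mono: "M \<le> N \<Longrightarrow> select_time M \<le> select_time N"
  unfolding select_time_def by (intro add_mono mult_mono) auto

context oracle_machine
begin

lemma compute_rank_terminates:
  assumes N: "nvar s count_reg = N"
  shows "terminates compute_rank s (N * 5 + 5)
    (\<lambda>s'. nvar s' rank_reg = key_rank (rarr s key_arr) N (nvar s candidate_reg))"
proof -
  let ?I = "\<lambda>j s'. nvar s' rank_reg = key_rank (rarr s key_arr) j (nvar s candidate_reg)"
  let ?W = "{Nat_var other_reg, Nat_var rank_reg}"
  have loop: "terminates (For other_reg (NVar count_reg)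
      (If key_precedes (increment rank_reg) Skip)) s1
      (N * (2 + 3) + 3) (\<lambda>s'. ?I N s' \<and> agree ?W s1 s')"
    if s1: "s1 = s\<lparr>nvar := (nvar s)(rank_reg := 0)\<rparr>" for s1
  proof (rule terminates_For)
    show "?I 0 s1" by (simp add: s1 key_rank_def)
    fix j s' assume s': "?I j s'" "agree ?W s1 s'" "nvar s' other_reg = j"
    then have "rarr s' = rarr s" "nvar s' candidate_reg = nvar s candidate_reg"
      by (auto simp: agree_def s1)
    then show "terminates (If key_precedes (increment rank_reg) Skip) s' 2 (?I (Suc j))"
      using s'(1,3) by (intro attains_straight) (simp_all add: bval_key_precedes key_rank_Suc)
  qed (auto simp: agree_def s1 N)
  have "terminates compute_rank s (1 + (N * (2 + 3) + 3) + 1) (\<lambda>s'. ?I N s')"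
    unfolding compute_rank_def
  proof (rule terminates_Seq)
    show "terminates (NAssign rank_reg (NConst 0)) s 1 (\<lambda>s1. s1 = s\<lparr>nvar := (nvar s)(rank_reg := 0)\<rparr>)"
      by (rule attains_straight) simp_all
    show "terminates (For other_reg (NVar count_reg) (If key_precedes (increment rank_reg) Skip)) s1
      (N * (2 + 3) + 3) (?I N)" if "s1 = s\<lparr>nvar := (nvar s)(rank_reg := 0)\<rparr>" for s1
      using loop[OF that] by (rule terminates_mono) auto
  qed
  then show ?thesis by (rule terminates_mono) auto
qed

lemma select_terminates:
  assumes N: "nvar s count_reg = N" and r: "nvar s wanted_reg = r" "r < N"
  shows "terminates select s (select_time N)
      (\<lambda>s'. nvar s' chosen_reg = order_index (rarr s key_arr) N r)"
proof -
  let ?idx = "order_index (rarr s key_arr) N r"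
  let ?W = "Nat_var ` {candidate_reg, other_reg, rank_reg, chosen_reg}"
  let ?I = "\<lambda>i s'. ?idx < i \<longrightarrow> nvar s' chosen_reg = ?idx"
  let ?record = "If (NEq (NVar rank_reg) (NVar wanted_reg))
      (NAssign chosen_reg (NVar candidate_reg)) Skip"
  have "terminates select s (N * (((N * 5 + 5) + 2 + 1) + 3) + 3) (\<lambda>s'. ?I N s' \<and> agree ?W s s')"
    unfolding select_def
  proof (rule terminates_For[where I = ?I])
    fix i s' assume i: "i < N" "?I i s'" and a: "agree ?W s s'" "nvar s' candidate_reg = i"
    have same: "rarr s' = rarr s" "nvar s' count_reg = N" "nvar s' wanted_reg = r"
      using a N r by (auto simp: agree_def)
    show "terminates (compute_rank ;; ?record) s' ((N * 5 + 5) + 2 + 1) (?I (Suc i))"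
    proof (rule terminates_Seq[OF attains_frame[OF compute_rank_terminates[OF same(2)]]])
      fix s'' assume s'': "nvar s'' rank_reg = key_rank (rarr s' key_arr) N (nvar s' candidate_reg)
        \<and> agree (writes compute_rank) s' s''"
      then have "nvar s'' rank_reg = r \<longleftrightarrow> i = ?idx"
        using key_rank_eq_iff[OF i(1) r(2)] a(2) by (simp add: same)
      moreover have "nvar s'' wanted_reg = r" "nvar s'' candidate_reg = i"
        "nvar s'' chosen_reg = nvar s' chosen_reg"
        using s'' a(2) same by (auto simp: agree_def writes_compute_rank)
      ultimately show "terminates ?record s'' 2 (?I (Suc i))"
        using i(2) by (intro attains_straight) (auto simp: bval_NEq less_Suc_eq simp del: bval.simps)
    qed
  qed (auto simp: agree_def writes_compute_rank N)
  then show ?thesis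
    by (rule terminates_mono) (use r order_index_less in \<open>auto simp: select_time_def\<close>)
qed

end

definition token :: "state \<Rightarrow> nat \<Rightarrow> nat \<times> nat" where
  "token s i = (narr s first_arr i, narr s second_arr i)"

abbreviation chosen_token :: "state \<Rightarrow> nat \<times> nat" where
  "chosen_token s \<equiv> token s (nvar s chosen_reg)"

definition tokens_listed :: "state \<Rightarrow> (nat \<times> nat) set \<Rightarrow> (nat \<times> nat \<Rightarrow> real) \<Rightarrow> bool" where
  "tokens_listed s A key \<longleftrightarrow> bij_betw (token s) {..<nvar s count_reg} A \<and>
     (\<forall>i<nvar s count_reg. rarr s key_arr i = key (token s i))"

definition lowest_tokens :: "state \<Rightarrow> nat \<Rightarrow> (nat \<times> nat) set" where
  "lowest_tokens s j = (\<lambda>r. token s (order_index (rarr s key_arr) (nvar s count_reg) r)) ` {..<j}"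

abbreviation "token_locs \<equiv> {Nat_var row_reg, Nat_var col_reg, Nat_var count_reg,
  Nat_array first_arr, Nat_array second_arr, Real_array key_arr}"

lemma tokens_listed_agree:
  assumes "agree W s s'" "token_locs \<inter> W = {}"
  shows "tokens_listed s' A key \<longleftrightarrow> tokens_listed s A key"
proof -
  have "nvar s' count_reg = nvar s count_reg" "narr s' first_arr = narr s first_arr"
    "narr s' second_arr = narr s second_arr" "rarr s' key_arr = rarr s key_arr"
    using assms by (auto simp: agree_def)
  then show ?thesis by (simp add: tokens_listed_def token_def[abs_def])
qed

lemma tokens_listed_count:
  assumes "tokens_listed s A key"
  shows "nvar s count_reg = card A"
  using assms bij_betw_same_card by (force simp: tokens_listed_def)

lemma lowest_tokens:
  assumes listed: "tokens_listed s A key" and j: "j \<le> card A"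
  shows "lowest key A (lowest_tokens s j)" "card (lowest_tokens s j) = j"
proof -
  let ?\<sigma> = "\<lambda>r. token s (order_index (rarr s key_arr) (nvar s count_reg) r)"
  have \<sigma>: "bij_betw ?\<sigma> {..<card A} A"
    using bij_betw_trans[OF order_index_bij[of "rarr s key_arr"
      "card A"]] listed tokens_listed_count[OF listed]
    by (auto simp: tokens_listed_def comp_def)
  have sorted: "key (?\<sigma> r) \<le> key (?\<sigma> r')" if "r < r'" "r' < card A" for r r'
    using order_index_sorted[OF that, of "rarr s key_arr"] listed tokens_listed_count[OF listed]
      order_index_less[of _ "card A" "rarr s key_arr"] that
    by (auto simp: tokens_listed_def)
  have img: "?\<sigma> ` {..<card A} = A" and inj: "inj_on ?\<sigma> {..<card A}"
    using \<sigma> by (auto simp: bij_betw_def)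
  show "card (lowest_tokens s j) = j"
    unfolding lowest_tokens_def using inj j by (subst card_image) (auto intro: inj_on_subset)
  show "lowest key A (lowest_tokens s j)"
    unfolding lowest_def lowest_tokens_def
  proof (intro conjI ballI)
    show "?\<sigma> ` {..<j} \<subseteq> A" using img j by auto
    fix x y assume x: "x \<in> ?\<sigma> ` {..<j}" and y: "y \<in> A - ?\<sigma> ` {..<j}"
    obtain r where r: "r < j" "x = ?\<sigma> r" using x by auto
    have "y \<in> ?\<sigma> ` {..<card A}" using y img by auto
    then obtain r' where r': "r' < card A" "y = ?\<sigma> r'" "\<not> r' < j" using y by auto
    show "key x \<le> key y" using sorted[of r r'] r r' by simp
  qed
qed

lemma mem_lowest_tokens_iff:
  assumes listed: "tokens_listed s A key" and j: "j \<le> card A" and r: "r < card A"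
  shows "token s (order_index (rarr s key_arr) (card A) r) \<in> lowest_tokens s j \<longleftrightarrow> r < j"
proof -
  have "inj_on (token s) {..<card A}" "inj_on (order_index (rarr s key_arr) (card A)) {..<card A}"
    using listed order_index_bij
      by (auto simp: tokens_listed_def bij_betw_def tokens_listed_count[OF listed])
  then show ?thesis
    using j r order_index_less unfolding lowest_tokens_def tokens_listed_count[OF listed]
    by (auto simp: inj_on_def) (metis lessThan_iff less_le_trans)
qed

definition push_token :: com where
  "push_token = RStore key_arr (NVar count_reg) (RVar key_reg) ;;
     NStore first_arr (NVar count_reg) (NVar row_reg) ;;
     NStore second_arr (NVar count_reg) (NVar col_reg) ;; increment count_reg"

definition list_pairs :: "nexp \<Rightarrow> bexp \<Rightarrow> com \<Rightarrow> com" where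
  "list_pairs u b c = NAssign count_reg (NConst 0) ;;
     For row_reg (NVar size_reg) (For col_reg u (If b (c ;; push_token) Skip))"

definition draw :: "nexp \<Rightarrow> com" where
  "draw u = Rand wanted_reg u ;; select"

lemma writes_push_token:
  "writes push_token = {Nat_var count_reg, Nat_array first_arr, Nat_array second_arr, Real_array key_arr}"
  by (auto simp: push_token_def)

lemma writes_list_pairs: "writes (list_pairs u b c) = token_locs \<union> writes c"
  by (auto simp: list_pairs_def writes_push_token)

lemma writes_draw:
  "writes (draw u) = Nat_var ` {candidate_reg, other_reg, rank_reg, chosen_reg, wanted_reg}"
  by (auto simp: draw_def writes_select)

definition pairs_before :: "(nat \<times> nat) set \<Rightarrow> nat \<Rightarrow> nat \<Rightarrow> (nat \<times> nat) set" where
  "pairs_before A i j = A \<inter> ({..<i} \<times> UNIV \<union> {i} \<times> {..<j})"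

lemma pairs_before_Suc:
  "pairs_before A i (Suc j) = (if (i, j) \<in> A then insert (i, j) (pairs_before A i j)
      else pairs_before A i j)"
  by (auto simp: pairs_before_def less_Suc_eq)

lemma pairs_before_row: "A \<subseteq> {..<n} \<times> {..<m} \<Longrightarrow> pairs_before A i m = pairs_before A (Suc i) 0"
  by (auto simp: pairs_before_def less_Suc_eq)

definition list_time :: "nat \<Rightarrow> nat \<Rightarrow> nat \<Rightarrow> nat" where
  "list_time N m T = N * (m * (T + 12) + 6) + 5"

context oracle_machine
begin

lemma tokens_listed_push:
  assumes listed: "tokens_listed s A key" and new: "(nvar s row_reg, nvar s col_reg) \<notin> A"
    and key: "rvar s key_reg = key (nvar s row_reg, nvar s col_reg)"
  shows "tokens_listed (effect push_token s) (insert (nvar s row_reg, nvar s col_reg) A) key"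
proof -
  let ?x = "(nvar s row_reg, nvar s col_reg)" and ?N = "nvar s count_reg"
  have token: "token (effect push_token s) = (token s)(?N := ?x)"
    by (auto simp: push_token_def token_def)
  have "bij_betw ((token s)(?N := ?x)) {..<?N} A"
    using listed by (subst bij_betw_cong[where g = "token s"]) (auto simp: tokens_listed_def)
  then have "bij_betw ((token s)(?N := ?x)) ({..<?N} \<union> {?N}) (A \<union> {?x})"
    using new by (intro bij_betw_combine) (auto simp: bij_betw_def)
  then have "bij_betw (token (effect push_token s)) {..<Suc ?N} (insert ?x A)"
    by (simp add: token lessThan_Suc)
  moreover have "\<forall>i<Suc ?N. rarr (effect push_token s) key_arr i
      = key (token (effect push_token s) i)"
    using listed key unfolding token by (auto simp: push_token_def tokens_listed_def less_Suc_eq)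
  ultimately show ?thesis
    by (simp add: tokens_listed_def) (simp add: push_token_def)
qed

lemma push_if_terminates:
  assumes W: "token_locs \<subseteq> W" and fresh: "token_locs \<inter> writes c = {}"
    and s': "agree W s s'" "tokens_listed s' (pairs_before A i j) key" "nvar s' row_reg = i"
      "nvar s' col_reg = j"
    and test: "bval s' b \<longleftrightarrow> (i, j) \<in> A"
    and eval: "(i, j) \<in> A \<Longrightarrow> terminates c s' T (\<lambda>s''. agree W s s'' \<and> rvar s'' key_reg = key (i, j))"
  shows "terminates (If b (c ;; push_token) Skip) s' (T + 9)
    (\<lambda>s''. agree W s s'' \<and> tokens_listed s'' (pairs_before A i (Suc j)) key \<and> nvar s'' row_reg = i)"
    (is "terminates _ _ _ ?Q")
proof -
  have "terminates (If b (c ;; push_token) Skip) s' (T + 7 + 1 + 1) ?Q"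
  proof (rule attains_If)
    assume "bval s' b"
    then have in_A: "(i, j) \<in> A" using test by simp
    show "terminates (c ;; push_token) s' (T + 7 + 1) ?Q"
    proof (rule terminates_Seq[OF attains_frame[OF eval[OF in_A]]])
      fix s'' assume s'': "(agree W s s'' \<and> rvar s'' key_reg = key (i, j)) \<and> agree (writes c) s' s''"
      then have same: "nvar s'' row_reg = i" "nvar s'' col_reg = j"
        and "tokens_listed s'' (pairs_before A i j) key"
        using s' fresh tokens_listed_agree[of "writes c" s' s''] by (auto simp: agree_def)
      then have "tokens_listed (effect push_token s'') (insert (i, j) (pairs_before A i j)) key"
        using s'' tokens_listed_push[of s'' "pairs_before A i j" key] by (simp add: pairs_before_def)
      moreover have "agree W s (effect push_token s'')"
        using s'' W by (auto simp: agree_def push_token_def)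
      ultimately show "terminates push_token s'' 7 ?Q"
        using same in_A unfolding pairs_before_Suc
          by (intro attains_straight) (simp_all add: push_token_def)
    qed
  next
    assume "\<not> bval s' b"
    then show "terminates Skip s' (T + 7 + 1) ?Q"
      using s' test unfolding pairs_before_Suc by (intro attains_straight) auto
  qed
  then show ?thesis by (rule terminates_mono) auto
qed

lemma list_pairs_terminates:
  assumes size: "nvar s size_reg = n" and A: "A \<subseteq> {..<n} \<times> {..<m}"
    and W: "token_locs \<subseteq> W" "Nat_var size_reg \<notin> W" and fresh: "token_locs \<inter> writes c = {}"
    and bound: "\<And>s'. agree W s s' \<Longrightarrow> nval s' u = m"
    and test: "\<And>s'. agree W s s' \<Longrightarrow> nvar s' row_reg < n \<Longrightarrow> nvar s' col_reg < m \<Longrightarrow>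
      bval s' b \<longleftrightarrow> (nvar s' row_reg, nvar s' col_reg) \<in> A"
    and eval: "\<And>s'. agree W s s' \<Longrightarrow> (nvar s' row_reg, nvar s' col_reg) \<in> A \<Longrightarrow>
      terminates c s' T (\<lambda>s''. agree W s s'' \<and>
          rvar s'' key_reg = key (nvar s' row_reg, nvar s' col_reg))"
  shows "terminates (list_pairs u b c) s (list_time n m T)
      (\<lambda>s'. agree W s s' \<and> tokens_listed s' A key)"
proof -
  let ?I = "\<lambda>i s'. agree W s s' \<and> tokens_listed s' (pairs_before A i 0) key"
  let ?J = "\<lambda>i j s'. agree W s s' \<and> tokens_listed s' (pairs_before A i j) key \<and> nvar s' row_reg = i"
  let ?cell = "If b (c ;; push_token) Skip"
  have fresh_cell: "Nat_var row_reg \<notin> writes ?cell" "Nat_var col_reg \<notin> writes ?cell"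
    using fresh by (auto simp: writes_push_token)
  have row: "terminates (For col_reg u ?cell) s' (m * (T + 12) + 3) (?I (Suc i))"
    if i: "i < n" and I: "?I i s'" "nvar s' row_reg = i" for i s'
  proof -
    have "terminates (For col_reg u ?cell) s' (m * (T + 9 + 3) + 3) (?J i m)"
    proof (rule attains_For)
      fix j s1 assume j: "j < m" "nvar s1 col_reg = j" and J: "?J i j s1"
      then show "terminates ?cell s1 (T + 9) (?J i (Suc j))"
        using i test[of s1] eval[of s1] by (intro push_if_terminates[OF W(1) fresh]) auto
    qed (use I bound W(1) fresh_cell
      in \<open>auto simp: agree_set_nvar tokens_listed_def token_def[abs_def]\<close>)
    then show ?thesis using A pairs_before_row by (elim terminates_mono) auto
  qed
  have "terminates (list_pairs u b c) s (1 + (n * (m * (T + 12) + 3 + 3) + 3) + 1) (?I n)"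
    unfolding list_pairs_def
  proof (rule terminates_Seq)
    show "terminates (NAssign count_reg (NConst 0)) s 1 (?I 0)"
      using W(1) by (intro attains_straight)
        (auto simp: agree_def tokens_listed_def bij_betw_def pairs_before_def)
    show "terminates (For row_reg (NVar size_reg) (For col_reg u ?cell)) s1
        (n * (m * (T + 12) + 3 + 3) + 3) (?I n)"
      if "?I 0 s1" for s1
    proof (rule attains_For)
      show "?I i (s1\<lparr>nvar := (nvar s1)(row_reg := v)\<rparr>) \<longleftrightarrow> ?I i s1" for i v s1
        using W(1) by (simp add: agree_set_nvar tokens_listed_def token_def[abs_def])
      show "nval s' (NVar size_reg) = n" if "?I i s'" for i s'
        using that W(2) size by (simp add: agree_def)
    qed (use that row fresh_cell in auto)
  qed
  moreover have "pairs_before A n 0 = A" using A by (auto simp: pairs_before_def)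
  ultimately show ?thesis by (elim terminates_mono) (auto simp: list_time_def algebra_simps)
qed

lemma lowest_tokens_all:
  assumes "tokens_listed s A key"
  shows "lowest_tokens s (card A) = A"
proof -
  have "finite A" using assms bij_betw_finite by (auto simp: tokens_listed_def)
  then show ?thesis
    using lowest_tokens[OF assms order_refl] by (intro card_subset_eq) (auto simp: lowest_def)
qed

lemma select_rank_terminates:
  assumes listed: "tokens_listed s A key" and r: "nvar s wanted_reg = r" "r < card A"
  shows "terminates select s (select_time (card A))
    (\<lambda>s'. chosen_token s' = token s (order_index (rarr s key_arr) (card A) r) \<and>
        nvar s' wanted_reg = r)"
proof -
  have "terminates select s (select_time (card A))
      (\<lambda>s'. nvar s' chosen_reg = order_index (rarr s key_arr) (card A) r \<and>
          agree (writes select) s s')"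
    using r tokens_listed_count[OF listed] by (intro attains_frame[OF select_terminates]) auto
  then show ?thesis
    by (rule terminates_mono) (use r(1) in \<open>auto simp: agree_def writes_select token_def\<close>)
qed

lemma attains_draw:
  assumes listed: "tokens_listed s A key" and m: "nval s u + 1 = m" "m \<le> card A"
    and v: "v \<le> average (lowest_tokens s m) V"
  shows "attains (draw u) s (select_time (card A) + 2)
    (\<lambda>s'. agree (writes (draw u)) s s' \<and> chosen_token s' \<in> lowest_tokens s m \<and>
      (\<forall>j\<le>card A. chosen_token s' \<in> lowest_tokens s j \<longleftrightarrow> nvar s' wanted_reg < j))
    (\<lambda>s'. V (chosen_token s')) v"
proof -
  let ?\<sigma> = "\<lambda>r. token s (order_index (rarr s key_arr) (card A) r)"
  let ?s = "\<lambda>r. s\<lparr>nvar := (nvar s)(wanted_reg := r)\<rparr>"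
  let ?Q = "\<lambda>s'. chosen_token s' \<in> lowest_tokens s m \<and>
    (\<forall>j\<le>card A. chosen_token s' \<in> lowest_tokens s j \<longleftrightarrow> nvar s' wanted_reg < j)"
  have lowest_m: "lowest_tokens s m = ?\<sigma> ` {..<m}"
    by (simp add: lowest_tokens_def tokens_listed_count[OF listed])
  have "inj_on ?\<sigma> {..<m}"
    using lowest_tokens(2)[OF listed m(2)] unfolding lowest_m by (intro eq_card_imp_inj_on) auto
  then have v': "v \<le> average {..<m} (\<lambda>r. V (?\<sigma> r))"
    using v unfolding lowest_m by (simp add: average_image comp_def)
  have select: "attains select s1 (select_time (card A)) ?Q
      (\<lambda>s'. V (chosen_token s')) (V (?\<sigma> (nvar s1 wanted_reg)))" if drawn: "\<exists>r<m. s1 = ?s r" for s1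
  proof -
    obtain r where r: "r < m" "s1 = ?s r" using drawn by blast
    have "tokens_listed s1 A key"
      using listed by (simp add: r(2) tokens_listed_def token_def[abs_def])
    then have "terminates select s1 (select_time (card A))
        (\<lambda>s'. chosen_token s' = ?\<sigma> r \<and> nvar s' wanted_reg = r)"
      using select_rank_terminates[of s1 A key r] r m(2) by (simp add: token_def[abs_def])
    then have "attains select s1 (select_time (card A))
        (\<lambda>s'. chosen_token s' = ?\<sigma> r \<and> nvar s' wanted_reg = r)
        (\<lambda>s'. V (chosen_token s')) (V (?\<sigma> r))" by (rule attains_of_terminates) simp
    then show ?thesis
      by (rule attains_mono) (use r m(2) mem_lowest_tokens_iff[OF listed] in auto)
  qed
  have "attains (draw u) s (1 + select_time (card A) + 1) ?Q (\<lambda>s'. V (chosen_token s')) v"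
    unfolding draw_def
  proof (rule attains_Seq[OF attains_Rand[OF m(1)]])
    show "\<exists>r'<m. ?s r = ?s r'" if "r < m" for r using that by auto
    show "v \<le> average {..<m} (\<lambda>r. V (?\<sigma> (nvar (?s r) wanted_reg)))" using v' by simp
  qed (rule select)
  from attains_frame[OF this] show ?thesis by (rule attains_mono) auto
qed

lemma draw_lowest_terminates:
  assumes listed: "tokens_listed s A key" and A: "1 \<le> card A"
  shows "terminates (draw (NConst 0)) s (select_time (card A) + 2)
      (\<lambda>s'. agree (writes (draw (NConst 0))) s s' \<and>
    chosen_token s' \<in> A \<and> (\<forall>y\<in>A. key (chosen_token s') \<le> key y))"
proof -
  have "terminates (draw (NConst 0)) s (select_time (card A) + 2)
      (\<lambda>s'. agree (writes (draw (NConst 0))) s s' \<and>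
      chosen_token s' \<in> lowest_tokens s 1 \<and>
      (\<forall>j\<le>card A. chosen_token s' \<in> lowest_tokens s j \<longleftrightarrow> nvar s' wanted_reg < j))"
    by (rule attains_draw[OF listed, where V = "\<lambda>_. 0"]) (use A in \<open>simp_all add: average_def\<close>)
  then show ?thesis
  proof (rule terminates_mono)
    fix s' assume s': "agree (writes (draw (NConst 0))) s s' \<and> chosen_token s' \<in> lowest_tokens s 1 \<and>
      (\<forall>j\<le>card A. chosen_token s' \<in> lowest_tokens s j \<longleftrightarrow> nvar s' wanted_reg < j)"
    then have "lowest_tokens s 1 = {chosen_token s'}"
      using lowest_tokens(2)[OF listed A] by (auto simp: card_1_singleton_iff)
    then have "lowest key A {chosen_token s'}" using lowest_tokens(1)[OF listed A] by simp
    then show "agree (writes (draw (NConst 0))) s s' \<and> chosen_token s' \<in> A \<and>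
        (\<forall>y\<in>A. key (chosen_token s') \<le> key y)" using s' by (simp add: lowest_singleton)
  qed simp
qed

end

section \<open>Sets in memory\<close>

abbreviation (input) target_reg :: nat where "target_reg \<equiv> 2"
abbreviation (input) in_reg :: nat where "in_reg \<equiv> 3"
abbreviation (input) out_reg :: nat where "out_reg \<equiv> 4"
abbreviation (input) save_reg :: nat where "save_reg \<equiv> 13"
abbreviation (input) cell_reg :: nat where "cell_reg \<equiv> 14"
abbreviation (input) solution_arr :: nat where "solution_arr \<equiv> 0"
abbreviation (input) aid_arr :: nat where "aid_arr \<equiv> 4"

abbreviation "parameter_locs \<equiv> Nat_var ` {size_reg, target_reg, in_reg, out_reg}"

definition member :: "nat \<Rightarrow> nexp \<Rightarrow> bexp" where
  "member a u = BOr (BAnd (NLess (NVar out_reg) (NVar in_reg)) (NLess (NVar out_reg) (NArr a u)))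
     (NLess (NArr a u) (NVar out_reg))"

definition store_first :: "nexp \<Rightarrow> nat \<Rightarrow> nexp \<Rightarrow> com" where
  "store_first u a v = For cell_reg u (NStore a (NVar cell_reg) v)"

definition store_initial :: "nat \<Rightarrow> nexp \<Rightarrow> com" where
  "store_initial a u = store_first (NVar size_reg) a (NVar out_reg) ;; store_first u a (NVar in_reg)"

definition copy_array :: "nat \<Rightarrow> nat \<Rightarrow> com" where
  "copy_array a b = store_first (NVar size_reg) a (NArr b (NVar cell_reg))"

definition query_with :: "nat \<Rightarrow> nat \<Rightarrow> nat \<Rightarrow> com" where
  "query_with x a v = NAssign save_reg (NArr a (NVar row_reg)) ;;
     NStore a (NVar row_reg) (NVar v) ;; Query x a ;; NStore a (NVar row_reg) (NVar save_reg)"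

text \<open>
  Exchanging the cells of a member and a nonmember exchanges their roles; exchanging them again
  restores the array.
\<close>

definition swap_cells :: "nat \<Rightarrow> com" where
  "swap_cells a = NAssign save_reg (NArr a (NVar row_reg)) ;;
     NStore a (NVar row_reg) (NArr a (NVar col_reg)) ;; NStore a (NVar col_reg) (NVar save_reg)"

lemma writes_store_first: "writes (store_first u a v) = {Nat_var cell_reg, Nat_array a}"
  by (simp add: store_first_def)

lemma writes_copy_array: "writes (copy_array a b) = {Nat_var cell_reg, Nat_array a}"
  by (simp add: copy_array_def writes_store_first)

lemma writes_query_with: "writes (query_with x a v) = {Nat_var save_reg, Nat_array a, Real_var x}"
  by (auto simp: query_with_def)

lemma writes_swap_cells: "writes (swap_cells a) = {Nat_var save_reg, Nat_array a}"
  by (auto simp: swap_cells_def)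

text \<open>
  With \<open>direct\<close> false, the arrays hold the complements of the sets that the program works on, and
  the oracle answers for the complement.
\<close>

locale submodular_machine = oracle_machine n g + nonneg_submodular "{..<n}" f
  for n :: nat and g f :: "nat set \<Rightarrow> real" +
  fixes direct :: bool and k :: nat
  assumes answers: "A \<subseteq> {..<n} \<Longrightarrow> g (if direct then A else {..<n} - A) = f A"
begin

definition members :: "state \<Rightarrow> nat \<Rightarrow> nat set" where
  "members s a = {i. i < n \<and> (narr s a i \<noteq> 0) = direct}"

definition configured :: "state \<Rightarrow> bool" where
  "configured s \<longleftrightarrow> nvar s size_reg = n \<and> nvar s target_reg = k \<and>
     nvar s in_reg = of_bool direct \<and> nvar s out_reg = of_bool (\<not> direct)"

lemma members_subset: "members s a \<subseteq> {..<n}"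
  by (auto simp: members_def)

lemma members_update [simp]:
  "members (s\<lparr>nvar := x\<rparr>) a = members s a" "members (s\<lparr>rvar := y\<rparr>) a = members s a"
  "b \<noteq> a \<Longrightarrow> members (s\<lparr>narr := (narr s)(b := z)\<rparr>) a = members s a"
  by (simp_all add: members_def)

lemma array_set_members: "array_set n s a = (if direct then members s a else {..<n} - members s a)"
  unfolding array_set_def members_def by auto

lemma oracle_members: "g (array_set n s a) = f (members s a)"
  unfolding array_set_members by (rule answers[OF members_subset])

lemma configured_agree:
  assumes "agree W s s'" "parameter_locs \<inter> W = {}"
  shows "configured s' \<longleftrightarrow> configured s"
  using assms by (simp add: agree_def configured_def)

lemma members_agree: "agree W s s' \<Longrightarrow> Nat_array a \<notin> W \<Longrightarrow> members s' a = members s a"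
  by (simp add: agree_def members_def)

lemma bval_member:
  assumes "configured s" "nval s u < n"
  shows "bval s (member a u) \<longleftrightarrow> nval s u \<in> members s a"
  using assms by (auto simp: member_def configured_def members_def)

lemma members_store:
  assumes "configured s" "x < n"
  shows "members (s\<lparr>narr := (narr s)(a := (narr s a)(x := nvar s in_reg))\<rparr>) a
      = insert x (members s a)"
    and "members (s\<lparr>narr := (narr s)(a := (narr s a)(x := nvar s out_reg))\<rparr>) a = members s a - {x}"
  using assms by (auto simp: configured_def members_def)

lemma store_first_terminates:
  assumes bound: "\<And>s'. agree {Nat_var cell_reg, Nat_array a} s s' \<Longrightarrow> nval s' u = m"
    and val: "\<And>s'. agree {Nat_var cell_reg, Nat_array a} s s' \<Longrightarrow> nval s' v = w (nvar s' cell_reg)"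
  shows "terminates (store_first u a v) s (m * 4 + 3) (\<lambda>s'.
    narr s' a = (\<lambda>i. if i < m then w i else narr s a i) \<and> agree {Nat_var cell_reg, Nat_array a} s s')"
proof -
  let ?I = "\<lambda>i s'. narr s' a = (\<lambda>j. if j < i then w j else narr s a j)"
  have "terminates (store_first u a v) s (m * (1 + 3) + 3)
      (\<lambda>s'. ?I m s' \<and> agree {Nat_var cell_reg, Nat_array a} s s')"
    unfolding store_first_def
  proof (rule terminates_For[where I = ?I])
    fix i s' assume "?I i s'" "agree {Nat_var cell_reg, Nat_array a} s s'" "nvar s' cell_reg = i"
    then show "terminates (NStore a (NVar cell_reg) v) s' 1 (?I (Suc i))"
      using val by (intro attains_straight) (auto simp: fun_eq_iff less_Suc_eq)
  qed (use bound in auto)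
  then show ?thesis by simp
qed

lemma store_initial_terminates:
  assumes s: "configured s"
    and bound: "\<And>s'. agree {Nat_var cell_reg, Nat_array a} s s' \<Longrightarrow> nval s' u = m" and m: "m \<le> n"
  shows "terminates (store_initial a u) s (n * 8 + 7)
      (\<lambda>s'. members s' a = {..<m} \<and> agree {Nat_var cell_reg, Nat_array a} s s')"
proof -
  let ?W = "{Nat_var cell_reg, Nat_array a}"
  have "terminates (store_initial a u) s ((n * 4 + 3) + (m * 4 + 3) + 1)
      (\<lambda>s'. members s' a = {..<m} \<and> agree ?W s s')"
    unfolding store_initial_def
  proof (rule terminates_Seq[OF store_first_terminates[where w = "\<lambda>_. nvar s out_reg"]])
    fix s1 assume s1: "narr s1 a = (\<lambda>i. if i < n then nvar s out_reg else narr s a i) \<and> agree ?W s s1"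
    have "terminates (store_first u a (NVar in_reg)) s1 (m * 4 + 3)
        (\<lambda>s'. narr s' a = (\<lambda>i. if i < m then nvar s in_reg else narr s1 a i) \<and> agree ?W s1 s')"
      using s1 bound agree_trans by (intro store_first_terminates) (blast, simp add: agree_def)
    then show "terminates (store_first u a (NVar in_reg)) s1 (m * 4 + 3)
        (\<lambda>s'. members s' a = {..<m} \<and> agree ?W s s')"
      using s1 s m by (elim terminates_mono)
        (auto simp: members_def configured_def intro: agree_trans)
  qed (use s in \<open>auto simp: agree_def configured_def\<close>)
  then show ?thesis using m by (elim terminates_mono) auto
qed

lemma copy_array_terminates:
  assumes "configured s" "a \<noteq> b"
  shows "terminates (copy_array a b) s (n * 4 + 3)
      (\<lambda>s'. members s' a = members s b \<and> agree {Nat_var cell_reg, Nat_array a} s s')"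
proof -
  have "terminates (copy_array a b) s (n * 4 + 3) (\<lambda>s'.
      narr s' a = (\<lambda>i. if i < n then narr s b i else narr s a i) \<and>
          agree {Nat_var cell_reg, Nat_array a} s s')"
    unfolding copy_array_def
    using assms by (intro store_first_terminates) (auto simp: agree_def configured_def)
  then show ?thesis by (rule terminates_mono) (auto simp: members_def)
qed

lemma effect_query_with:
  assumes "configured s" "nvar s row_reg < n"
  shows "effect (query_with x a in_reg) s = s\<lparr>nvar := (nvar s)(save_reg := narr s a (nvar s row_reg)),
      rvar := (rvar s)(x := f (insert (nvar s row_reg) (members s a)))\<rparr>"
    and "effect (query_with x a out_reg) s = s\<lparr>nvar := (nvar s)(save_reg := narr s a
        (nvar s row_reg)),
      rvar := (rvar s)(x := f (members s a - {nvar s row_reg}))\<rparr>"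
proof -
  let ?s = "s\<lparr>nvar := (nvar s)(save_reg := narr s a (nvar s row_reg))\<rparr>"
  have "configured ?s" "members ?s a = members s a"
    using assms(1) by (simp_all add: configured_def members_def)
  with members_store[of ?s "nvar s row_reg" a] assms(2)
  show "effect (query_with x a in_reg) s = s\<lparr>nvar := (nvar s)(save_reg := narr s a (nvar s row_reg)),
      rvar := (rvar s)(x := f (insert (nvar s row_reg) (members s a)))\<rparr>"
    and "effect (query_with x a out_reg) s = s\<lparr>nvar := (nvar s)(save_reg := narr s a
        (nvar s row_reg)),
      rvar := (rvar s)(x := f (members s a - {nvar s row_reg}))\<rparr>"
    by (simp_all add: query_with_def oracle_members)
qed

lemma members_swap_cells:
  assumes "nvar s row_reg \<in> members s a" "nvar s col_reg < n" "nvar s col_reg \<notin> members s a"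
  shows "members (effect (swap_cells a) s) a
      = insert (nvar s col_reg) (members s a - {nvar s row_reg})"
  using assms by (auto simp: swap_cells_def members_def split: if_splits)

end

section \<open>Local search\<close>

abbreviation (input) round_reg :: nat where "round_reg \<equiv> 15"
abbreviation (input) limit_reg :: nat where "limit_reg \<equiv> 16"
abbreviation (input) value_reg :: nat where "value_reg \<equiv> 2"
abbreviation (input) gain_reg :: nat where "gain_reg \<equiv> 3"
abbreviation (input) least_gain_reg :: nat where "least_gain_reg \<equiv> 4"

definition swappable :: bexp where
  "swappable = BAnd (member solution_arr (NVar row_reg)) (BNot (member solution_arr (NVar col_reg)))"

definition evaluate_swap :: com where
  "evaluate_swap = swap_cells solution_arr ;; Query key_reg solution_arr ;;
     RAssign key_reg (RSub RZero (RVar key_reg)) ;; swap_cells solution_arr"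

definition load_swap :: com where
  "load_swap = (NAssign row_reg (NArr first_arr (NVar chosen_reg)) ;;
       NAssign col_reg (NArr second_arr (NVar chosen_reg))) ;;
     evaluate_swap ;; Query value_reg solution_arr ;;
     RAssign gain_reg (RSub (RSub RZero (RVar key_reg)) (RVar value_reg))"

definition record_set :: com where
  "record_set =
     If (BOr (NLess (NVar round_reg) (NConst 1)) (RLess (RVar gain_reg) (RVar least_gain_reg)))
       (RAssign least_gain_reg (RVar gain_reg) ;; copy_array aid_arr solution_arr) Skip"

definition perform_swap :: com where
  "perform_swap = If (RLess RZero (RVar gain_reg)) (swap_cells solution_arr) Skip"

definition swap_round :: com where
  "swap_round = list_pairs (NVar size_reg) swappable evaluate_swap ;; draw (NConst 0) ;;
     load_swap ;; record_set ;; perform_swap"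

definition square_size :: com where
  "square_size = NAssign limit_reg (NConst 0) ;;
     For row_reg (NVar size_reg) (NAssign limit_reg (NAdd (NVar limit_reg) (NVar size_reg)))"

lemma swap_round_keeps:
  "writes swap_round \<inter> (Nat_var ` {round_reg, limit_reg} \<union> parameter_locs) = {}"
  by (auto simp: swap_round_def writes_list_pairs evaluate_swap_def writes_swap_cells writes_draw
    load_swap_def
      record_set_def writes_copy_array perform_swap_def)

text \<open>
  Every round raises the value by its best gain, if positive.  The least of \<open>n\<^sup>2\<close> such gains is hence at
  most \<open>opt_value / n\<^sup>2\<close>, and the set from which it arose is recorded.
\<close>

definition local_search :: com where
  "local_search = square_size ;; store_initial solution_arr (NVar target_reg) ;;
     For round_reg (NVar limit_reg) swap_round"

definition swap_round_time :: "nat \<Rightarrow> nat" where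
  "swap_round_time n = list_time n n 15 + select_time (n * n) + n * 4 + 43"

definition local_search_time :: "nat \<Rightarrow> nat" where
  "local_search_time n = n * n * (swap_round_time n + 3) + n * 12 + 17"

context submodular_machine
begin

definition swap_optimal :: "nat set \<Rightarrow> real \<Rightarrow> bool" where
  "swap_optimal Z \<delta> \<longleftrightarrow> Z \<subseteq> {..<n} \<and> card Z = k \<and>
      (\<forall>u\<in>Z. \<forall>v\<in>{..<n} - Z. f (insert v (Z - {u})) \<le> f Z + \<delta>)"

abbreviation "swap_set Z x \<equiv> insert (snd x) (Z - {fst x})"

lemma evaluate_swap_terminates:
  assumes s: "nvar s row_reg \<in> members s solution_arr" "nvar s col_reg < n"
    "nvar s col_reg \<notin> members s solution_arr"
  shows "terminates evaluate_swap s 15 (\<lambda>s'. agree {Nat_var save_reg, Real_var key_reg} s s' \<and>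
    rvar s' key_reg = - f (swap_set (members s solution_arr) (nvar s row_reg, nvar s col_reg)))"
proof (rule attains_straight)
  show "agree {Nat_var save_reg, Real_var key_reg} s (effect evaluate_swap s) \<and>
      rvar (effect evaluate_swap s) key_reg = - f
          (swap_set (members s solution_arr) (nvar s row_reg, nvar s col_reg))"
    unfolding fst_conv snd_conv members_swap_cells[OF s, symmetric] oracle_members[symmetric]
    by (auto simp: evaluate_swap_def swap_cells_def agree_def fun_eq_iff)
qed (simp_all add: evaluate_swap_def swap_cells_def)

lemma list_swaps_terminates:
  fixes s :: state
  defines "Z \<equiv> members s solution_arr"
  assumes s: "configured s"
  shows "terminates (list_pairs (NVar size_reg) swappable evaluate_swap) s (list_time n n 15) (\<lambda>s'.
    agree (token_locs \<union> {Nat_var save_reg, Real_var key_reg}) s s' \<and>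
    tokens_listed s' (Z \<times> ({..<n} - Z)) (\<lambda>x. - f (swap_set Z x)))"
proof (rule list_pairs_terminates)
  let ?W = "token_locs \<union> {Nat_var save_reg, Real_var key_reg}"
  show "nvar s size_reg = n" using s by (simp add: configured_def)
  show "Z \<times> ({..<n} - Z) \<subseteq> {..<n} \<times> {..<n}" using members_subset by (auto simp: Z_def)
  show "token_locs \<inter> writes evaluate_swap = {}"
    by (auto simp: evaluate_swap_def writes_swap_cells)
  fix s' assume agree: "agree ?W s s'"
  then show "nval s' (NVar size_reg) = n" using s by (simp add: agree_def configured_def)
  have Z: "members s' solution_arr = Z" unfolding Z_def using agree by (rule members_agree) simp
  have "configured s'" using configured_agree[OF agree] s by auto
  then show "bval s' swappable \<longleftrightarrow> (nvar s' row_reg, nvar s' col_reg) \<in> Z \<times> ({..<n} - Z)"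
    if "nvar s' row_reg < n" "nvar s' col_reg < n"
    using that by (simp add: swappable_def bval_member Z)
  assume x: "(nvar s' row_reg, nvar s' col_reg) \<in> Z \<times> ({..<n} - Z)"
  have "terminates evaluate_swap s' 15 (\<lambda>s''. agree {Nat_var save_reg, Real_var key_reg} s' s'' \<and>
      rvar s'' key_reg = - f (swap_set Z (nvar s' row_reg, nvar s' col_reg)))"
    using evaluate_swap_terminates[of s'] x unfolding Z by auto
  then show "terminates evaluate_swap s' 15 (\<lambda>s''. agree ?W s s'' \<and>
      rvar s'' key_reg = - f (swap_set Z (nvar s' row_reg, nvar s' col_reg)))"
    by (rule terminates_mono) (use agree in \<open>blast intro: agree_trans agree_mono\<close>)+
qed auto

lemma record_set_terminates:
  assumes s: "configured s"
  shows "terminates record_set s (n * 4 + 6)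
      (\<lambda>s'. agree {Nat_var cell_reg, Nat_array aid_arr, Real_var least_gain_reg} s s' \<and>
    (if nvar s round_reg = 0 \<or> rvar s gain_reg < rvar s least_gain_reg
     then members s' aid_arr = members s solution_arr \<and> rvar s' least_gain_reg = rvar s gain_reg
     else members s' aid_arr = members s aid_arr \<and> rvar s' least_gain_reg = rvar s least_gain_reg))"
    (is "terminates _ _ _ ?Q")
proof -
  let ?store = "RAssign least_gain_reg (RVar gain_reg)"
  have "terminates record_set s ((1 + (n * 4 + 3) + 1) + 1) ?Q"
    unfolding record_set_def
  proof (rule attains_If)
    assume b: "bval s (BOr (NLess (NVar round_reg) (NConst 1))
        (RLess (RVar gain_reg) (RVar least_gain_reg)))"
    show "terminates (?store ;; copy_array aid_arr solution_arr) s (1 + (n * 4 + 3) + 1) ?Q"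
    proof (rule terminates_Seq)
      let ?s = "s\<lparr>rvar := (rvar s)(least_gain_reg := rvar s gain_reg)\<rparr>"
      show "terminates ?store s 1 (\<lambda>s'. s' = ?s)" by (rule attains_straight) simp_all
      have "terminates (copy_array aid_arr solution_arr) ?s (n * 4 + 3)
          (\<lambda>s'. members s' aid_arr = members ?s solution_arr \<and>
              agree {Nat_var cell_reg, Nat_array aid_arr} ?s s')"
        using s by (intro copy_array_terminates) (simp_all add: configured_def)
      then show "terminates (copy_array aid_arr solution_arr) s1 (n * 4 + 3) ?Q" if "s1 = ?s" for s1
        unfolding that by (rule terminates_mono) (use b in \<open>auto simp: agree_def members_def\<close>)
    qed
  qed (intro attains_straight, auto simp: agree_refl)
  then show ?thesis by (rule terminates_mono) auto
qed

lemma load_swap_terminates: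
  assumes chosen: "chosen_token s \<in> members s solution_arr \<times> ({..<n} - members s solution_arr)"
  shows "terminates load_swap s 25 (\<lambda>s'.
    agree {Nat_var row_reg, Nat_var col_reg, Nat_var save_reg, Real_var key_reg, Real_var value_reg,
        Real_var gain_reg} s s' \<and>
    (nvar s' row_reg, nvar s' col_reg) = chosen_token s \<and>
    rvar s' gain_reg = f (swap_set (members s solution_arr) (chosen_token s))
        - f (members s solution_arr))"
    (is "terminates _ _ _ ?Q")
proof -
  let ?load = "NAssign row_reg (NArr first_arr (NVar chosen_reg)) ;;
      NAssign col_reg (NArr second_arr (NVar chosen_reg))"
  let ?set = "Query value_reg solution_arr ;;
      RAssign gain_reg (RSub (RSub RZero (RVar key_reg)) (RVar value_reg))"
  let ?s = "s\<lparr>nvar := (nvar s)(row_reg := fst (chosen_token s), col_reg := snd (chosen_token s))\<rparr>"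
  have same: "members ?s solution_arr = members s solution_arr" by (simp add: members_def)
  have "terminates load_swap s (3 + (15 + 3 + 1) + 1) ?Q"
    unfolding load_swap_def
  proof (rule terminates_Seq)
    show "terminates ?load s 3 (\<lambda>s1. s1 = ?s)"
      by (rule attains_straight) (simp_all add: token_def)
    show "terminates (evaluate_swap ;; ?set) s1 (15 + 3 + 1) ?Q" if s1: "s1 = ?s" for s1
      unfolding s1
    proof (rule terminates_Seq[OF evaluate_swap_terminates])
      fix s2 assume s2: "agree {Nat_var save_reg, Real_var key_reg} ?s s2 \<and>
        rvar s2 key_reg = - f (swap_set (members ?s solution_arr) (nvar ?s row_reg, nvar ?s col_reg))"
      then have "members s2 solution_arr = members s solution_arr"
        using members_agree[of _ ?s s2] same by auto
      then show "terminates ?set s2 3 ?Q"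
        using s2 same by (intro attains_straight) (auto simp: oracle_members agree_def token_def)
    qed (use chosen in \<open>auto simp: same token_def\<close>)
  qed
  then show ?thesis by (rule terminates_mono) auto
qed

lemma perform_swap_terminates:
  assumes "(nvar s row_reg, nvar s col_reg) \<in> members s solution_arr \<times> ({..<n}
      - members s solution_arr)"
  shows "terminates perform_swap s 6 (\<lambda>s'. agree {Nat_var save_reg, Nat_array solution_arr} s s' \<and>
    members s' solution_arr = (if 0 < rvar s gain_reg
      then swap_set (members s solution_arr) (nvar s row_reg, nvar s col_reg)
          else members s solution_arr))"
  using assms by (intro attains_straight)
    (auto simp: perform_swap_def members_swap_cells, auto simp: swap_cells_def agree_def)

definition swap_result :: "state \<Rightarrow> nat \<times> nat \<Rightarrow> state \<Rightarrow> bool" where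
  "swap_result s x s' \<longleftrightarrow> (let Z = members s solution_arr; \<delta> = f (swap_set Z x) - f Z in
     members s' solution_arr = (if 0 < \<delta> then swap_set Z x else Z) \<and>
     (if nvar s round_reg = 0 \<or> \<delta> < rvar s least_gain_reg
      then members s' aid_arr = Z \<and> rvar s' least_gain_reg = \<delta>
      else members s' aid_arr = members s aid_arr \<and> rvar s' least_gain_reg = rvar s least_gain_reg))"

lemma swap_chosen_terminates:
  assumes s: "configured s"
    and chosen: "chosen_token s \<in> members s solution_arr \<times> ({..<n} - members s solution_arr)"
  shows "terminates (load_swap ;; record_set ;; perform_swap) s
      (n * 4 + 39) (swap_result s (chosen_token s))"
proof -
  let ?Z = "members s solution_arr" and ?x = "chosen_token s"
  let ?\<delta> = "f (swap_set ?Z ?x) - f ?Z"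
  have "terminates (load_swap ;; record_set ;; perform_swap) s
      (25 + (n * 4 + 6 + 6 + 1) + 1) (swap_result s ?x)"
  proof (rule terminates_Seq[OF load_swap_terminates[OF chosen]])
    fix s1 assume s1: "agree {Nat_var row_reg, Nat_var col_reg, Nat_var save_reg, Real_var key_reg,
        Real_var value_reg, Real_var gain_reg} s s1 \<and>
      (nvar s1 row_reg, nvar s1 col_reg) = ?x \<and> rvar s1 gain_reg = ?\<delta>"
    then have same1: "members s1 solution_arr = ?Z" "members s1 aid_arr = members s aid_arr"
      "configured s1"
      "nvar s1 round_reg = nvar s round_reg" "rvar s1 least_gain_reg = rvar s least_gain_reg"
      using s by (auto simp: agree_def members_def configured_def)
    show "terminates (record_set ;; perform_swap) s1 (n * 4 + 6 + 6 + 1) (swap_result s ?x)"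
    proof (rule terminates_Seq[OF record_set_terminates[OF same1(3)]])
      fix s2 assume s2: "agree {Nat_var cell_reg, Nat_array aid_arr, Real_var least_gain_reg} s1 s2 \<and>
        (if nvar s1 round_reg = 0 \<or> rvar s1 gain_reg < rvar s1 least_gain_reg
         then members s2 aid_arr = members s1 solution_arr \<and> rvar s2 least_gain_reg = rvar s1 gain_reg
         else members s2 aid_arr = members s1 aid_arr \<and>
             rvar s2 least_gain_reg = rvar s1 least_gain_reg)"
      then have same2: "members s2 solution_arr = ?Z" "rvar s2 gain_reg = ?\<delta>"
        "(nvar s2 row_reg, nvar s2 col_reg) = ?x"
        using same1 s1 by (auto simp: agree_def members_def)
      show "terminates perform_swap s2 6 (swap_result s ?x)"
      proof (rule terminates_mono[OF perform_swap_terminates])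
        fix s3 assume s3: "agree {Nat_var save_reg, Nat_array solution_arr} s2 s3 \<and>
            members s3 solution_arr =
          (if 0 < rvar s2 gain_reg then swap_set (members s2 solution_arr)
              (nvar s2 row_reg, nvar s2 col_reg)
           else members s2 solution_arr)"
        then have "members s3 aid_arr = members s2 aid_arr"
          "rvar s3 least_gain_reg = rvar s2 least_gain_reg"
          "members s3 solution_arr = (if 0 < ?\<delta> then swap_set ?Z ?x else ?Z)"
          unfolding same2 by (simp_all add: agree_def members_def)
        then show "swap_result s ?x s3" using s1 s2 unfolding swap_result_def Let_def same1 by simp
      qed (use chosen same2 in simp_all)
    qed
  qed
  then show ?thesis by (rule terminates_mono) auto
qed

lemma swap_round_terminates:
  fixes s :: state
  defines "Z \<equiv> members s solution_arr"
  assumes s: "configured s" and Z: "card Z = k" and k: "1 \<le> k" "k < n"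
  shows "terminates swap_round s (swap_round_time n) (\<lambda>s'. \<exists>x \<in> Z \<times> ({..<n} - Z).
    (\<forall>y \<in> Z \<times> ({..<n} - Z). f (swap_set Z y) \<le> f (swap_set Z x)) \<and> swap_result s x s')"
    (is "terminates _ _ _ ?Q")
proof -
  let ?A = "Z \<times> ({..<n} - Z)" and ?key = "\<lambda>x. - f (swap_set Z x)"
  let ?finish = "load_swap ;; record_set ;; perform_swap"
  have "Z \<subseteq> {..<n}" unfolding Z_def by (rule members_subset)
  then have card: "card ?A = k * (n - k)"
    using Z by (simp add: card_cartesian_product card_Diff_subset finite_subset)
  have card_A: "1 \<le> card ?A" "card ?A \<le> n * n" unfolding card using k by (auto intro: mult_mono)
  let ?draw_time = "select_time (card ?A) + 2" and ?finish_time = "n * 4 + 39"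
  have "terminates swap_round s (list_time n n 15 + (?draw_time + ?finish_time + 1) + 1) ?Q"
    unfolding swap_round_def
  proof (rule terminates_Seq[OF list_swaps_terminates[OF s, folded Z_def]])
    fix s1 assume s1: "agree (token_locs \<union> {Nat_var save_reg, Real_var key_reg}) s s1 \<and>
      tokens_listed s1 ?A ?key"
    show "terminates (draw (NConst 0) ;; ?finish) s1 (?draw_time + ?finish_time + 1) ?Q"
    proof (rule terminates_Seq[OF draw_lowest_terminates[OF conjunct2[OF s1] card_A(1)]])
      fix s2 assume s2: "agree (writes (draw (NConst 0))) s1 s2 \<and> chosen_token s2 \<in> ?A \<and>
        (\<forall>y\<in>?A. ?key (chosen_token s2) \<le> ?key y)"
      have same: "members s2 solution_arr = Z" "members s2 aid_arr = members s aid_arr"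
        "configured s2" "nvar s2 round_reg = nvar s round_reg"
        "rvar s2 least_gain_reg = rvar s least_gain_reg"
        using s1 s2 s by (auto simp: agree_def members_def configured_def Z_def writes_draw)
      then have "swap_result s2 = swap_result s" by (simp add: swap_result_def[abs_def] Z_def)
      then have "?Q s'" if "swap_result s2 (chosen_token s2) s'" for s'
        using that s2 unfolding neg_le_iff_le by metis
      then show "terminates ?finish s2 ?finish_time ?Q"
        using s2 same by (intro terminates_mono[OF swap_chosen_terminates]) simp_all
    qed
  qed
  then show ?thesis
    by (rule terminates_mono)
      (use select_time_mono[OF card_A(2)] in \<open>simp_all add: swap_round_time_def\<close>)
qed

definition search_invariant :: "nat \<Rightarrow> state \<Rightarrow> bool" where
  "search_invariant i s \<longleftrightarrow> configured s \<and> nvar s limit_reg = n * n \<and>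
      card (members s solution_arr) = k \<and>
     real i * max 0 (rvar s least_gain_reg) \<le> f (members s solution_arr) \<and>
     (0 < i \<longrightarrow> swap_optimal (members s aid_arr) (rvar s least_gain_reg))"

lemma swap_round_invariant:
  assumes I: "search_invariant i s" and i: "nvar s round_reg = i" and k: "1 \<le> k" "k < n"
  shows "terminates swap_round s (swap_round_time n) (search_invariant (Suc i))"
proof -
  let ?Z = "members s solution_arr"
  have s: "configured s" "card ?Z = k" and Z: "?Z \<subseteq> {..<n}" "finite ?Z"
    using I members_subset[of s] finite_sub by (auto simp: search_invariant_def)
  show ?thesis
  proof (rule terminates_mono[OF attains_frame[OF swap_round_terminates[OF s k]]])
    fix s' assume s': "(\<exists>x \<in> ?Z \<times> ({..<n} - ?Z).
      (\<forall>y \<in> ?Z \<times> ({..<n} - ?Z). f (swap_set ?Z y) \<le> f (swap_set ?Z x)) \<and> swap_result s x s') \<and>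
          agree (writes swap_round) s s'"
    then obtain x where x: "x \<in> ?Z \<times> ({..<n} - ?Z)" and result: "swap_result s x s'"
      and best: "\<And>y. y \<in> ?Z \<times> ({..<n} - ?Z) \<Longrightarrow> f (swap_set ?Z y) \<le> f (swap_set ?Z x)" by blast
    define \<delta> where "\<delta> = f (swap_set ?Z x) - f ?Z"
    have optimal: "swap_optimal ?Z \<delta>"
      unfolding swap_optimal_def \<delta>_def using s Z best by force
    have result': "members s' solution_arr = (if 0 < \<delta> then swap_set ?Z x else ?Z)"
      "if i = 0 \<or> \<delta> < rvar s least_gain_reg then members s' aid_arr = ?Z \<and> rvar s' least_gain_reg = \<delta>
       else members s' aid_arr = members s aid_arr \<and> rvar s' least_gain_reg = rvar s least_gain_reg"
      using result i unfolding swap_result_def Let_def \<delta>_def by simp_all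
    have "card (swap_set ?Z x) = k"
      using x s(2) Z(2) k by (auto simp: card_insert_if card_Diff_singleton_if)
    moreover have "f (members s' solution_arr) = f ?Z + max 0 \<delta>"
      unfolding result'(1) by (simp add: \<delta>_def)
    moreover have "real (Suc i) * max 0 (rvar s' least_gain_reg) \<le> f ?Z + max 0 \<delta>"
    proof -
      have "real i * max 0 (rvar s' least_gain_reg) \<le> real i * max 0 (rvar s least_gain_reg)"
        using result'(2) by (cases "i = 0") (auto intro!: mult_left_mono split: if_splits)
      moreover have "max 0 (rvar s' least_gain_reg) \<le> max 0 \<delta>"
        using result'(2) by (auto split: if_splits)
      ultimately show ?thesis using I by (auto simp: search_invariant_def algebra_simps)
    qed
    moreover have "swap_optimal (members s' aid_arr) (rvar s' least_gain_reg)"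
      using result'(2) optimal I by (cases "i = 0") (auto simp: search_invariant_def split: if_splits)
    moreover have "configured s'" "nvar s' limit_reg = n * n"
      using s' I swap_round_keeps by (auto simp: search_invariant_def agree_def configured_def)
    ultimately show "search_invariant (Suc i) s'"
      using result'(1) s(2) by (simp add: search_invariant_def)
  qed simp
qed

lemma square_size_terminates:
  assumes "configured s"
  shows "terminates square_size s (n * 4 + 5)
      (\<lambda>s'. nvar s' limit_reg = n * n \<and> agree {Nat_var row_reg, Nat_var limit_reg} s s')"
proof -
  let ?W = "{Nat_var row_reg, Nat_var limit_reg}"
  let ?s = "s\<lparr>nvar := (nvar s)(limit_reg := 0)\<rparr>"
  have "terminates square_size s (1 + (n * (1 + 3) + 3) + 1)
      (\<lambda>s'. nvar s' limit_reg = n * n \<and> agree ?W s s')"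
    unfolding square_size_def
  proof (rule terminates_Seq)
    show "terminates (NAssign limit_reg (NConst 0)) s 1 (\<lambda>s1. s1 = ?s)"
      by (rule attains_straight) simp_all
    fix s1 assume s1: "s1 = ?s"
    have "terminates (For row_reg (NVar size_reg)
        (NAssign limit_reg (NAdd (NVar limit_reg) (NVar size_reg)))) s1 (n * (1 + 3) + 3)
        (\<lambda>s'. nvar s' limit_reg = n * n \<and> agree ?W s1 s')"
    proof (rule terminates_For[where I = "\<lambda>i s'. nvar s' limit_reg = i * n"])
      fix i s' assume "nvar s' limit_reg = i * n" "agree ?W s1 s'"
      then show "terminates (NAssign limit_reg (NAdd (NVar limit_reg) (NVar size_reg))) s' 1
          (\<lambda>s'. nvar s' limit_reg = Suc i * n)"
        using assms by (intro attains_straight) (auto simp: s1 agree_def configured_def)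
    qed (use assms in \<open>auto simp: s1 agree_def configured_def\<close>)
    then show "terminates (For row_reg (NVar size_reg)
        (NAssign limit_reg (NAdd (NVar limit_reg) (NVar size_reg)))) s1 (n * (1 + 3) + 3)
        (\<lambda>s'. nvar s' limit_reg = n * n \<and> agree ?W s s')"
      by (rule terminates_mono) (auto simp: s1 agree_def)
  qed
  then show ?thesis by (rule terminates_mono) auto
qed

lemma search_invariant_final:
  assumes I: "search_invariant (n * n) s" and n: "0 < n"
  shows "\<exists>\<delta>\<ge>0. swap_optimal (members s aid_arr) \<delta> \<and> real (n * n) * \<delta> \<le> opt_value {..<n} f k"
proof (intro exI conjI)
  let ?\<delta> = "max 0 (rvar s least_gain_reg)"
  have "members s solution_arr \<in> feasible {..<n} k"
    using I members_subset by (auto simp: search_invariant_def feasible_def)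
  then show "real (n * n) * ?\<delta> \<le> opt_value {..<n} f k"
    using I opt_value_ge[of "{..<n}" _ k f] by (fastforce simp: search_invariant_def)
  show "swap_optimal (members s aid_arr) ?\<delta>"
    using I n by (force simp: search_invariant_def swap_optimal_def)
qed simp

lemma local_search_terminates:
  assumes s: "configured s" and k: "1 \<le> k" "k < n"
  shows "terminates local_search s (local_search_time n) (\<lambda>s'. configured s' \<and>
    (\<exists>\<delta>\<ge>0. swap_optimal (members s' aid_arr) \<delta> \<and> real (n * n) * \<delta> \<le> opt_value {..<n} f k))"
proof -
  let ?rounds = "For round_reg (NVar limit_reg) swap_round"
  let ?T = "n * n * (swap_round_time n + 3) + 3"
  have "terminates local_search s ((n * 4 + 5) + ((n * 8 + 7) + ?T + 1) + 1)
      (search_invariant (n * n))"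
    unfolding local_search_def
  proof (rule terminates_Seq[OF square_size_terminates[OF s]])
    fix s1 assume "nvar s1 limit_reg = n * n \<and> agree {Nat_var row_reg, Nat_var limit_reg} s s1"
    then have s1: "configured s1" "nvar s1 limit_reg = n * n"
      using configured_agree[of _ s s1] s by auto
    show "terminates (store_initial solution_arr (NVar target_reg) ;; ?rounds) s1
        ((n * 8 + 7) + ?T + 1) (search_invariant (n * n))"
    proof (rule terminates_Seq[OF store_initial_terminates[where m = k]])
      fix s2 assume s2: "members s2 solution_arr = {..<k} \<and>
          agree {Nat_var cell_reg, Nat_array solution_arr} s1 s2"
      have "configured s2" using configured_agree[OF conjunct2[OF s2]] s1 by simp
      then have "search_invariant 0 s2"
        using s1 s2 k nonneg[of "{..<k}"] by (auto simp: search_invariant_def agree_def)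
      then show "terminates ?rounds s2 ?T (search_invariant (n * n))"
      proof (rule attains_For)
        show "search_invariant i (s'\<lparr>nvar := (nvar s')(round_reg := v)\<rparr>) \<longleftrightarrow> search_invariant i s'"
          for i v s'
          by (simp add: search_invariant_def configured_def)
        show "nval s' (NVar limit_reg) = n * n" if "search_invariant i s'" for i s'
          using that by (simp add: search_invariant_def)
      qed (use swap_round_invariant k swap_round_keeps in auto)
    qed (use s1 k in \<open>auto simp: configured_def agree_def\<close>)
  qed
  then show ?thesis
  proof (rule terminates_mono)
    show "configured s' \<and> (\<exists>\<delta>\<ge>0. swap_optimal (members s' aid_arr) \<delta> \<and>
        real (n * n) * \<delta> \<le> opt_value {..<n} f k)" if "search_invariant (n * n) s'" for s'
      using search_invariant_final[OF that] that k by (simp add: search_invariant_def)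
  qed (simp add: local_search_time_def)
qed

end

section \<open>Random greedy with an aided start\<close>

primrec ntimes :: "nat \<Rightarrow> nexp \<Rightarrow> nexp" where
  "ntimes 0 u = NConst 0"
| "ntimes (Suc m) u = NAdd u (ntimes m u)"

lemma nval_ntimes [simp]: "nval s (ntimes m u) = m * nval s u"
  by (induction m) auto

definition avoiding :: bexp where
  "avoiding = BAnd (BNot (NLess (NVar target_reg) (NConst 1000)))
     (BNot (NLess (ntimes 2 (NVar target_reg)) (ntimes 5 (NAdd (NVar round_reg) (NConst 1)))))"

definition eligible :: bexp where
  "eligible = BNot (BOr (member solution_arr (NVar row_reg))
     (BAnd avoiding (member aid_arr (NVar row_reg))))"

definition evaluate_insertion :: com where
  "evaluate_insertion = query_with key_reg solution_arr in_reg ;;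
     RAssign key_reg (RSub RZero (RVar key_reg))"

definition insert_chosen :: com where
  "insert_chosen = NStore solution_arr (NArr first_arr (NVar chosen_reg)) (NVar in_reg)"

definition greedy_round :: com where
  "greedy_round = list_pairs (NConst 1) eligible evaluate_insertion ;;
     draw (NSub (NVar target_reg) (NConst 1)) ;; insert_chosen"

definition keep_better :: com where
  "keep_better = (Query value_reg solution_arr ;; Query gain_reg aid_arr) ;;
     If (RLess (RVar value_reg) (RVar gain_reg)) (copy_array solution_arr aid_arr) Skip"

definition greedy :: com where
  "greedy = store_initial solution_arr (NConst 0) ;;
     For round_reg (NVar target_reg) greedy_round ;; keep_better"

definition aided_program :: com where
  "aided_program = local_search ;; greedy"

lemma greedy_round_keeps:
  "writes greedy_round \<inter> ({Nat_var round_reg, Nat_array aid_arr} \<union> parameter_locs) = {}"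
  by (auto simp: greedy_round_def insert_chosen_def writes_list_pairs evaluate_insertion_def
    writes_query_with writes_draw)

definition greedy_round_time :: "nat \<Rightarrow> nat" where
  "greedy_round_time n = list_time n 1 9 + select_time n + 5"

definition aided_time :: "nat \<Rightarrow> nat" where
  "aided_time n = local_search_time n + n * (greedy_round_time n + 3) + n * 12 + 21"

context submodular_machine
begin

definition eligible_set :: "nat \<Rightarrow> nat set \<Rightarrow> nat set \<Rightarrow> nat set" where
  "eligible_set i Z S = (if i < avoiding_rounds k then {..<n} - Z - S else {..<n} - S)"

lemma bval_eligible:
  assumes "configured s" "nvar s row_reg < n"
  shows "bval s eligible \<longleftrightarrow> nvar s row_reg \<in> eligible_set (nvar s round_reg) (members s aid_arr)
      (members s solution_arr)"
proof -
  have "i < 2 * k div 5 \<longleftrightarrow> 5 * (i + 1) \<le> 2 * k" for i by presburger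
  then have "bval s avoiding \<longleftrightarrow> nvar s round_reg < avoiding_rounds k"
    using assms(1) by (simp add: avoiding_def avoiding_rounds_def configured_def not_less)
  then show ?thesis using assms by (auto simp: eligible_def bval_member eligible_set_def)
qed

lemma list_insertions_terminates:
  fixes s :: state
  defines "S \<equiv> members s solution_arr"
    and "E \<equiv> eligible_set (nvar s round_reg) (members s aid_arr) (members s solution_arr)"
  assumes s: "configured s"
  shows "terminates (list_pairs (NConst 1) eligible evaluate_insertion) s (list_time n 1 9) (\<lambda>s'.
    agree (token_locs \<union> {Nat_var save_reg, Real_var key_reg}) s s' \<and>
    tokens_listed s' (E \<times> {0}) (\<lambda>x. - f (insert (fst x) S)))"
proof (rule list_pairs_terminates)
  let ?W = "token_locs \<union> {Nat_var save_reg, Real_var key_reg}"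
  show "nvar s size_reg = n" using s by (simp add: configured_def)
  show "E \<times> {0} \<subseteq> {..<n} \<times> {..<1::nat}" by (auto simp: E_def eligible_set_def)
  show "token_locs \<inter> writes evaluate_insertion = {}"
    by (auto simp: evaluate_insertion_def writes_query_with)
  fix s' assume agree: "agree ?W s s'"
  have s': "configured s'" using configured_agree[OF agree] s by auto
  have same: "members s' solution_arr = S" "members s' aid_arr = members s aid_arr"
    "nvar s' round_reg = nvar s round_reg"
    using agree by (auto simp: S_def agree_def members_def)
  then show "bval s' eligible \<longleftrightarrow> (nvar s' row_reg, nvar s' col_reg) \<in> E \<times> {0}"
    if "nvar s' row_reg < n" "nvar s' col_reg < 1"
    using that s' by (simp add: bval_eligible E_def S_def)
  assume "(nvar s' row_reg, nvar s' col_reg) \<in> E \<times> {0}"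
  then have "nvar s' row_reg < n" by (auto simp: E_def eligible_set_def split: if_splits)
  with s' same agree show "terminates evaluate_insertion s' 9 (\<lambda>s''. agree ?W s s'' \<and>
      rvar s'' key_reg = - f (insert (fst (nvar s' row_reg, nvar s' col_reg)) S))"
    by (intro attains_straight)
      (simp_all add: evaluate_insertion_def effect_query_with agree_def, simp_all add: query_with_def)
qed auto

definition greedy_invariant :: "nat set \<Rightarrow> nat \<Rightarrow> state \<Rightarrow> bool" where
  "greedy_invariant Z i s \<longleftrightarrow> configured s \<and> members s aid_arr = Z \<and> card (members s solution_arr) = i \<and>
     (i < avoiding_rounds k \<longrightarrow> members s solution_arr \<inter> Z = {})"

lemma card_eligible_set:
  assumes S: "S \<subseteq> {..<n}" "card S = i" "i < k" and Z: "Z \<subseteq> {..<n}" "card Z = k" and k: "10 * k \<le> n"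
  shows "k \<le> card (eligible_set i Z S)" "card (eligible_set i Z S) \<le> n"
proof -
  have finite: "finite S" "finite Z" using S(1) Z(1) finite_sub by auto
  have "n - card (Z \<union> S) \<le> card ({..<n} - (Z \<union> S))"
    using diff_card_le_card_Diff[of "Z \<union> S" "{..<n}"] finite by simp
  also have "\<dots> \<le> card (eligible_set i Z S)" by (intro card_mono) (auto simp: eligible_set_def)
  finally show "k \<le> card (eligible_set i Z S)" using card_Un_le[of Z S] S Z k by simp
  show "card (eligible_set i Z S) \<le> n"
    by (rule order_trans[OF card_mono[of "{..<n}"]]) (auto simp: eligible_set_def)
qed

lemma greedy_submartingale_tokens:
  assumes V: "greedy_submartingale k (avoiding_rounds k) Z V"
    and S: "S \<subseteq> {..<n}" "card S = i" "i < k" "i < avoiding_rounds k \<longrightarrow> S \<inter> Z = {}"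
    and T: "lowest (\<lambda>x. - f (insert (fst x) S)) (eligible_set i Z S \<times> {c}) T" "card T = k"
  shows "V i S \<le> average T (\<lambda>x. V (Suc i) (insert (fst x) S))"
proof -
  note fst_T = lowest_fst[OF T(1)]
  have "V i S \<le> average (fst ` T) (\<lambda>u. V (Suc i) (insert u S))"
    using V S fst_T(1) card_image[OF fst_T(2)] T(2)
      unfolding greedy_submartingale_def eligible_set_def by simp
  then show ?thesis using average_image[OF fst_T(2)] by (simp add: comp_def)
qed

lemma insert_chosen_terminates:
  assumes s: "configured s" "members s aid_arr = Z" "members s solution_arr = S"
    and S: "card S = i" "i < avoiding_rounds k \<longrightarrow> S \<inter> Z = {}"
      and chosen: "fst (chosen_token s) \<in> eligible_set i Z S"
  shows "terminates insert_chosen s 1 (\<lambda>s'. greedy_invariant Z (Suc i) s' \<and>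
      members s' solution_arr = insert (fst (chosen_token s)) S)"
proof (rule attains_straight)
  let ?u = "fst (chosen_token s)" and ?s = "effect insert_chosen s"
  have u: "?u < n" "?u \<notin> S" "i < avoiding_rounds k \<longrightarrow> ?u \<notin> Z"
    using chosen by (auto simp: eligible_set_def split: if_splits)
  have solution: "members ?s solution_arr = insert ?u S"
    using members_store(1)[OF s(1) u(1)] s(3) by (simp add: insert_chosen_def token_def)
  have "members ?s aid_arr = Z" "configured ?s"
    using s by (simp_all add: insert_chosen_def members_def configured_def)
  moreover have "finite S" using members_subset[of s solution_arr] finite_sub s(3) by simp
  ultimately show "greedy_invariant Z (Suc i) ?s \<and> members ?s solution_arr = insert ?u S"
    using S u solution by (simp add: greedy_invariant_def)
qed (simp_all add: insert_chosen_def)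

lemma draw_insert_attains:
  assumes s: "configured s" "members s aid_arr = Z" "members s solution_arr = S"
    and S: "card S = i" "i < k" "i < avoiding_rounds k \<longrightarrow> S \<inter> Z = {}"
      and V: "greedy_submartingale k (avoiding_rounds k) Z V"
    and listed: "tokens_listed s (eligible_set i Z S \<times> {0}) (\<lambda>x. - f (insert (fst x) S))"
      and E: "k \<le> card (eligible_set i Z S)"
  shows "attains (draw (NSub (NVar target_reg) (NConst 1)) ;; insert_chosen) s
      (select_time (card (eligible_set i Z S)) + 4)
    (greedy_invariant Z (Suc i)) (\<lambda>s'. V (Suc i) (members s' solution_arr)) (V i S)"
proof -
  let ?E = "eligible_set i Z S" and ?V = "\<lambda>x. V (Suc i) (insert (fst x) S)"
  let ?\<phi> = "\<lambda>s'. V (Suc i) (members s' solution_arr)"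
    and ?draw = "draw (NSub (NVar target_reg) (NConst 1))"
  have card: "card (?E \<times> {0::nat}) = card ?E" by (simp add: card_cartesian_product)
  note low = lowest_tokens[OF listed, unfolded card, OF E]
  have "S \<subseteq> {..<n}" unfolding s(3)[symmetric] by (rule members_subset)
  then have start: "V i S \<le> average (lowest_tokens s k) ?V"
    using greedy_submartingale_tokens[OF V _ S low] by simp
  have "attains (?draw ;; insert_chosen) s ((select_time (card ?E) + 2) + 1 + 1)
      (greedy_invariant Z (Suc i)) ?\<phi> (V i S)"
  proof (rule attains_Seq[OF attains_draw[OF listed, unfolded card, where V = ?V, OF _ E start]])
    show "nval s (NSub (NVar target_reg) (NConst 1)) + 1 = k"
      using s(1) S(2) by (simp add: configured_def)
    fix s' assume s': "agree (writes ?draw) s s' \<and> chosen_token s' \<in> lowest_tokens s k \<and>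
      (\<forall>j\<le>card ?E. chosen_token s' \<in> lowest_tokens s j \<longleftrightarrow> nvar s' wanted_reg < j)"
    then have "chosen_token s' \<in> ?E \<times> {0}" using low(1) by (auto simp: lowest_def)
    moreover have "configured s'" "members s' aid_arr = Z" "members s' solution_arr = S"
      using s' s by (auto simp: agree_def members_def configured_def writes_draw)
    ultimately have "terminates insert_chosen s' 1
        (\<lambda>s''. greedy_invariant Z (Suc i) s'' \<and> members s'' solution_arr
            = insert (fst (chosen_token s')) S)"
      using S by (intro insert_chosen_terminates) auto
    then have "attains insert_chosen s' 1
        (\<lambda>s''. greedy_invariant Z (Suc i) s'' \<and> members s'' solution_arr
            = insert (fst (chosen_token s')) S)
        ?\<phi> (?V (chosen_token s'))" by (rule attains_of_terminates) simp
    then show "attains insert_chosen s' 1 (greedy_invariant Z (Suc i)) ?\<phi> (?V (chosen_token s'))"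
      by (rule attains_mono) simp_all
  qed
  then show ?thesis by (rule attains_mono) simp_all
qed

lemma greedy_round_attains:
  assumes I: "greedy_invariant Z i s" and i: "nvar s round_reg = i" "i < k" and k: "10 * k \<le> n"
    and Z: "card Z = k"
    and V: "greedy_submartingale k (avoiding_rounds k) Z V"
  shows "attains greedy_round s (greedy_round_time n) (greedy_invariant Z (Suc i))
    (\<lambda>s'. V (Suc i) (members s' solution_arr)) (V i (members s solution_arr))"
proof -
  define S where "S = members s solution_arr"
  define E where "E = eligible_set i Z S"
  let ?list = "list_pairs (NConst 1) eligible evaluate_insertion"
    and ?\<phi> = "\<lambda>s'. V (Suc i) (members s' solution_arr)"
  let ?listed = "\<lambda>s1. agree (token_locs \<union> {Nat_var save_reg, Real_var key_reg}) s s1 \<and>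
    tokens_listed s1 (E \<times> {0}) (\<lambda>x. - f (insert (fst x) S))"
  have s: "configured s" "members s aid_arr = Z"
    and S: "card S = i" "i < avoiding_rounds k \<longrightarrow> S \<inter> Z = {}"
    using I by (auto simp: greedy_invariant_def S_def)
  have sub: "S \<subseteq> {..<n}" "Z \<subseteq> {..<n}" unfolding S_def s(2)[symmetric] by (rule members_subset)+
  note E = card_eligible_set[OF sub(1) S(1) i(2) sub(2) Z k, folded E_def]
  have "attains greedy_round s (list_time n 1 9 + (select_time (card E) + 4) + 1)
      (greedy_invariant Z (Suc i)) ?\<phi> (V i S)"
    unfolding greedy_round_def
  proof (rule attains_Seq)
    show "attains ?list s (list_time n 1 9) ?listed (\<lambda>_. V i S) (V i S)"
      using list_insertions_terminates[OF s(1)] unfolding i(1) s(2) E_def S_def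
        by (rule attains_of_terminates) simp
    show "attains (draw (NSub (NVar target_reg) (NConst 1)) ;; insert_chosen) s1
        (select_time (card E) + 4)
        (greedy_invariant Z (Suc i)) ?\<phi> (V i S)" if s1: "?listed s1" for s1
      unfolding E_def
    proof (rule draw_insert_attains[OF _ _ _ S(1) i(2) S(2) V])
      show "configured s1" "members s1 aid_arr = Z" "members s1 solution_arr = S"
        using s1 s by (auto simp: agree_def members_def configured_def S_def)
    qed (use s1 E(1) in \<open>simp_all add: E_def\<close>)
  qed
  then show ?thesis
    unfolding S_def by (rule attains_mono)
      (use select_time_mono[OF E(2)] in \<open>simp_all add: greedy_round_time_def\<close>)
qed

lemma keep_better_terminates:
  assumes s: "configured s"
  shows "terminates keep_better s (n * 4 + 8) (\<lambda>s'. members s' solution_arr =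
    (if f (members s solution_arr) < f (members s aid_arr) then members s aid_arr
        else members s solution_arr))"
    (is "terminates _ _ _ ?Q")
proof -
  let ?queries = "Query value_reg solution_arr ;; Query gain_reg aid_arr"
  let ?s = "s\<lparr>rvar := (rvar s)(value_reg := f (members s solution_arr), gain_reg := f
      (members s aid_arr))\<rparr>"
  have "terminates keep_better s (3 + ((n * 4 + 3) + 1) + 1) ?Q"
    unfolding keep_better_def
  proof (rule terminates_Seq)
    show "terminates ?queries s 3 (\<lambda>s1. s1 = ?s)"
      by (rule attains_straight) (simp_all add: oracle_members)
    have "terminates (copy_array solution_arr aid_arr) ?s (n * 4 + 3)
        (\<lambda>s'. members s' solution_arr = members ?s aid_arr \<and>
        agree {Nat_var cell_reg, Nat_array solution_arr} ?s s')"
      using s by (intro copy_array_terminates) (simp_all add: configured_def)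
    then have copy: "terminates (copy_array solution_arr aid_arr) ?s (n * 4 + 3)
        (\<lambda>s'. members s' solution_arr = members s aid_arr)"
      by (rule terminates_mono) auto
    fix s1 assume s1: "s1 = ?s"
    show "terminates (If (RLess (RVar value_reg) (RVar gain_reg))
        (copy_array solution_arr aid_arr) Skip) s1 ((n * 4 + 3) + 1) ?Q"
      unfolding s1
    proof (rule attains_If)
      show "terminates (copy_array solution_arr aid_arr) ?s (n * 4 + 3) ?Q"
        if "bval ?s (RLess (RVar value_reg) (RVar gain_reg))"
        using copy by (rule terminates_mono) (use that in auto)
    qed (auto intro!: attains_straight)
  qed
  then show ?thesis by (rule terminates_mono) auto
qed

lemma keep_better_attains:
  assumes I: "greedy_invariant Z k s" and Z: "Z \<in> feasible {..<n} k"
    and v: "v \<le> max (f (members s solution_arr)) (f Z)"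
  shows "attains keep_better s (n * 4 + 8) (\<lambda>s'. members s' solution_arr \<in> feasible {..<n} k)
    (\<lambda>s'. f (members s' solution_arr)) v"
proof -
  have s: "configured s" "members s aid_arr = Z" "members s solution_arr \<in> feasible {..<n} k"
    using I members_subset by (auto simp: greedy_invariant_def feasible_def)
  have "terminates keep_better s (n * 4 + 8)
      (\<lambda>s'. members s' solution_arr \<in> feasible {..<n} k \<and> v \<le> f (members s' solution_arr))"
    by (rule terminates_mono[OF keep_better_terminates[OF s(1)]])
      (use s(2,3) Z v in \<open>auto simp: max_def split: if_splits\<close>)
  then have "attains keep_better s (n * 4 + 8)
      (\<lambda>s'. members s' solution_arr \<in> feasible {..<n} k \<and> v \<le> f (members s' solution_arr))
      (\<lambda>s'. f (members s' solution_arr)) v" by (rule attains_of_terminates) simp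
  then show ?thesis by (rule attains_mono) simp_all
qed

lemma greedy_attains:
  assumes s: "configured s" "members s aid_arr = Z" and k: "10 * k \<le> n" and Z: "card Z = k"
    and V: "greedy_submartingale k (avoiding_rounds k) Z V" "\<And>S. V k S \<le> max (f S) (f Z)"
  shows "attains greedy s (n * (greedy_round_time n + 3) + n * 12 + 20)
      (\<lambda>s'. members s' solution_arr \<in> feasible {..<n} k)
    (\<lambda>s'. f (members s' solution_arr)) (V 0 {})"
    (is "attains _ _ _ ?Q ?\<phi> _")
proof -
  let ?rounds = "For round_reg (NVar target_reg) greedy_round"
    and ?T = "k * (greedy_round_time n + 3) + 3"
  have feasible: "Z \<in> feasible {..<n} k" using s(2) Z members_subset by (auto simp: feasible_def)
  have "attains greedy s ((n * 8 + 7) + (?T + (n * 4 + 8) + 1) + 1) ?Q ?\<phi> (V 0 {})"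
    unfolding greedy_def
  proof (rule attains_Seq[OF attains_of_terminates[OF store_initial_terminates[OF s(1),
    where m = 0]]])
    fix s1 assume s1: "members s1 solution_arr = {..<0} \<and>
        agree {Nat_var cell_reg, Nat_array solution_arr} s s1"
    then have "greedy_invariant Z 0 s1"
      using s configured_agree[OF conjunct2[OF s1]]
        by (auto simp: greedy_invariant_def agree_def members_def)
    then have "attains ?rounds s1 ?T (greedy_invariant Z k)
        (\<lambda>s'. V k (members s' solution_arr)) (V 0 (members s1 solution_arr))"
    proof (rule attains_For)
      show "greedy_invariant Z i (s'\<lparr>nvar := (nvar s')(round_reg := x)\<rparr>) \<longleftrightarrow> greedy_invariant Z i s'"
        for i x s'
        by (simp add: greedy_invariant_def configured_def)
      show "nval s' (NVar target_reg) = k" if "greedy_invariant Z i s'" for i s'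
        using that by (simp add: greedy_invariant_def configured_def)
    qed (use greedy_round_attains V(1) k Z greedy_round_keeps in auto)
    then have "attains (?rounds ;; keep_better) s1 (?T + (n * 4 + 8) + 1)
        ?Q ?\<phi> (V 0 (members s1 solution_arr))"
      by (rule attains_Seq[OF _ keep_better_attains[OF _ feasible V(2)]])
    then show "attains (?rounds ;; keep_better) s1 (?T + (n * 4 + 8) + 1) ?Q ?\<phi> (V 0 {})"
      using s1 by simp
  qed simp_all
  then show ?thesis
  proof (rule attains_mono)
    have "k * (greedy_round_time n + 3) \<le> n * (greedy_round_time n + 3)"
      using k by (intro mult_right_mono) auto
    then show "(n * 8 + 7) + (?T + (n * 4 + 8) + 1) + 1 \<le> n * (greedy_round_time n + 3) + n * 12 + 20"
      by simp
  qed simp_all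
qed

lemma aided_program_attains:
  assumes s: "configured s" and k: "1 \<le> k" "10 * k \<le> n"
  shows "attains aided_program s (aided_time n) (\<lambda>s'. members s' solution_arr \<in> feasible {..<n} k)
    (\<lambda>s'. f (members s' solution_arr)) ((exp (- 1) - 1000 / real n) * opt_value {..<n} f k)"
    (is "attains _ _ _ ?Q ?\<phi> ?v")
proof -
  let ?T = "n * (greedy_round_time n + 3) + n * 12 + 20"
  have "attains aided_program s (local_search_time n + ?T + 1) ?Q ?\<phi> ?v"
    unfolding aided_program_def
  proof (rule attains_Seq[OF attains_of_terminates[OF local_search_terminates[OF s]]])
    fix s1 assume "configured s1 \<and> (\<exists>\<delta>\<ge>0. swap_optimal (members s1 aid_arr) \<delta> \<and>
        real (n * n) * \<delta> \<le> opt_value {..<n} f k)"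
    then obtain \<delta> where s1: "configured s1" and \<delta>: "0 \<le> \<delta>" "real (n * n) * \<delta> \<le> opt_value {..<n} f k"
      and Z: "swap_optimal (members s1 aid_arr) \<delta>" by blast
    obtain V where V: "greedy_submartingale k (avoiding_rounds k) (members s1 aid_arr) V"
      "\<And>S. V k S \<le> max (f S) (f (members s1 aid_arr))" "?v \<le> V 0 {}"
      using greedy_potential_exists[of k "members s1 aid_arr" \<delta>] k \<delta> Z
        by (auto simp: swap_optimal_def)
    have "attains greedy s1 ?T ?Q ?\<phi> (V 0 {})"
      using Z by (intro greedy_attains[OF s1 refl k(2) _ V(1,2)]) (simp add: swap_optimal_def)
    then show "attains greedy s1 ?T ?Q ?\<phi> ?v" by (rule attains_mono) (use V(3) in simp_all)
  qed (use k in auto)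
  then show ?thesis by (rule attains_mono) (simp_all add: aided_time_def)
qed

end

section \<open>Double greedy on tokens\<close>

abbreviation (input) need_reg :: nat where "need_reg \<equiv> 17"
abbreviation (input) spread_reg :: nat where "spread_reg \<equiv> 5"
abbreviation (input) upper_arr :: nat where "upper_arr \<equiv> 4"

primrec rtimes :: "nat \<Rightarrow> rexp \<Rightarrow> rexp" where
  "rtimes 0 u = RZero"
| "rtimes (Suc m) u = RAdd u (rtimes m u)"

lemma rval_rtimes [simp]: "rval s (rtimes m u) = real m * rval s u"
  by (induction m) (auto simp: algebra_simps)

definition undecided :: bexp where
  "undecided = BAnd (member upper_arr (NVar row_reg)) (BNot (member solution_arr (NVar row_reg)))"

definition evaluate_gains :: com where
  "evaluate_gains = query_with gain_reg solution_arr in_reg ;; Query value_reg solution_arr ;;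
     RAssign gain_reg (RSub (RVar gain_reg) (RVar value_reg)) ;;
     query_with spread_reg upper_arr out_reg ;; Query value_reg upper_arr ;;
     RAssign spread_reg (RAdd (RVar gain_reg) (RSub (RVar spread_reg) (RVar value_reg))) ;;
     RAssign key_reg (RSub (RVar spread_reg) (rtimes 8192 (RVar gain_reg)))"

definition evaluate_token :: com where
  "evaluate_token = evaluate_gains ;;
     For cell_reg (NVar col_reg) (RAssign key_reg (RAdd (RVar key_reg) (rtimes 2 (RVar spread_reg))))"

text \<open>The rank of the chosen token is known, so its acceptance is decided without comparing keys.\<close>

definition decide_chosen :: com where
  "decide_chosen = If (NLess (NVar wanted_reg) (ntimes 4096 (NVar need_reg)))
     (insert_chosen ;; NAssign need_reg (NSub (NVar need_reg) (NConst 1)))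
     (NStore upper_arr (NArr first_arr (NVar chosen_reg)) (NVar out_reg))"

definition token_round :: com where
  "token_round = list_pairs (NConst 4096) undecided evaluate_token ;;
     draw (NSub (NVar count_reg) (NConst 1)) ;; decide_chosen"

definition double_greedy_program :: com where
  "double_greedy_program = store_initial solution_arr (NConst 0) ;;
     store_initial upper_arr (NVar size_reg) ;; NAssign need_reg (NVar target_reg) ;;
     For round_reg (NVar size_reg) token_round"

abbreviation "evaluation_locs \<equiv> {Nat_var save_reg, Nat_var cell_reg,
  Real_var gain_reg, Real_var value_reg, Real_var spread_reg, Real_var key_reg}"

lemma writes_evaluate_token: "writes evaluate_token
    = {Nat_array solution_arr, Nat_array upper_arr} \<union> evaluation_locs"
  by (auto simp: evaluate_token_def evaluate_gains_def writes_query_with)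

lemma token_round_keeps: "writes token_round \<inter> {Nat_var round_reg} = {}"
  by (auto simp: token_round_def writes_list_pairs writes_evaluate_token writes_draw decide_chosen_def
    insert_chosen_def)

definition token_round_time :: "nat \<Rightarrow> nat" where
  "token_round_time n = list_time n 4096 17000 + select_time (n * 4096) + 8"

definition double_greedy_time :: "nat \<Rightarrow> nat" where
  "double_greedy_time n = n * (token_round_time n + 3) + n * 16 + 21"

context submodular_machine
begin

abbreviation "gain_key X Y \<equiv> token_key 4096 (add_gain X) (\<lambda>u. add_gain X u + remove_gain Y u)"

lemma evaluate_gains_terminates:
  fixes s :: state
  defines "u \<equiv> nvar s row_reg" and "X \<equiv> members s solution_arr" and "Y \<equiv> members s upper_arr"
  assumes s: "configured s" and u: "u < n"
  shows "terminates evaluate_gains s 25 (\<lambda>s'. agree evaluation_locs s s' \<and>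
    rvar s' spread_reg = add_gain X u + remove_gain Y u \<and>
        rvar s' key_reg = rvar s' spread_reg - 8192 * add_gain X u)"
proof (rule attains_straight)
  have "configured (s\<lparr>nvar := (nvar s)(save_reg := a), rvar := r\<rparr>)" for a r
    using s by (simp add: configured_def)
  then show "agree evaluation_locs s (effect evaluate_gains s) \<and>
    rvar (effect evaluate_gains s) spread_reg = add_gain X u + remove_gain Y u \<and>
    rvar (effect evaluate_gains s) key_reg = rvar (effect evaluate_gains s) spread_reg
        - 8192 * add_gain X u"
    using s u by (simp add: evaluate_gains_def effect_query_with oracle_members agree_def u_def X_def
      Y_def)
qed (simp_all add: evaluate_gains_def query_with_def)

lemma evaluate_token_terminates:
  fixes s :: state
  defines "u \<equiv> nvar s row_reg" and "X \<equiv> members s solution_arr" and "Y \<equiv> members s upper_arr"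
  assumes s: "configured s" and u: "u < n" and j: "nvar s col_reg < 4096"
  shows "terminates evaluate_token s 17000
      (\<lambda>s'. agree evaluation_locs s s' \<and> rvar s' key_reg = gain_key X Y (u, nvar s col_reg))"
proof -
  let ?j = "nvar s col_reg" and ?spread = "add_gain X u + remove_gain Y u"
  let ?add = "RAssign key_reg (RAdd (RVar key_reg) (rtimes 2 (RVar spread_reg)))"
  let ?W = "{Nat_var cell_reg, Real_var key_reg}"
  have "terminates evaluate_token s (25 + (?j * (1 + 3) + 3) + 1)
      (\<lambda>s'. agree evaluation_locs s s' \<and> rvar s' key_reg = gain_key X Y (u, ?j))"
    unfolding evaluate_token_def
  proof (rule terminates_Seq[OF
    evaluate_gains_terminates[OF s u[unfolded u_def], folded u_def X_def Y_def]])
    fix s1 assume s1: "agree evaluation_locs s s1 \<and> rvar s1 spread_reg = ?spread \<and>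
      rvar s1 key_reg = rvar s1 spread_reg - 8192 * add_gain X u"
    let ?I = "\<lambda>i s'. rvar s' key_reg = (2 * real i + 1) * ?spread - 8192 * add_gain X u"
    have "terminates (For cell_reg (NVar col_reg) ?add) s1 (?j * (1 + 3) + 3)
        (\<lambda>s'. ?I ?j s' \<and> agree ?W s1 s')"
    proof (rule terminates_For[where I = ?I])
      fix i s' assume "?I i s'" "agree ?W s1 s'"
      then show "terminates ?add s' 1 (?I (Suc i))"
        using s1 by (intro attains_straight) (auto simp: agree_def algebra_simps)
    qed (use s1 in \<open>auto simp: agree_def\<close>)
    then show "terminates (For cell_reg (NVar col_reg) ?add) s1 (?j * (1 + 3) + 3)
        (\<lambda>s'. agree evaluation_locs s s' \<and> rvar s' key_reg = gain_key X Y (u, ?j))"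
      by (rule terminates_mono) (use s1 in \<open>auto simp: token_key_def agree_def\<close>)
  qed
  then show ?thesis by (rule terminates_mono) (use j in auto)
qed

lemma list_undecided_terminates:
  fixes s :: state
  defines "X \<equiv> members s solution_arr" and "Y \<equiv> members s upper_arr"
  assumes s: "configured s"
  shows "terminates (list_pairs (NConst 4096) undecided evaluate_token) s (list_time n 4096 17000)
      (\<lambda>s'.
    agree (token_locs \<union> evaluation_locs) s s' \<and>
        tokens_listed s' ((Y - X) \<times> {..<4096}) (gain_key X Y))"
proof (rule list_pairs_terminates)
  let ?W = "token_locs \<union> evaluation_locs"
  show "nvar s size_reg = n" using s by (simp add: configured_def)
  show "(Y - X) \<times> {..<4096} \<subseteq> {..<n} \<times> {..<4096}" using members_subset by (auto simp: Y_def)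
  show "token_locs \<inter> writes evaluate_token = {}" by (auto simp: writes_evaluate_token)
  fix s' assume agree: "agree ?W s s'"
  have s': "configured s'" using configured_agree[OF agree] s by auto
  have same: "members s' solution_arr = X" "members s' upper_arr = Y"
    using members_agree[OF agree] by (auto simp: X_def Y_def)
  then show "bval s' undecided \<longleftrightarrow> (nvar s' row_reg, nvar s' col_reg) \<in> (Y - X) \<times> {..<4096}"
    if "nvar s' row_reg < n" "nvar s' col_reg < 4096"
    using that s' by (simp add: undecided_def bval_member)
  assume "(nvar s' row_reg, nvar s' col_reg) \<in> (Y - X) \<times> {..<4096}"
  then have "nvar s' row_reg < n" "nvar s' col_reg < 4096"
    using members_subset[of s upper_arr] by (auto simp: Y_def)
  from evaluate_token_terminates[OF s' this] show
    "terminates evaluate_token s' 17000 (\<lambda>s''. agree ?W s s'' \<and>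
      rvar s'' key_reg = gain_key X Y (nvar s' row_reg, nvar s' col_reg))"
    by (rule terminates_mono) (use agree same in \<open>auto simp: agree_def\<close>)
qed auto

definition decision_invariant :: "nat \<Rightarrow> state \<Rightarrow> bool" where
  "decision_invariant i s \<longleftrightarrow> (let X = members s solution_arr; Y = members s upper_arr in
     configured s \<and> nvar s need_reg = k - card X \<and> X \<subseteq> Y \<and> card (Y - X) + i = n \<and> card X \<le> k \<and>
         k \<le> card Y)"

abbreviation "decision_value V s \<equiv> V (members s solution_arr) (members s upper_arr)"

lemma decide_chosen_terminates:
  assumes I: "decision_invariant i s"
    and u: "u = fst (chosen_token s)" "u \<in> members s upper_arr - members s solution_arr"
    and accept: "accept \<longleftrightarrow> nvar s wanted_reg < 4096 * (k - card (members s solution_arr))"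
    and room: "\<not> accept \<Longrightarrow> k < card (members s upper_arr)"
  shows "terminates decide_chosen s 4 (\<lambda>s'. decision_invariant (Suc i) s' \<and>
    members s' solution_arr = (if accept then insert u (members s solution_arr)
        else members s solution_arr) \<and>
    members s' upper_arr = (if accept then members s upper_arr else members s upper_arr - {u}))"
proof (rule attains_straight)
  let ?X = "members s solution_arr" and ?Y = "members s upper_arr" and ?s = "effect decide_chosen s"
  have s: "configured s" "nvar s need_reg = k - card ?X"
    and XY: "?X \<subseteq> ?Y" "card (?Y - ?X) + i = n" "card ?X \<le> k" "k \<le> card ?Y"
    using I by (auto simp: decision_invariant_def Let_def)
  have finite: "finite ?X" "finite ?Y" using members_subset finite_sub by blast+
  have "u < n" using u(2) members_subset[of s upper_arr] by auto
  note store = members_store[OF s(1) \<open>u < n\<close>]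
  have test: "bval s (NLess (NVar wanted_reg) (ntimes 4096 (NVar need_reg))) \<longleftrightarrow> accept"
    using s(2) accept by simp
  have "?s = (if accept
      then s\<lparr>narr := (narr s)(solution_arr := (narr s solution_arr)(u := nvar s in_reg)), nvar
          := (nvar s)(need_reg := nvar s need_reg - 1)\<rparr>
      else s\<lparr>narr := (narr s)(upper_arr := (narr s upper_arr)(u := nvar s out_reg))\<rparr>)"
    unfolding decide_chosen_def effect.simps test insert_chosen_def by (simp add: u(1) token_def)
  then have "members ?s solution_arr = (if accept then insert u ?X else ?X)"
    "members ?s upper_arr = (if accept then ?Y else ?Y - {u})"
    "nvar ?s need_reg = (if accept then k - card ?X - 1 else k - card ?X)"
    using s(2) by (simp_all add: store)
  moreover have "configured ?s"
    using s(1) by (simp add: decide_chosen_def insert_chosen_def configured_def)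
  moreover have "accept \<Longrightarrow> card ?X < k" using accept by (auto intro: ccontr)
  moreover have "insert u ?X \<subseteq> ?Y" "?X \<subseteq> ?Y - {u}" using XY(1) u(2) by auto
  moreover have "?Y - insert u ?X = ?Y - ?X - {u}" "?Y - {u} - ?X = ?Y - ?X - {u}" by auto
  moreover have "card (?Y - ?X - {u}) + Suc i = n"
    using card_Suc_Diff1[of "?Y - ?X" u] XY(2) u(2) finite by simp
  ultimately show "decision_invariant (Suc i) ?s \<and>
      members ?s solution_arr = (if accept then insert u ?X else ?X) \<and>
      members ?s upper_arr = (if accept then ?Y else ?Y - {u})"
    using XY(3,4) room u(2) finite unfolding decision_invariant_def Let_def
    by (cases accept) (simp_all del: effect.simps)
qed (simp_all add: decide_chosen_def insert_chosen_def)

lemma card_decision_tokens: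
  fixes s :: state
  defines "X \<equiv> members s solution_arr" and "Y \<equiv> members s upper_arr"
  assumes I: "decision_invariant i s" and i: "i < n"
  shows "1 \<le> card ((Y - X) \<times> {..<4096::nat})"
    and "4096 * (k - card X) \<le> card ((Y - X) \<times> {..<4096::nat})"
    and "4096 * (k - card X) = card ((Y - X) \<times> {..<4096::nat}) \<or> k < card Y"
proof -
  have "X \<subseteq> Y" "card (Y - X) + i = n" "card X \<le> k" "k \<le> card Y" and "finite X" "finite Y"
    using I finite_sub[OF members_subset] by (auto simp: decision_invariant_def Let_def X_def Y_def)
  then show "1 \<le> card ((Y - X) \<times> {..<4096::nat})"
    and "4096 * (k - card X) \<le> card ((Y - X) \<times> {..<4096::nat})"
    and "4096 * (k - card X) = card ((Y - X) \<times> {..<4096::nat}) \<or> k < card Y"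
    using i by (auto simp: card_cartesian_product card_Diff_subset)
qed

lemma token_average_ge:
  fixes s s' :: state
  defines "X \<equiv> members s solution_arr" and "Y \<equiv> members s upper_arr"
  defines "A \<equiv> (Y - X) \<times> {..<4096::nat}" and "T \<equiv> lowest_tokens s' (4096 * (k - card X))"
  assumes I: "decision_invariant i s" and i: "i < n" and V: "token_submartingale 4096 k V"
    and listed: "tokens_listed s' A (gain_key X Y)"
  shows "V X Y \<le> average A (\<lambda>x. if x \<in> T then V (insert (fst x) X) Y else V X (Y - {fst x}))"
proof -
  have XY: "X \<subseteq> Y" "Y \<subseteq> {..<n}" "X \<noteq> Y" "card X \<le> k" "k \<le> card Y"
    using I i members_subset by (auto simp: decision_invariant_def Let_def X_def Y_def)
  note low = lowest_tokens[OF listed card_decision_tokens(2)[OF I i, folded X_def Y_def, folded A_def]]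
  show ?thesis
    using V XY low unfolding token_submartingale_def A_def T_def by blast
qed

lemma draw_decide_attains:
  fixes s :: state
  defines "X \<equiv> members s solution_arr" and "Y \<equiv> members s upper_arr"
  defines "A \<equiv> (Y - X) \<times> {..<4096::nat}"
  assumes I: "decision_invariant i s" and i: "i < n" and V: "token_submartingale 4096 k V"
    and listed: "tokens_listed s A (gain_key X Y)"
  shows "attains (draw (NSub (NVar count_reg) (NConst 1)) ;; decide_chosen) s
    (select_time (card A) + 7) (decision_invariant (Suc i)) (decision_value V) (V X Y)"
proof -
  define need where "need = 4096 * (k - card X)"
  let ?draw = "draw (NSub (NVar count_reg) (NConst 1))" and ?T = "lowest_tokens s need"
  let ?V = "\<lambda>x. if x \<in> ?T then V (insert (fst x) X) Y else V X (Y - {fst x})"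
  note card_A = card_decision_tokens[OF I i, folded X_def Y_def, folded A_def need_def]
  note all = lowest_tokens_all[OF listed]
  have start: "V X Y \<le> average (lowest_tokens s (card A)) ?V" unfolding all
    by (rule token_average_ge[OF I i V, of s, folded X_def Y_def, folded A_def need_def, OF listed])
  have "attains (?draw ;; decide_chosen) s ((select_time (card A) + 2) + 4 + 1)
      (decision_invariant (Suc i)) (decision_value V) (V X Y)"
  proof (rule attains_Seq[OF attains_draw[OF listed, where V = ?V, OF _ order_refl start]])
    show "nval s (NSub (NVar count_reg) (NConst 1)) + 1 = card A"
      using tokens_listed_count[OF listed] card_A(1) by simp
    fix s' assume s': "agree (writes ?draw) s s' \<and> chosen_token s' \<in> lowest_tokens s (card A) \<and>
      (\<forall>j\<le>card A. chosen_token s' \<in> lowest_tokens s j \<longleftrightarrow> nvar s' wanted_reg < j)"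
    let ?u = "fst (chosen_token s')" and ?accept = "chosen_token s' \<in> ?T"
    let ?decided = "\<lambda>s''. decision_invariant (Suc i) s'' \<and>
      members s'' solution_arr = (if ?accept then insert ?u X else X) \<and>
      members s'' upper_arr = (if ?accept then Y else Y - {?u})"
    have u: "chosen_token s' \<in> A" using s' all by simp
    have same: "members s' solution_arr = X" "members s' upper_arr = Y"
      using s' by (auto simp: agree_def members_def X_def Y_def writes_draw)
    have I': "decision_invariant i s'"
      using I s'
      by (auto simp: decision_invariant_def Let_def configured_def agree_def members_def writes_draw)
    have "need \<noteq> card A" if "\<not> ?accept" using that u all by auto
    then have "k < card Y" if "\<not> ?accept" using that card_A(3) by (auto simp: need_def)
    then have "terminates decide_chosen s' 4 ?decided"
      using decide_chosen_terminates[OF I' refl, of ?accept] u s' card_A(2) unfolding same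
      by (auto simp: A_def need_def)
    then have "attains decide_chosen s' 4 ?decided (decision_value V) (?V (chosen_token s'))"
      by (rule attains_of_terminates) auto
    then show "attains decide_chosen s' 4 (decision_invariant (Suc i)) (decision_value V)
        (?V (chosen_token s'))"
      by (rule attains_mono) simp_all
  qed
  then show ?thesis by (rule attains_mono) simp_all
qed

lemma token_round_attains:
  assumes I: "decision_invariant i s" and i: "i < n" and V: "token_submartingale 4096 k V"
  shows "attains token_round s (token_round_time n) (decision_invariant (Suc i)) (decision_value V)
      (decision_value V s)"
proof -
  define A where "A = (members s upper_arr - members s solution_arr) \<times> {..<4096::nat}"
  let ?listed = "\<lambda>s1. agree (token_locs \<union> evaluation_locs) s s1 \<and>
    tokens_listed s1 A (gain_key (members s solution_arr) (members s upper_arr))"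
  have s: "configured s" and "card (members s upper_arr - members s solution_arr) \<le> n"
    using I by (auto simp: decision_invariant_def Let_def)
  then have A: "card A \<le> n * 4096" by (simp add: A_def card_cartesian_product)
  have "attains token_round s (list_time n 4096 17000 + (select_time (card A) + 7) + 1)
      (decision_invariant (Suc i)) (decision_value V) (decision_value V s)"
    unfolding token_round_def
  proof (rule attains_Seq)
    show "attains (list_pairs (NConst 4096) undecided evaluate_token) s
        (list_time n 4096 17000) ?listed
        (\<lambda>_. decision_value V s) (decision_value V s)"
      using list_undecided_terminates[OF s] unfolding A_def by (rule attains_of_terminates) simp
    fix s1 assume s1: "?listed s1"
    then have same: "members s1 solution_arr = members s solution_arr"
      "members s1 upper_arr = members s upper_arr"
      by (auto simp: agree_def members_def)
    have "decision_invariant i s1"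
      using I s1 by (auto simp: decision_invariant_def Let_def configured_def agree_def members_def)
    from draw_decide_attains[OF this i V, unfolded same, folded A_def]
    show "attains (draw (NSub (NVar count_reg) (NConst 1)) ;; decide_chosen) s1
        (select_time (card A) + 7)
        (decision_invariant (Suc i)) (decision_value V) (decision_value V s)" using s1 by simp
  qed
  then show ?thesis
    by (rule attains_mono) (use select_time_mono[OF A] in \<open>simp_all add: token_round_time_def\<close>)
qed

lemma token_rounds_attain:
  assumes I: "decision_invariant 0 s"
    and V: "token_submartingale 4096 k V" "\<And>A. A \<in> feasible {..<n} k \<Longrightarrow> V A A \<le> f A"
  shows "attains (For round_reg (NVar size_reg) token_round) s (n * (token_round_time n + 3) + 3)
    (\<lambda>s'. members s' solution_arr \<in> feasible {..<n} k)
        (\<lambda>s'. f (members s' solution_arr)) (decision_value V s)"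
proof -
  have "attains (For round_reg (NVar size_reg) token_round) s (n * (token_round_time n + 3) + 3)
      (decision_invariant n) (decision_value V) (decision_value V s)"
    using I
  proof (rule attains_For[where V = "\<lambda>_. decision_value V"])
    show "decision_invariant i (s'\<lparr>nvar := (nvar s')(round_reg := x)\<rparr>) \<longleftrightarrow> decision_invariant i s'"
      for i x s'
      by (simp add: decision_invariant_def configured_def)
    show "nval s' (NVar size_reg) = n" if "decision_invariant i s'" for i s'
      using that by (simp add: decision_invariant_def Let_def configured_def)
  qed (use token_round_attains V(1) token_round_keeps in auto)
  then show ?thesis
  proof (rule attains_mono)
    fix s' assume "decision_invariant n s'"
    then have "members s' solution_arr = members s' upper_arr" "card (members s' solution_arr) = k"
      using finite_sub[OF members_subset] by (auto simp: decision_invariant_def Let_def)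
    then show "members s' solution_arr \<in> feasible {..<n} k"
      "decision_value V s' \<le> f (members s' solution_arr)"
      using V(2) members_subset by (auto simp: feasible_def)
  qed simp_all
qed

lemma double_greedy_program_attains:
  assumes s: "configured s" and k: "k \<le> n" "k = n \<or> n \<le> 10 * k \<and> n \<le> 10 * (n - k)"
  shows "attains double_greedy_program s (double_greedy_time n)
      (\<lambda>s'. members s' solution_arr \<in> feasible {..<n} k)
    (\<lambda>s'. f (members s' solution_arr)) ((exp (- 1) - 10 ^ 24 / real n) * opt_value {..<n} f k)"
    (is "attains _ _ _ ?Q ?\<phi> ?v")
proof -
  let ?start = "NAssign need_reg (NVar target_reg)"
    and ?rounds = "For round_reg (NVar size_reg) token_round"
  let ?T = "n * (token_round_time n + 3) + 3"
  obtain V where V: "token_submartingale 4096 k V" "\<And>A. A \<in> feasible {..<n} k \<Longrightarrow> V A A \<le> f A"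
    "?v \<le> V {} {..<n}"
    using double_greedy_potential_exists[of k] k by auto
  have rounds: "attains ?rounds s1 ?T ?Q ?\<phi> ?v"
    if "decision_invariant 0 s1" "members s1 solution_arr = {}" "members s1 upper_arr = {..<n}" for s1
    by (rule attains_mono[OF token_rounds_attain[OF that(1) V(1,2)]]) (use that V(3) in simp_all)
  have "attains double_greedy_program s ((n * 8 + 7) + ((n * 8 + 7) + (1 + ?T + 1) + 1) + 1) ?Q ?\<phi> ?v"
    unfolding double_greedy_program_def
  proof (rule attains_Seq[OF attains_of_terminates[OF store_initial_terminates[OF s, where m = 0]]])
    fix s1 assume s1: "members s1 solution_arr = {..<0} \<and>
        agree {Nat_var cell_reg, Nat_array solution_arr} s s1"
    have s1': "configured s1" using configured_agree[OF conjunct2[OF s1]] s by simp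
    show "attains (store_initial upper_arr (NVar size_reg) ;; ?start ;; ?rounds) s1
        ((n * 8 + 7) + (1 + ?T + 1) + 1) ?Q ?\<phi> ?v"
    proof (rule attains_Seq[OF attains_of_terminates[OF store_initial_terminates[where m = n]]])
      fix s2 assume s2: "members s2 upper_arr = {..<n} \<and>
          agree {Nat_var cell_reg, Nat_array upper_arr} s1 s2"
      have "configured s2" using configured_agree[OF conjunct2[OF s2]] s1' by simp
      moreover have "members s2 solution_arr = {}" using s1 s2 by (auto simp: agree_def members_def)
      ultimately have "attains ?start s2 1 (\<lambda>s3. decision_invariant 0 s3 \<and>
          members s3 solution_arr = {} \<and> members s3 upper_arr = {..<n}) (\<lambda>_. ?v) ?v"
        using s2 k(1) by (intro attains_straight) (auto simp: decision_invariant_def configured_def)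
      then show "attains (?start ;; ?rounds) s2 (1 + ?T + 1) ?Q ?\<phi> ?v"
        by (rule attains_Seq) (use rounds in auto)
    qed (use s1' in \<open>auto simp: configured_def agree_def\<close>)
  qed auto
  then show ?thesis by (rule attains_mono) (simp_all add: double_greedy_time_def)
qed

end

section \<open>The algorithm\<close>

abbreviation (input) parameter_reg :: nat where "parameter_reg \<equiv> 1"

definition set_polarity :: "bool \<Rightarrow> nexp \<Rightarrow> com" where
  "set_polarity direct u = NAssign target_reg u ;; NAssign in_reg (NConst (of_bool direct)) ;;
     NAssign out_reg (NConst (of_bool (\<not> direct)))"

definition main_program :: com where
  "main_program =
     If (BNot (NLess (NVar size_reg) (ntimes 10 (NVar parameter_reg))))
       (set_polarity True (NVar parameter_reg) ;; aided_program)
       (If (BAnd (NLess (NVar parameter_reg) (NVar size_reg))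
             (BNot (NLess (NVar size_reg) (ntimes 10 (NSub (NVar size_reg) (NVar parameter_reg))))))
         (set_polarity False (NSub (NVar size_reg) (NVar parameter_reg)) ;; aided_program)
         (set_polarity True (NVar parameter_reg) ;; double_greedy_program))"

definition main_time :: "nat \<Rightarrow> nat" where
  "main_time n = aided_time n + double_greedy_time n + 8"

definition is_polynomial :: "(nat \<Rightarrow> nat) \<Rightarrow> bool" where
  "is_polynomial T \<longleftrightarrow> (\<exists>p. \<forall>n. poly p n = T n)"

lemma is_polynomial_const: "is_polynomial (\<lambda>_. c)"
  unfolding is_polynomial_def by (rule exI[of _ "[:c:]"]) simp

lemma is_polynomial_id: "is_polynomial (\<lambda>n. n)"
  unfolding is_polynomial_def by (rule exI[of _ "[:0, 1:]"]) simp

lemma is_polynomial_add: "is_polynomial S \<Longrightarrow> is_polynomial T \<Longrightarrow> is_polynomial (\<lambda>n. S n + T n)"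
  unfolding is_polynomial_def by (metis poly_add)

lemma is_polynomial_mult: "is_polynomial S \<Longrightarrow> is_polynomial T \<Longrightarrow> is_polynomial (\<lambda>n. S n * T n)"
  unfolding is_polynomial_def by (metis poly_mult)

lemma is_polynomial_main_time: "is_polynomial main_time"
  unfolding main_time_def[abs_def] aided_time_def local_search_time_def swap_round_time_def
    greedy_round_time_def
    double_greedy_time_def token_round_time_def list_time_def select_time_def
  by (intro is_polynomial_add is_polynomial_mult is_polynomial_const is_polynomial_id)

context submodular_machine
begin

lemma set_polarity_terminates:
  assumes "nvar s size_reg = n" "nval s u = k"
  shows "terminates (set_polarity direct u) s 5 configured"
  using assms by (intro attains_straight) (simp_all add: set_polarity_def configured_def)

lemma opt_value_oracle:
  assumes "k \<le> n"
  shows "opt_value {..<n} f k = opt_value {..<n} g (if direct then k else n - k)"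
proof (cases direct)
  case True
  then have "f ` feasible {..<n} k = g ` feasible {..<n} k"
    using answers by (intro image_cong) (auto simp: feasible_def)
  then show ?thesis using True by (simp add: opt_value_def)
next
  case False
  then have "f ` feasible {..<n} k = (\<lambda>S. g ({..<n} - S)) ` feasible {..<n} k"
    using answers by (intro image_cong) (auto simp: feasible_def)
  then show ?thesis using False assms opt_value_complement[of "{..<n}" "n - k" g]
    by (simp add: opt_value_def)
qed

lemma attains_output:
  assumes s: "nvar s size_reg = n" "nval s u = k" and k: "k \<le> n"
    and k': "k' = (if direct then k else n - k)"
    and P: "\<And>s. configured s \<Longrightarrow> attains P s T (\<lambda>s'. members s' solution_arr \<in> feasible {..<n} k)
      (\<lambda>s'. f (members s' solution_arr)) ((exp (- 1) - c / real n) * opt_value {..<n} f k)"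
    and c: "c \<le> 10 ^ 24"
  shows "attains (set_polarity direct u ;; P) s (T + 6)
      (\<lambda>s'. array_set n s' solution_arr \<in> feasible {..<n} k')
    (\<lambda>s'. g (array_set n s' solution_arr)) ((exp (- 1) - 10 ^ 24 / real n) * opt_value {..<n} g k')"
proof -
  have "attains (set_polarity direct u ;; P) s (5 + T + 1)
      (\<lambda>s'. members s' solution_arr \<in> feasible {..<n} k)
      (\<lambda>s'. f (members s' solution_arr)) ((exp (- 1) - c / real n) * opt_value {..<n} f k)"
    by (rule attains_Seq[OF attains_of_terminates[OF set_polarity_terminates[OF s]] P]) simp_all
  then show ?thesis
  proof (rule attains_mono)
    obtain S where "S \<subseteq> {..<n}" "f S = opt_value {..<n} f k"
      using opt_value_attained[of "{..<n}" k f] k by auto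
    then have "0 \<le> opt_value {..<n} f k" using nonneg by metis
    moreover have "exp (- 1) - 10 ^ 24 / real n \<le> exp (- 1) - c / real n"
      using c by (simp add: divide_right_mono)
    ultimately show "(exp (- 1) - 10 ^ 24 / real n) * opt_value {..<n} g k'
        \<le> (exp (- 1) - c / real n) * opt_value {..<n} f k"
      unfolding k' opt_value_oracle[OF k, symmetric] by (intro mult_right_mono)
    show "array_set n s' solution_arr \<in> feasible {..<n} k'"
      if "members s' solution_arr \<in> feasible {..<n} k" for s'
      using that k' unfolding array_set_members
      by (auto simp: feasible_def card_Diff_subset finite_subset)
  qed (simp_all add: oracle_members)
qed

end

context oracle_machine
begin

lemma main_program_attains:
  assumes g: "nonneg_submodular {..<n} g" and k: "1 \<le> k" "k \<le> n"
  shows "attains main_program (init_state n k) (main_time n)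
      (\<lambda>s. array_set n s solution_arr \<in> feasible {..<n} k)
    (\<lambda>s. g (array_set n s solution_arr)) ((exp (- 1) - 10 ^ 24 / real n) * opt_value {..<n} g k)"
    (is "attains _ ?s _ ?Q ?\<phi> ?v")
proof -
  interpret pos: submodular_machine n g g True k
    using g by unfold_locales (auto simp: nonneg_submodular_def)
  interpret neg: submodular_machine n g "\<lambda>S. g ({..<n} - S)" False "n - k"
    using nonneg_submodular.nonneg_submodular_complement[OF g]
      by unfold_locales (auto simp: nonneg_submodular_def)
  have small: "attains (set_polarity True (NVar parameter_reg) ;;
      aided_program) ?s (aided_time n + 6) ?Q ?\<phi> ?v" if "10 * k \<le> n"
    by (rule pos.attains_output[OF _ _ _ _ pos.aided_program_attains])
      (use that k in \<open>auto simp: init_state_def\<close>)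
  have large: "attains (set_polarity False (NSub (NVar size_reg) (NVar parameter_reg)) ;;
      aided_program) ?s (aided_time n + 6) ?Q ?\<phi> ?v"
    if "k < n" "10 * (n - k) \<le> n"
    by (rule neg.attains_output[OF _ _ _ _ neg.aided_program_attains])
      (use that k in \<open>auto simp: init_state_def\<close>)
  have middle: "attains (set_polarity True (NVar parameter_reg) ;;
      double_greedy_program) ?s (double_greedy_time n + 6) ?Q ?\<phi> ?v"
    if "k = n \<or> n \<le> 10 * k \<and> n \<le> 10 * (n - k)"
    by (rule pos.attains_output[OF _ _ _ _ pos.double_greedy_program_attains])
      (use that k in \<open>auto simp: init_state_def\<close>)
  let ?T = "aided_time n + double_greedy_time n + 6"
  have "attains main_program ?s (?T + 1 + 1) ?Q ?\<phi> ?v"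
    unfolding main_program_def
    by (rule attains_If attains_mono[OF small] attains_mono[OF large] attains_mono[OF middle] | use k
      in \<open>force simp: init_state_def\<close>)+
  then show ?thesis by (rule attains_mono) (simp_all add: main_time_def)
qed

lemma attains_result:
  assumes "attains c s T Q \<phi> v"
  shows "\<forall>x\<in>set_pmf (steps n g T ([c], s)). halted x \<and> Q (snd x)"
    and "v \<le> measure_pmf.expectation (steps n g T ([c], s)) (\<lambda>x. \<phi> (snd x))"
proof -
  obtain D where D: "outcome [c] s D" "\<forall>x\<in>set_pmf D. snd x \<le> T \<and> Q (fst x)"
    "v \<le> measure_pmf.expectation D (\<lambda>x. \<phi> (fst x))"
    using assms unfolding attains_stack_def by auto
  have "steps n g T ([c], s) = map_pmf (\<lambda>x. ([], fst x)) D"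
    using D by (intro outcome_steps) auto
  then show "\<forall>x\<in>set_pmf (steps n g T ([c], s)). halted x \<and> Q (snd x)"
    and "v \<le> measure_pmf.expectation (steps n g T ([c], s)) (\<lambda>x. \<phi> (snd x))"
    using D by (auto simp: halted_def)
qed

end

lemma run_main_program:
  assumes e: "bij_betw e {..<card N} N" and f: "submodular_on N f" "nonneg_on N f"
    and k: "1 \<le> k" "k \<le> card N" and D: "D = run main_program N e f k (main_time (card N))"
  shows "\<forall>c\<in>set_pmf D. halted c \<and> output_set N e c \<in> feasible N k"
    and "(exp (- 1) - 10 ^ 24 / real (card N)) * opt_value N f k
        \<le> measure_pmf.expectation D (\<lambda>c. f (output_set N e c))"
proof -
  let ?n = "card N" and ?g = "\<lambda>I. f (e ` I)"
  have feasible: "e ` I \<in> feasible N k" if "I \<in> feasible {..<?n} k" for I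
    using that e by (auto simp: feasible_def bij_betw_def card_image inj_on_subset)
  have "nonneg_submodular {..<?n} ?g" using e f by (intro nonneg_submodular_image) auto
  note result = oracle_machine.attains_result[OF oracle_machine.main_program_attains[OF this k],
      folded run_def opt_value_image[OF e] D output_set_def]
  show "\<forall>c\<in>set_pmf D. halted c \<and> output_set N e c \<in> feasible N k"
    using result(1) feasible unfolding output_set_def by blast
  show "(exp (- 1) - 10 ^ 24 / real (card N)) * opt_value N f k
      \<le> measure_pmf.expectation D (\<lambda>c. f (output_set N e c))"
    by (rule result(2))
qed

theorem theorem1p3:
  "\<exists>(P :: com) (p :: nat poly) (\<epsilon> :: nat \<Rightarrow> real).
     \<epsilon> \<longlonglongrightarrow> 0 \<and>
     (\<forall>(N :: 'a set) (e :: nat \<Rightarrow> 'a) (f :: 'a set \<Rightarrow> real) (k :: nat).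
        finite N \<longrightarrow> bij_betw e {..<card N} N \<longrightarrow>
        submodular_on N f \<longrightarrow> nonneg_on N f \<longrightarrow> 1 \<le> k \<longrightarrow> k \<le> card N \<longrightarrow>
        (let D = run P N e f k (poly p (card N)) in
           (\<forall>c \<in> set_pmf D. halted c \<and> output_set N e c \<in> feasible N k) \<and>
           measure_pmf.expectation D (\<lambda>c. f (output_set N e c))
             \<ge> (exp (- 1) - \<epsilon> (card N)) * opt_value N f k))"
proof -
  obtain p where p: "\<And>n. poly p n = main_time n"
    using is_polynomial_main_time unfolding is_polynomial_def by auto
  show ?thesis
  proof (intro exI conjI allI impI)
    show "(\<lambda>n. 10 ^ 24 / real n) \<longlonglongrightarrow> 0" by (rule lim_const_over_n)
    fix N :: "'a set" and e f k
    assume "bij_betw e {..<card N} N" "submodular_on N f" "nonneg_on N f" "1 \<le> k" "k \<le> card N"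
    from run_main_program[OF this refl]
    show "let D = run main_program N e f k (poly p (card N)) in
        (\<forall>c \<in> set_pmf D. halted c \<and> output_set N e c \<in> feasible N k) \<and>
        measure_pmf.expectation D (\<lambda>c. f (output_set N e c))
          \<ge> (exp (- 1) - 10 ^ 24 / real (card N)) * opt_value N f k"
      unfolding Let_def p by (rule conjI)
  qed
qed

end
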